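(* Let $H$ be a semisimple Hopf algebra over $k$, $A\subseteq H$ a Hopf subalgebra, $C\subseteq H$ a simple subcoalgebra such that $Ca\subseteq C$ for all $a\in A$, and $V\subseteq C$ an irreducible left coideal of $H$. Let $p:H\to H/HA^+$ be the canonical projection, $\overline C=p(C)$, and let $\psi:A\to C^*$ and the $2$-cocycle $\alpha:A\otimes A\to k$ be as described in the context. Then $\left(\operatorname{End}^{\overline C}V\right)^{\mathrm{op}}\simeq A_\alpha$ as algebras. Moreover, $A_\alpha$ (embedded through $\psi$) and $\overline C^*$ (embedded through the transpose of $p|_C$) form a commuting pair in $(\operatorname{End}V)^{\mathrm{op}}\simeq C^*$; that is, each of these two subalgebras is the centralizer of the other.
   Context: $k$ is an algebraically closed field of characteristic zero. $A^+=A\cap\ker\epsilon$; $H/HA^+$ is a quotient coalgebra of $H$, and $\overline C=p(C)$ is a subcoalgebra of it. $V$ is regarded as a left $\overline C$-comodule via $(p\otimes\mathrm{id})\rho$, where $\rho=\Delta|_V$ is its left coaction, and $\operatorname{End}^{\overline C}V$ is the algebra of $\overline C$-comodule endomorphisms of $V$. The identification $C^*\simeq(\operatorname{End}V)^{\mathrm{op}}$ is given by the algebra anti-isomorphism $I:C^*\to\operatorname{End}V$, $I(f)(v)=\langle f,v_{-1}\rangle v_0$, where $\rho(v)=v_{-1}\otimes v_0$. $C^*$ is a left $A$-module algebra via $(a.f)(c)=f(ca)$. Since $C^*$ is a simple algebra, by the Skolem–Noether theorem for Hopf algebras there is a convolution invertible map $\psi:A\to C^*$, normalized by $\psi(1)=1$,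 with $a.f=\psi(a_1)f\psi^{-1}(a_2)$ for all $f\in C^*$, $a\in A$, where $\psi^{-1}$ is the convolution inverse. Then $\alpha(a,b)=\psi^{-1}(a_1b_1)\psi(a_2)\psi(b_2)$ is scalar valued and defines a $2$-cocycle $\alpha:A\otimes A\to k$. $A_\alpha$ denotes the crossed product $A\#_\alpha k$: the vector space $A$ with multiplication $a\cdot b=\alpha(a_2,b_2)\,a_1b_1$; then $\psi:A_\alpha\to C^*$ is an algebra map. *)

theory Defs
  imports
    "HOL-Computational_Algebra.Polynomial"
    "HOL-Library.Poly_Mapping"
    "HOL-Library.Function_Algebras"
    "HOL-Algebra.Module"
begin

text \<open>
  An element of a tensor product \<open>U \<otimes> W\<close> is given by a representative in the free vector space
  on pairs, of type \<open>'a \<times> 'b \<Rightarrow>\<^sub>0 'k\<close>; equality in \<open>U \<otimes> W\<close> is equality modulo the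
  subspace spanned by the usual bilinearity relations.  For subspaces \<open>X\<close> of \<open>U\<close> and \<open>Y\<close> of \<open>W\<close>
  the space \<open>X \<otimes> Y\<close> is a subspace of \<open>U \<otimes> W\<close> (the scalars form a field), consisting of the
  classes that have a representative supported in \<open>X \<times> Y\<close>.
\<close>

definition free_scale :: "'k::field \<Rightarrow> ('a \<Rightarrow>\<^sub>0 'k) \<Rightarrow> ('a \<Rightarrow>\<^sub>0 'k)" where
  "free_scale c t = Poly_Mapping.map ((*) c) t"

definition fun_scale :: "'k::field \<Rightarrow> ('a \<Rightarrow> 'k) \<Rightarrow> ('a \<Rightarrow> 'k)" where
  "fun_scale c f = (\<lambda>x. c * f x)"

lemma lookup_free_scale: "Poly_Mapping.lookup (free_scale c t) z = c * Poly_Mapping.lookup t z"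
  by (simp add: free_scale_def Poly_Mapping.map.rep_eq when_def)

lemma vector_space_free_scale: "vector_space free_scale"
  by unfold_locales
    (auto intro!: poly_mapping_eqI simp: lookup_free_scale lookup_add algebra_simps)

lemma vector_space_fun_scale: "vector_space fun_scale"
  by unfold_locales (auto simp: fun_scale_def algebra_simps)

text \<open>
  The linear extension of \<open>F\<close> to the free vector space.  If \<open>F\<close> is bilinear, this is the map
  induced on the tensor product, i.e. \<open>lin_ext s (\<lambda>(x, y). F x y) (\<Delta> c)\<close> is
  \<open>F c\<^sub>1 c\<^sub>2\<close> in Sweedler notation.
\<close>

definition lin_ext ::
  "('k::field \<Rightarrow> 'b::comm_monoid_add \<Rightarrow> 'b) \<Rightarrow> ('a \<Rightarrow> 'b) \<Rightarrow> ('a \<Rightarrow>\<^sub>0 'k) \<Rightarrow> 'b" where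
  "lin_ext s F t = (\<Sum>z\<in>Poly_Mapping.keys t. s (Poly_Mapping.lookup t z) (F z))"

definition pure :: "'a \<Rightarrow> 'a \<Rightarrow>\<^sub>0 'k::field" where
  "pure z = Poly_Mapping.single z 1"

definition tensor_null ::
  "('k::field \<Rightarrow> 'a::ab_group_add \<Rightarrow> 'a) \<Rightarrow> ('k \<Rightarrow> 'b::ab_group_add \<Rightarrow> 'b) \<Rightarrow> ('a \<times> 'b \<Rightarrow>\<^sub>0 'k) set"
  where "tensor_null s1 s2 = module.span free_scale
    ({pure (x + x', y) - pure (x, y) - pure (x', y) | x x' y. True} \<union>
     {pure (x, y + y') - pure (x, y) - pure (x, y') | x y y'. True} \<union>
     {pure (s1 c x, y) - free_scale c (pure (x, y)) | c x y. True} \<union>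
     {pure (x, s2 c y) - free_scale c (pure (x, y)) | c x y. True})"

definition tensor_eq ::
  "('k::field \<Rightarrow> 'a::ab_group_add \<Rightarrow> 'a) \<Rightarrow> ('k \<Rightarrow> 'b::ab_group_add \<Rightarrow> 'b) \<Rightarrow>
   ('a \<times> 'b \<Rightarrow>\<^sub>0 'k) \<Rightarrow> ('a \<times> 'b \<Rightarrow>\<^sub>0 'k) \<Rightarrow> bool" where
  "tensor_eq s1 s2 t u \<longleftrightarrow> t - u \<in> tensor_null s1 s2"

definition tensor3_null ::
  "('k::field \<Rightarrow> 'a::ab_group_add \<Rightarrow> 'a) \<Rightarrow> ('a \<times> 'a \<times> 'a \<Rightarrow>\<^sub>0 'k) set" where
  "tensor3_null s = module.span free_scale
    ({pure (x + x', y, z) - pure (x, y, z) - pure (x', y, z) | x x' y z. True} \<union>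
     {pure (x, y + y', z) - pure (x, y, z) - pure (x, y', z) | x y y' z. True} \<union>
     {pure (x, y, z + z') - pure (x, y, z) - pure (x, y, z') | x y z z'. True} \<union>
     {pure (s c x, y, z) - free_scale c (pure (x, y, z)) | c x y z. True} \<union>
     {pure (x, s c y, z) - free_scale c (pure (x, y, z)) | c x y z. True} \<union>
     {pure (x, y, s c z) - free_scale c (pure (x, y, z)) | c x y z. True})"

definition tensor3_eq ::
  "('k::field \<Rightarrow> 'a::ab_group_add \<Rightarrow> 'a) \<Rightarrow>
   ('a \<times> 'a \<times> 'a \<Rightarrow>\<^sub>0 'k) \<Rightarrow> ('a \<times> 'a \<times> 'a \<Rightarrow>\<^sub>0 'k) \<Rightarrow> bool" where
  "tensor3_eq s t u \<longleftrightarrow> t - u \<in> tensor3_null s"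

definition tensor_map ::
  "('a \<Rightarrow> 'c) \<Rightarrow> ('b \<Rightarrow> 'd) \<Rightarrow> ('a \<times> 'b \<Rightarrow>\<^sub>0 'k::field) \<Rightarrow> ('c \<times> 'd \<Rightarrow>\<^sub>0 'k)" where
  "tensor_map f g = lin_ext free_scale (\<lambda>(x, y). pure (f x, g y))"

definition tensor_mult ::
  "('a::ring_1 \<times> 'a \<Rightarrow>\<^sub>0 'k::field) \<Rightarrow> ('a \<times> 'a \<Rightarrow>\<^sub>0 'k) \<Rightarrow> ('a \<times> 'a \<Rightarrow>\<^sub>0 'k)" where
  "tensor_mult t u = lin_ext free_scale
     (\<lambda>(x, y). lin_ext free_scale (\<lambda>(x', y'). pure (x * x', y * y')) u) t"

definition tensor_in ::
  "('k::field \<Rightarrow> 'a::ab_group_add \<Rightarrow> 'a) \<Rightarrow> ('k \<Rightarrow> 'b::ab_group_add \<Rightarrow> 'b) \<Rightarrow>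
   'a set \<Rightarrow> 'b set \<Rightarrow> ('a \<times> 'b \<Rightarrow>\<^sub>0 'k) \<Rightarrow> bool" where
  "tensor_in s1 s2 X Y t \<longleftrightarrow> (\<exists>u. Poly_Mapping.keys u \<subseteq> X \<times> Y \<and> tensor_eq s1 s2 u t)"

text \<open>
  For \<open>t\<close> in \<open>X \<otimes> Y\<close>, a representative supported in \<open>X \<times> Y\<close>.  It is needed to apply maps that
  are defined (or linear) only on \<open>X\<close> and \<open>Y\<close>; the result does not depend on the choice.
\<close>

definition tensor_restrict ::
  "('k::field \<Rightarrow> 'a::ab_group_add \<Rightarrow> 'a) \<Rightarrow> ('k \<Rightarrow> 'b::ab_group_add \<Rightarrow> 'b) \<Rightarrow>
   'a set \<Rightarrow> 'b set \<Rightarrow> ('a \<times> 'b \<Rightarrow>\<^sub>0 'k) \<Rightarrow> ('a \<times> 'b \<Rightarrow>\<^sub>0 'k)" where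
  "tensor_restrict s1 s2 X Y t =
     (SOME u. Poly_Mapping.keys u \<subseteq> X \<times> Y \<and> tensor_eq s1 s2 u t)"

definition linear_on ::
  "('k::field \<Rightarrow> 'a::ab_group_add \<Rightarrow> 'a) \<Rightarrow> ('k \<Rightarrow> 'b::ab_group_add \<Rightarrow> 'b) \<Rightarrow>
   'a set \<Rightarrow> ('a \<Rightarrow> 'b) \<Rightarrow> bool" where
  "linear_on s1 s2 X f \<longleftrightarrow>
     (\<forall>x\<in>X. \<forall>y\<in>X. f (x + y) = f x + f y) \<and> (\<forall>c. \<forall>x\<in>X. f (s1 c x) = s2 c (f x))"

text \<open>
  A coalgebra whose underlying space is the subspace \<open>X\<close> of the type.  The representatives
  \<open>\<Delta> x\<close> are taken with support in \<open>X \<times> X\<close>.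
\<close>

locale coalgebra_on = vector_space scale
  for scale :: "'k::field \<Rightarrow> 'a::ab_group_add \<Rightarrow> 'a" +
  fixes X :: "'a set"
    and \<Delta> :: "'a \<Rightarrow> ('a \<times> 'a \<Rightarrow>\<^sub>0 'k)"
    and \<epsilon> :: "'a \<Rightarrow> 'k"
  assumes subspace_carrier: "module.subspace scale X"
    and comult_closed: "x \<in> X \<Longrightarrow> Poly_Mapping.keys (\<Delta> x) \<subseteq> X \<times> X"
    and comult_add: "x \<in> X \<Longrightarrow> y \<in> X \<Longrightarrow> tensor_eq scale scale (\<Delta> (x + y)) (\<Delta> x + \<Delta> y)"
    and comult_scale: "x \<in> X \<Longrightarrow> tensor_eq scale scale (\<Delta> (scale c x)) (free_scale c (\<Delta> x))"
    and counit_linear: "linear_on scale (*) X \<epsilon>"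
    and coassoc: "x \<in> X \<Longrightarrow> tensor3_eq scale
      (lin_ext free_scale (\<lambda>(u, v). lin_ext free_scale (\<lambda>(u1, u2). pure (u1, u2, v)) (\<Delta> u)) (\<Delta> x))
      (lin_ext free_scale (\<lambda>(u, v). lin_ext free_scale (\<lambda>(v1, v2). pure (u, v1, v2)) (\<Delta> v)) (\<Delta> x))"
    and counit_left: "x \<in> X \<Longrightarrow> lin_ext scale (\<lambda>(u, v). scale (\<epsilon> u) v) (\<Delta> x) = x"
    and counit_right: "x \<in> X \<Longrightarrow> lin_ext scale (\<lambda>(u, v). scale (\<epsilon> v) u) (\<Delta> x) = x"

locale hopf_algebra = coalgebra_on scale UNIV \<Delta> \<epsilon>
  for scale :: "'k::field \<Rightarrow> 'h::ring_1 \<Rightarrow> 'h"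
    and \<Delta> :: "'h \<Rightarrow> ('h \<times> 'h \<Rightarrow>\<^sub>0 'k)"
    and \<epsilon> :: "'h \<Rightarrow> 'k" +
  fixes S :: "'h \<Rightarrow> 'h"
  assumes scale_mult_left: "scale c x * y = scale c (x * y)"
    and scale_mult_right: "x * scale c y = scale c (x * y)"
    and comult_one: "tensor_eq scale scale (\<Delta> 1) (pure (1, 1))"
    and comult_mult: "tensor_eq scale scale (\<Delta> (x * y)) (tensor_mult (\<Delta> x) (\<Delta> y))"
    and counit_one: "\<epsilon> 1 = 1"
    and counit_mult: "\<epsilon> (x * y) = \<epsilon> x * \<epsilon> y"
    and antipode_linear: "linear_on scale scale UNIV S"
    and antipode_left: "lin_ext scale (\<lambda>(u, v). S u * v) (\<Delta> x) = scale (\<epsilon> x) 1"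
    and antipode_right: "lin_ext scale (\<lambda>(u, v). u * S v) (\<Delta> x) = scale (\<epsilon> x) 1"

text \<open>A left ideal; in a unital algebra it is automatically a linear subspace.\<close>

definition left_ideal :: "'h::ring_1 set \<Rightarrow> bool" where
  "left_ideal L \<longleftrightarrow> 0 \<in> L \<and> (\<forall>x\<in>L. \<forall>y\<in>L. x + y \<in> L) \<and> (\<forall>h. \<forall>x\<in>L. h * x \<in> L)"

definition semisimple_ring :: "'h::ring_1 itself \<Rightarrow> bool" where
  "semisimple_ring TYPE('h) \<longleftrightarrow>
     (\<forall>L::'h set. left_ideal L \<longrightarrow>
        (\<exists>L'. left_ideal L' \<and> L \<inter> L' = {0} \<and> (\<forall>h. \<exists>x\<in>L. \<exists>y\<in>L'. h = x + y)))"

definition subcoalgebra ::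
  "('k::field \<Rightarrow> 'a::ab_group_add \<Rightarrow> 'a) \<Rightarrow> ('a \<Rightarrow> ('a \<times> 'a \<Rightarrow>\<^sub>0 'k)) \<Rightarrow> 'a set \<Rightarrow> bool" where
  "subcoalgebra scale \<Delta> C \<longleftrightarrow>
     module.subspace scale C \<and> (\<forall>c\<in>C. tensor_in scale scale C C (\<Delta> c))"

definition simple_subcoalgebra ::
  "('k::field \<Rightarrow> 'a::ab_group_add \<Rightarrow> 'a) \<Rightarrow> ('a \<Rightarrow> ('a \<times> 'a \<Rightarrow>\<^sub>0 'k)) \<Rightarrow> 'a set \<Rightarrow> bool" where
  "simple_subcoalgebra scale \<Delta> C \<longleftrightarrow>
     subcoalgebra scale \<Delta> C \<and> C \<noteq> {0} \<and>
     (\<forall>D. subcoalgebra scale \<Delta> D \<and> D \<subseteq> C \<longrightarrow> D = {0} \<or> D = C)"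

definition left_coideal ::
  "('k::field \<Rightarrow> 'a::ab_group_add \<Rightarrow> 'a) \<Rightarrow> ('a \<Rightarrow> ('a \<times> 'a \<Rightarrow>\<^sub>0 'k)) \<Rightarrow> 'a set \<Rightarrow> bool" where
  "left_coideal scale \<Delta> V \<longleftrightarrow>
     module.subspace scale V \<and> (\<forall>v\<in>V. tensor_in scale scale UNIV V (\<Delta> v))"

definition irreducible_left_coideal ::
  "('k::field \<Rightarrow> 'a::ab_group_add \<Rightarrow> 'a) \<Rightarrow> ('a \<Rightarrow> ('a \<times> 'a \<Rightarrow>\<^sub>0 'k)) \<Rightarrow> 'a set \<Rightarrow> bool" where
  "irreducible_left_coideal scale \<Delta> V \<longleftrightarrow>
     left_coideal scale \<Delta> V \<and> V \<noteq> {0} \<and>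
     (\<forall>W. left_coideal scale \<Delta> W \<and> W \<subseteq> V \<longrightarrow> W = {0} \<or> W = V)"

definition hopf_subalgebra ::
  "('k::field \<Rightarrow> 'h::ring_1 \<Rightarrow> 'h) \<Rightarrow> ('h \<Rightarrow> ('h \<times> 'h \<Rightarrow>\<^sub>0 'k)) \<Rightarrow> ('h \<Rightarrow> 'h) \<Rightarrow> 'h set \<Rightarrow> bool" where
  "hopf_subalgebra scale \<Delta> S A \<longleftrightarrow>
     subcoalgebra scale \<Delta> A \<and> 1 \<in> A \<and> (\<forall>a\<in>A. \<forall>b\<in>A. a * b \<in> A) \<and> (\<forall>a\<in>A. S a \<in> A)"

text \<open>The left ideal \<open>H A\<^sup>+\<close>, where \<open>A\<^sup>+ = A \<inter> ker \<epsilon>\<close>.\<close>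

definition left_ideal_plus ::
  "('k::field \<Rightarrow> 'h::ring_1 \<Rightarrow> 'h) \<Rightarrow> ('h \<Rightarrow> 'k) \<Rightarrow> 'h set \<Rightarrow> 'h set" where
  "left_ideal_plus scale \<epsilon> A = module.span scale {h * a | h a. a \<in> A \<and> \<epsilon> a = 0}"

text \<open>
  The quotient coalgebra of \<open>H\<close> by \<open>I\<close> with its projection, up to isomorphism: a coalgebra on \<open>Q\<close>
  and a coalgebra map \<open>p\<close> from \<open>H\<close> onto \<open>Q\<close> with kernel \<open>I\<close>.  As \<open>Q\<close> is allowed to be a subspace
  of its type, such a model exists already in the type of \<open>H\<close> (a complement of \<open>I\<close>).
\<close>

definition quotient_coalgebra ::
  "('k::field \<Rightarrow> 'h::ab_group_add \<Rightarrow> 'h) \<Rightarrow> ('h \<Rightarrow> ('h \<times> 'h \<Rightarrow>\<^sub>0 'k)) \<Rightarrow> ('h \<Rightarrow> 'k) \<Rightarrow> 'h set \<Rightarrow>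
   ('k \<Rightarrow> 'q::ab_group_add \<Rightarrow> 'q) \<Rightarrow> 'q set \<Rightarrow> ('q \<Rightarrow> ('q \<times> 'q \<Rightarrow>\<^sub>0 'k)) \<Rightarrow> ('q \<Rightarrow> 'k) \<Rightarrow>
   ('h \<Rightarrow> 'q) \<Rightarrow> bool" where
  "quotient_coalgebra scale \<Delta> \<epsilon> I scaleQ Q \<Delta>Q \<epsilon>Q p \<longleftrightarrow>
     coalgebra_on scaleQ Q \<Delta>Q \<epsilon>Q \<and>
     Vector_Spaces.linear scale scaleQ p \<and>
     range p = Q \<and> {h. p h = 0} = I \<and>
     (\<forall>h. tensor_eq scaleQ scaleQ (\<Delta>Q (p h)) (tensor_map p p (\<Delta> h))) \<and>
     (\<forall>h. \<epsilon>Q (p h) = \<epsilon> h)"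

text \<open>
  Algebras whose carrier is a subset of a type are bundled in the record \<open>module\<close> of HOL-Algebra.
  Maps defined only on a subspace are normalised to vanish outside it.
\<close>

definition algebra_hom ::
  "('k, 'a, 'm) module_scheme \<Rightarrow> ('k, 'b, 'n) module_scheme \<Rightarrow> ('a \<Rightarrow> 'b) set" where
  "algebra_hom M N =
     {f \<in> ring_hom M N. \<forall>c. \<forall>x\<in>carrier M. f (c \<odot>\<^bsub>M\<^esub> x) = c \<odot>\<^bsub>N\<^esub> f x}"

definition algebra_iso ::
  "('k, 'a, 'm) module_scheme \<Rightarrow> ('k, 'b, 'n) module_scheme \<Rightarrow> ('a \<Rightarrow> 'b) set" where
  "algebra_iso M N = {f \<in> algebra_hom M N. bij_betw f (carrier M) (carrier N)}"

definition centralizer :: "('a, 'm) monoid_scheme \<Rightarrow> 'a set \<Rightarrow> 'a set" where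
  "centralizer M Y = {x \<in> carrier M. \<forall>y\<in>Y. x \<otimes>\<^bsub>M\<^esub> y = y \<otimes>\<^bsub>M\<^esub> x}"

definition dual_algebra ::
  "('k::field \<Rightarrow> 'a::ab_group_add \<Rightarrow> 'a) \<Rightarrow> ('a \<Rightarrow> ('a \<times> 'a \<Rightarrow>\<^sub>0 'k)) \<Rightarrow> ('a \<Rightarrow> 'k) \<Rightarrow> 'a set \<Rightarrow>
   ('k, 'a \<Rightarrow> 'k) module" where
  "dual_algebra scale \<Delta> \<epsilon> C =
     \<lparr>carrier = {f. linear_on scale (*) C f \<and> (\<forall>x. x \<notin> C \<longrightarrow> f x = 0)},
      mult = (\<lambda>f g c. if c \<in> C
        then lin_ext (*) (\<lambda>(x, y). f x * g y) (tensor_restrict scale scale C C (\<Delta> c)) else 0),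
      one = (\<lambda>c. if c \<in> C then \<epsilon> c else 0),
      zero = 0, add = (+), smult = fun_scale\<rparr>"

text \<open>The algebra \<open>(End V)\<^sup>o\<^sup>p\<close>: the product of \<open>T\<close> and \<open>U\<close> is \<open>U \<circ> T\<close>.\<close>

definition end_op ::
  "('k::field \<Rightarrow> 'a::ab_group_add \<Rightarrow> 'a) \<Rightarrow> 'a set \<Rightarrow> ('k, 'a \<Rightarrow> 'a) module" where
  "end_op scale V =
     \<lparr>carrier = {T. linear_on scale scale V T \<and> T ` V \<subseteq> V \<and> (\<forall>x. x \<notin> V \<longrightarrow> T x = 0)},
      mult = (\<lambda>T U. U \<circ> T),
      one = (\<lambda>v. if v \<in> V then v else 0),
      zero = 0, add = (+), smult = (\<lambda>c T v. scale c (T v))\<rparr>"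

text \<open>
  The opposite algebra of the endomorphisms of a left comodule \<open>V\<close> with coaction
  \<open>\<rho> : V \<rightarrow> D \<otimes> V\<close>, given by representatives with second components in \<open>V\<close>;
  \<open>scaleD\<close> is the scalar multiplication of the coalgebra \<open>D\<close>.
\<close>

definition comodule_end_op ::
  "('k::field \<Rightarrow> 'q::ab_group_add \<Rightarrow> 'q) \<Rightarrow> ('k \<Rightarrow> 'a::ab_group_add \<Rightarrow> 'a) \<Rightarrow> 'a set \<Rightarrow>
   ('a \<Rightarrow> ('q \<times> 'a \<Rightarrow>\<^sub>0 'k)) \<Rightarrow> ('k, 'a \<Rightarrow> 'a) module" where
  "comodule_end_op scaleD scale V \<rho> = (end_op scale V)
     \<lparr>carrier := {T \<in> carrier (end_op scale V).
        \<forall>v\<in>V. tensor_eq scaleD scale (\<rho> (T v)) (tensor_map id T (\<rho> v))}\<rparr>"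

text \<open>
  The coaction \<open>v \<mapsto> v\<^sub>-\<^sub>1 \<otimes> v\<^sub>0\<close> of a left coideal \<open>V \<subseteq> C\<close>, i.e. \<open>\<Delta>\<close> restricted to \<open>V\<close>, with
  representatives supported in \<open>C \<times> V\<close>.
\<close>

definition coaction ::
  "('k::field \<Rightarrow> 'a::ab_group_add \<Rightarrow> 'a) \<Rightarrow> ('a \<Rightarrow> ('a \<times> 'a \<Rightarrow>\<^sub>0 'k)) \<Rightarrow> 'a set \<Rightarrow> 'a set \<Rightarrow>
   'a \<Rightarrow> ('a \<times> 'a \<Rightarrow>\<^sub>0 'k)" where
  "coaction scale \<Delta> C V v = tensor_restrict scale scale C V (\<Delta> v)"

text \<open>The map \<open>I(f)(v) = \<langle>f, v\<^sub>-\<^sub>1\<rangle> v\<^sub>0\<close> from \<open>C\<^sup>*\<close> to \<open>End V\<close>.\<close>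

definition dual_to_end ::
  "('k::field \<Rightarrow> 'a::ab_group_add \<Rightarrow> 'a) \<Rightarrow> ('a \<Rightarrow> ('a \<times> 'a \<Rightarrow>\<^sub>0 'k)) \<Rightarrow> 'a set \<Rightarrow> 'a set \<Rightarrow>
   ('a \<Rightarrow> 'k) \<Rightarrow> ('a \<Rightarrow> 'a)" where
  "dual_to_end scale \<Delta> C V f =
     (\<lambda>v. if v \<in> V then lin_ext scale (\<lambda>(x, w). scale (f x) w) (coaction scale \<Delta> C V v) else 0)"

definition transpose_on :: "'a set \<Rightarrow> ('a \<Rightarrow> 'q) \<Rightarrow> ('q \<Rightarrow> 'k::field) \<Rightarrow> ('a \<Rightarrow> 'k)" where
  "transpose_on C p f = (\<lambda>c. if c \<in> C then f (p c) else 0)"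

text \<open>
  The map \<open>\<psi> : A \<rightarrow> C\<^sup>*\<close> with convolution inverse \<open>\<psi>'\<close>, normalised and implementing the action
  \<open>(a.f)(c) = f(ca)\<close> of \<open>A\<close> on \<open>C\<^sup>*\<close>.
\<close>

definition implements_action ::
  "('k::field \<Rightarrow> 'h::ring_1 \<Rightarrow> 'h) \<Rightarrow> ('h \<Rightarrow> ('h \<times> 'h \<Rightarrow>\<^sub>0 'k)) \<Rightarrow> ('h \<Rightarrow> 'k) \<Rightarrow> 'h set \<Rightarrow> 'h set \<Rightarrow>
   ('h \<Rightarrow> 'h \<Rightarrow> 'k) \<Rightarrow> ('h \<Rightarrow> 'h \<Rightarrow> 'k) \<Rightarrow> bool" where
  "implements_action scale \<Delta> \<epsilon> A C \<psi> \<psi>' \<longleftrightarrow>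
     (let D = dual_algebra scale \<Delta> \<epsilon> C; \<Delta>A = (\<lambda>a. tensor_restrict scale scale A A (\<Delta> a)) in
      linear_on scale fun_scale A \<psi> \<and> \<psi> ` A \<subseteq> carrier D \<and>
      linear_on scale fun_scale A \<psi>' \<and> \<psi>' ` A \<subseteq> carrier D \<and>
      (\<forall>a\<in>A. lin_ext fun_scale (\<lambda>(x, y). \<psi> x \<otimes>\<^bsub>D\<^esub> \<psi>' y) (\<Delta>A a) = fun_scale (\<epsilon> a) \<one>\<^bsub>D\<^esub>) \<and>
      (\<forall>a\<in>A. lin_ext fun_scale (\<lambda>(x, y). \<psi>' x \<otimes>\<^bsub>D\<^esub> \<psi> y) (\<Delta>A a) = fun_scale (\<epsilon> a) \<one>\<^bsub>D\<^esub>) \<and>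
      \<psi> 1 = \<one>\<^bsub>D\<^esub> \<and>
      (\<forall>a\<in>A. \<forall>f\<in>carrier D.
         (\<lambda>c. if c \<in> C then f (c * a) else 0) =
         lin_ext fun_scale (\<lambda>(x, y). \<psi> x \<otimes>\<^bsub>D\<^esub> f \<otimes>\<^bsub>D\<^esub> \<psi>' y) (\<Delta>A a)))"

text \<open>
  \<open>\<psi>'(a\<^sub>1 b\<^sub>1) \<psi>(a\<^sub>2) \<psi>(b\<^sub>2)\<close> is a scalar multiple of the unit of \<open>C\<^sup>*\<close> when \<open>\<psi>\<close>, \<open>\<psi>'\<close> implement the action
  and \<open>C\<close> is simple; \<open>\<alpha>(a, b)\<close> is that scalar.
\<close>

definition cocycle ::
  "('k::field \<Rightarrow> 'h::ring_1 \<Rightarrow> 'h) \<Rightarrow> ('h \<Rightarrow> ('h \<times> 'h \<Rightarrow>\<^sub>0 'k)) \<Rightarrow> ('h \<Rightarrow> 'k) \<Rightarrow> 'h set \<Rightarrow> 'h set \<Rightarrow>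
   ('h \<Rightarrow> 'h \<Rightarrow> 'k) \<Rightarrow> ('h \<Rightarrow> 'h \<Rightarrow> 'k) \<Rightarrow> 'h \<Rightarrow> 'h \<Rightarrow> 'k" where
  "cocycle scale \<Delta> \<epsilon> A C \<psi> \<psi>' a b =
     (let D = dual_algebra scale \<Delta> \<epsilon> C; \<Delta>A = (\<lambda>a. tensor_restrict scale scale A A (\<Delta> a)) in
      THE s. fun_scale s \<one>\<^bsub>D\<^esub> =
        lin_ext fun_scale (\<lambda>(a1, a2). lin_ext fun_scale (\<lambda>(b1, b2).
          \<psi>' (a1 * b1) \<otimes>\<^bsub>D\<^esub> \<psi> a2 \<otimes>\<^bsub>D\<^esub> \<psi> b2) (\<Delta>A b)) (\<Delta>A a))"

definition crossed_product ::
  "('k::field \<Rightarrow> 'h::ring_1 \<Rightarrow> 'h) \<Rightarrow> ('h \<Rightarrow> ('h \<times> 'h \<Rightarrow>\<^sub>0 'k)) \<Rightarrow> 'h set \<Rightarrow> ('h \<Rightarrow> 'h \<Rightarrow> 'k) \<Rightarrow>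
   ('k, 'h) module" where
  "crossed_product scale \<Delta> A \<alpha> =
     \<lparr>carrier = A,
      mult = (\<lambda>a b. lin_ext scale (\<lambda>(a1, a2). lin_ext scale (\<lambda>(b1, b2).
          scale (\<alpha> a2 b2) (a1 * b1)) (tensor_restrict scale scale A A (\<Delta> b)))
          (tensor_restrict scale scale A A (\<Delta> a))),
      one = 1, zero = 0, add = (+), smult = scale\<rparr>"

end

theory Submission
  imports Defs
begin

text \<open>
  The algebra \<open>C\<^sup>*\<close> acts irreducibly on \<open>V\<close>, so it is \<open>(End V)\<^sup>o\<^sup>p\<close> by Burnside's theorem.  As \<open>\<psi>\<close> implements the
  action of \<open>A\<close>, an element of \<open>C\<^sup>*\<close> commutes with \<open>\<psi>(A)\<close> iff it is \<open>A\<close>-invariant, and by means of a normalised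
  left integral \<open>e\<close> of \<open>A\<close> these are the functionals that vanish on the intersection of \<open>C\<close> with \<open>HA\<^sup>+\<close>, the
  transposes.  If \<open>T\<close> commutes with the invariants \<open>\<psi>(e\<^sub>1) f \<psi>\<^sup>-\<^sup>1(e\<^sub>2)\<close> for all \<open>f\<close>, then
  \<open>T \<psi>(e\<^sub>1) \<otimes> \<psi>\<^sup>-\<^sup>1(e\<^sub>2) = \<psi>(e\<^sub>1) \<otimes> \<psi>\<^sup>-\<^sup>1(e\<^sub>2) T\<close>, as \<open>C\<^sup>*\<close> is a matrix algebra; \<open>\<psi>\<^sup>-\<^sup>1\<close> is injective, so the second
  factor can be evaluated such that the left side becomes \<open>T\<close>, and the right side is in \<open>\<psi>(A)\<close>.  Endomorphisms of
  the \<open>p(C)\<close>-comodule \<open>V\<close> are those commuting with the transposes.  The integral \<open>e\<close> exists since a nonzero left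
  integral \<open>t\<close> of \<open>A\<close> with \<open>\<epsilon>(t) = 0\<close> would be incompatible with the growth of the tensor powers of \<open>H\<close> as
  \<open>A\<close>-modules.
\<close>

text \<open>Only \<open>H\<close> is assumed semisimple, while invariants are averaged over
  \<open>A\<close>; hence the work on a left integral of \<open>A\<close> with counit 1. Let
  \<open>t\<close> be a nonzero left integral of \<open>A\<close> with counit 0. Then an integral
  \<Lambda> of \<open>H\<close> with counit 1 lies outside t H, and some functional \<open>g\<close>
  kills t H and has g(\<Lambda>) = 1. The average x \<mapsto> g(\<Lambda>1) S(\<Lambda>2)
  \<phi>(\<Lambda>3 x) sends the identity \<phi> of a tensor power of \<open>H\<close> to itself,
  but an \<open>A\<close>-linear \<phi> through a free module to 0. An \<open>A\<close>-linear
  projection of \<open>H\<close> onto \<open>A\<close> with kernel \<open>N\<close> splits off free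
  parts, so the identity of the n-th power is a sum of maps through the n-th power of
  \<open>N\<close>, the number of terms being independent of n. As dim N < dim H, this fails for
  large n. Tensors are classes without normal form, and many maps are linear only on a subspace.
  Both difficulties are met by testing with pairs of functionals: identities become equations of
  scalar Sweedler sums, and linear projections extend maps from \<open>A\<close> and
  \<open>C\<close> to \<open>H\<close>.\<close>

abbreviation lmap ::
  "('k::field \<Rightarrow> 'a::ab_group_add \<Rightarrow> 'a) \<Rightarrow> ('k \<Rightarrow> 'b::ab_group_add \<Rightarrow> 'b) \<Rightarrow> ('a \<Rightarrow> 'b) \<Rightarrow> bool" where
  "lmap s1 s2 \<equiv> linear_on s1 s2 UNIV"

lemma lmap_iff: "lmap s1 s2 f \<longleftrightarrow> (\<forall>x y. f (x + y) = f x + f y) \<and> (\<forall>c x. f (s1 c x) = s2 c (f x))"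
  by (simp add: linear_on_def)

text \<open>\<open>lmap\<close> leaves the vector space axioms out of linearity, so that linearity
  goals unfold to equations for the simplifier; this is the bridge to the library notion.\<close>

lemma lmap_iff_linear:
  assumes "vector_space s1" "vector_space s2"
  shows "lmap s1 s2 f \<longleftrightarrow> Vector_Spaces.linear s1 s2 f"
  using assms by (simp add: lmap_iff Vector_Spaces.linear_iff)

lemma vector_space_times: "vector_space ((*) :: 'k::field \<Rightarrow> 'k \<Rightarrow> 'k)"
  by unfold_locales (auto simp: algebra_simps)

definition bilin ::
  "('k::field \<Rightarrow> 'a::ab_group_add \<Rightarrow> 'a) \<Rightarrow> ('k \<Rightarrow> 'b::ab_group_add \<Rightarrow> 'b) \<Rightarrow>
   ('k \<Rightarrow> 'c::ab_group_add \<Rightarrow> 'c) \<Rightarrow> ('a \<Rightarrow> 'b \<Rightarrow> 'c) \<Rightarrow> bool" where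
  "bilin s1 s2 s3 F \<longleftrightarrow> (\<forall>y. lmap s1 s3 (\<lambda>x. F x y)) \<and> (\<forall>x. lmap s2 s3 (F x))"

lemma lmap_add: "lmap s1 s2 f \<Longrightarrow> f (x + y) = f x + f y"
  and lmap_scale: "lmap s1 s2 f \<Longrightarrow> f (s1 c x) = s2 c (f x)"
  by (auto simp: lmap_iff)

lemma lmap_zero:
  assumes "lmap s1 s2 f" shows "f 0 = 0"
  using lmap_add[OF assms, of 0 0] by simp

lemma lmap_uminus:
  assumes "lmap s1 s2 f" shows "f (- x) = - f x"
  using lmap_add[OF assms, of x "- x"] lmap_zero[OF assms] by (simp add: eq_neg_iff_add_eq_0 add.commute)

lemma lmap_diff:
  assumes "lmap s1 s2 f" shows "f (x - y) = f x - f y"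
  using lmap_add[OF assms, of x "- y"] lmap_uminus[OF assms] by simp

lemma lmap_sum:
  assumes "lmap s1 s2 f" shows "f (\<Sum>i\<in>I. g i) = (\<Sum>i\<in>I. f (g i))"
  by (induction I rule: infinite_finite_induct) (auto simp: lmap_zero[OF assms] lmap_add[OF assms])

lemma lmap_compose: "lmap s1 s2 f \<Longrightarrow> lmap s2 s3 g \<Longrightarrow> lmap s1 s3 (\<lambda>x. g (f x))"
  by (auto simp: lmap_iff)

lemma bilin_add: "bilin s1 s2 s3 F \<Longrightarrow> F (x + x') y = F x y + F x' y"
  "bilin s1 s2 s3 F \<Longrightarrow> F x (y + y') = F x y + F x y'"
  and bilin_scale: "bilin s1 s2 s3 F \<Longrightarrow> F (s1 c x) y = s3 c (F x y)"
  "bilin s1 s2 s3 F \<Longrightarrow> F x (s2 c y) = s3 c (F x y)"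
  by (auto simp: bilin_def lmap_iff)

text \<open>Equations between functions: they also rewrite partial applications such as
  \<open>F (x + y)\<close> that occur as an eta-contracted argument of a Sweedler sum.\<close>

lemma bilin_fun:
  assumes "bilin s1 s2 s3 F"
  shows "F (x + y) = (\<lambda>z. F x z + F y z)" "F (s1 c x) = (\<lambda>z. s3 c (F x z))"
  using bilin_add(1)[OF assms] bilin_scale(1)[OF assms] by auto

lemma subspace_image:
  assumes s: "vector_space s1" "vector_space s2" and f: "lmap s1 s2 f" and X: "module.subspace s1 X"
  shows "module.subspace s2 (f ` X)"
proof -
  interpret v1: vector_space s1 by fact
  interpret v2: vector_space s2 by fact
  have "0 \<in> f ` X" using lmap_zero[OF f] v1.subspace_0[OF X] by force
  then show ?thesis
    using v1.subspace_add[OF X] v1.subspace_scale[OF X]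
    by (auto simp: v2.subspace_def simp flip: lmap_add[OF f] lmap_scale[OF f])
qed

section \<open>Projections onto subspaces and separation by linear functionals\<close>

context vector_space
begin

lemma subspace_projection:
  assumes "subspace X"
  obtains P where "lmap scale scale P" "\<And>x. P x \<in> X" "\<And>x. x \<in> X \<Longrightarrow> P x = x"
proof -
  interpret vector_space_pair scale scale by unfold_locales
  have "Vector_Spaces.linear scale scale id"
    by (simp add: linear_id)
  from linear_exists_left_inverse_on[OF this assms]
  obtain g where "range g \<subseteq> X" "Vector_Spaces.linear scale scale g" "\<forall>v\<in>X. g v = v"
    by auto
  then show ?thesis
    using that[of g] by (auto simp: lmap_iff_linear vector_space_axioms)
qed

lemma subspace_functional:
  assumes "subspace X" "v \<notin> X"
  obtains f where "lmap scale (*) f" "\<And>x. x \<in> X \<Longrightarrow> f x = 0" "f v = 1"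
proof -
  interpret vector_space_pair scale "(*)"
    using vector_space_axioms vector_space_times by (simp add: vector_space_pair_def)
  obtain B where B: "B \<subseteq> X" "independent B" "X \<subseteq> span B"
    by (rule maximal_independent_subset)
  then have XB: "X = span B"
    using assms(1) span_minimal by blast
  then have "independent (insert v B)"
    using assms(2) B by (simp add: independent_insertI)
  from linear_independent_extend[OF this, of "\<lambda>x. if x = v then 1 else 0"]
  obtain g where g: "Vector_Spaces.linear scale (*) g" "\<forall>x\<in>insert v B. g x = (if x = v then 1 else 0)"
    by blast
  have "g x = 0" if "x \<in> span B" for x
    using that
  proof (induction rule: span_induct_alt)
    case base
    then show ?case using linear_0[OF g(1)] by simp
  next
    case (step c b y)
    then have "g b = 0" using g(2) B(1) assms(2) by auto
    with step show ?case
      using linear_add[OF g(1)] linear_scale[OF g(1)] by simp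
  qed
  with g show ?thesis
    using that[of g] XB lmap_iff_linear[OF vector_space_axioms vector_space_times] by auto
qed

lemma zero_if_functionals:
  assumes "\<And>f. lmap scale (*) f \<Longrightarrow> f x = 0" shows "x = 0"
proof (rule ccontr)
  assume "x \<noteq> 0"
  then have "x \<notin> {0}" by simp
  then obtain f where "lmap scale (*) f" "f x = 1"
    using subspace_functional[OF subspace_single_0] by metis
  with assms[of f] show False by simp
qed

lemma eq_if_functionals:
  assumes "\<And>f. lmap scale (*) f \<Longrightarrow> f x = f y" shows "x = y"
proof -
  have "x - y = 0"
    by (rule zero_if_functionals) (use assms lmap_diff in fastforce)
  then show ?thesis by simp
qed

text \<open>A subspace is the intersection of the kernels of the functionals that vanish on it.
  Memberships proved by this rule need no explicit linear combination.\<close>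

lemma mem_if_functionals:
  assumes "subspace X" "\<And>f. lmap scale (*) f \<Longrightarrow> (\<And>y. y \<in> X \<Longrightarrow> f y = 0) \<Longrightarrow> f x = 0"
  shows "x \<in> X"
proof (rule ccontr)
  assume "x \<notin> X"
  then obtain f where "lmap scale (*) f" "\<And>x. x \<in> X \<Longrightarrow> f x = 0" "f x = 1"
    using subspace_functional[OF assms(1)] by metis
  with assms(2)[of f] show False by simp
qed

lemma linear_extension_from_subspace:
  assumes "subspace X" "linear_on scale s X f" "vector_space s"
  obtains g where "lmap scale s g" "\<And>x. x \<in> X \<Longrightarrow> g x = f x"
proof -
  obtain P where P: "lmap scale scale P" "\<And>x. P x \<in> X" "\<And>x. x \<in> X \<Longrightarrow> P x = x"
    using subspace_projection[OF assms(1)] by blast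
  have "lmap scale s (\<lambda>x. f (P x))"
    using assms(2) P by (auto simp: linear_on_def)
  then show ?thesis using that[of "\<lambda>x. f (P x)"] P(3) by simp
qed

end

section \<open>Linear extensions and tensors\<close>

lemma lin_ext_superset:
  assumes "vector_space s" "finite K" "Poly_Mapping.keys t \<subseteq> K"
  shows "lin_ext s F t = (\<Sum>z\<in>K. s (Poly_Mapping.lookup t z) (F z))"
proof -
  interpret vector_space s by fact
  show ?thesis
    unfolding lin_ext_def
    by (rule sum.mono_neutral_left) (use assms in \<open>auto simp: in_keys_iff\<close>)
qed

lemma lin_ext_add:
  assumes "vector_space s"
  shows "lin_ext s F (t + u) = lin_ext s F t + lin_ext s F u"
proof -
  interpret vector_space s by fact
  let ?K = "Poly_Mapping.keys t \<union> Poly_Mapping.keys u"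
  have K: "finite ?K" "Poly_Mapping.keys t \<subseteq> ?K" "Poly_Mapping.keys u \<subseteq> ?K" by auto
  have "Poly_Mapping.keys (t + u) \<subseteq> ?K"
    by (rule Poly_Mapping.keys_add)
  then show ?thesis
    using K by (simp add: lin_ext_superset[OF assms K(1)] lookup_add scale_left_distrib sum.distrib)
qed

lemma lin_ext_free_scale:
  assumes "vector_space s"
  shows "lin_ext s F (free_scale c t) = s c (lin_ext s F t)"
proof -
  interpret vector_space s by fact
  have "Poly_Mapping.keys (free_scale c t) \<subseteq> Poly_Mapping.keys t"
    by (auto simp: in_keys_iff lookup_free_scale)
  from lin_ext_superset[OF assms finite_keys this, of F] show ?thesis
    by (simp add: lin_ext_def[of s F t] lookup_free_scale scale_sum_right)
qed

lemma lmap_lin_ext: "vector_space s \<Longrightarrow> lmap free_scale s (lin_ext s F)"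
  by (simp add: lmap_iff lin_ext_add lin_ext_free_scale)

lemma lin_ext_pure [simp]:
  assumes "vector_space s" shows "lin_ext s F (pure z) = F z"
proof -
  interpret vector_space s by fact
  show ?thesis by (simp add: lin_ext_def pure_def)
qed

lemma lin_ext_cong:
  "(\<And>z. z \<in> Poly_Mapping.keys t \<Longrightarrow> F z = G z) \<Longrightarrow> lin_ext s F t = lin_ext s G t"
  by (simp add: lin_ext_def)

lemma lmap_of_lin_ext:
  assumes "lmap s1 s2 f" shows "f (lin_ext s1 F t) = lin_ext s2 (\<lambda>z. f (F z)) t"
  unfolding lin_ext_def lmap_sum[OF assms] by (simp add: lmap_scale[OF assms])

lemma lin_ext_plus:
  assumes "vector_space s" shows "lin_ext s (\<lambda>z. F z + G z) t = lin_ext s F t + lin_ext s G t"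
proof -
  interpret vector_space s by fact
  show ?thesis by (simp add: lin_ext_def scale_right_distrib sum.distrib)
qed

lemma lin_ext_cmult:
  assumes "vector_space s" shows "lin_ext s (\<lambda>z. s c (F z)) t = s c (lin_ext s F t)"
proof -
  interpret vector_space s by fact
  show ?thesis by (simp add: lin_ext_def scale_sum_right mult.commute)
qed

lemma lin_ext_swap:
  assumes "vector_space s"
  shows "lin_ext s (\<lambda>x. lin_ext s (\<lambda>y. F x y) u) t = lin_ext s (\<lambda>y. lin_ext s (\<lambda>x. F x y) t) u"
proof -
  interpret vector_space s by fact
  show ?thesis
    unfolding lin_ext_def scale_sum_right
    by (subst sum.swap) (simp add: mult.commute)
qed

lemma lin_ext_fun_scale: "lin_ext fun_scale F t c = lin_ext (*) (\<lambda>z. F z c) t"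
proof -
  have "(\<Sum>z\<in>K. fun_scale (Poly_Mapping.lookup t z) (F z)) c = (\<Sum>z\<in>K. Poly_Mapping.lookup t z * F z c)" for K
    by (induction K rule: infinite_finite_induct) (auto simp: fun_scale_def)
  then show ?thesis by (simp add: lin_ext_def)
qed

text \<open>Universal property of the tensor product: a bilinear map sends each generating relation
  to 0, and the kernel of its linear extension is a subspace.\<close>

lemma lin_ext_tensor_null:
  assumes t: "t \<in> tensor_null s1 s2" and s: "vector_space s3" and F: "bilin s1 s2 s3 (\<lambda>x y. F (x, y))"
  shows "lin_ext s3 F t = 0"
proof -
  interpret v: vector_space s3 by fact
  interpret f: vector_space free_scale by (rule vector_space_free_scale)
  note L = lmap_lin_ext[OF s, of F]
  have "t \<in> {t. lin_ext s3 F t = 0}"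
    using t unfolding tensor_null_def
  proof (rule f.span_minimal[THEN subsetD, rotated 2])
    show "f.subspace {t. lin_ext s3 F t = 0}"
      unfolding f.subspace_def by (auto simp: lin_ext_add[OF s] lin_ext_free_scale[OF s] lin_ext_def[of _ _ 0])
    show "{pure (x + x', y) - pure (x, y) - pure (x', y) | x x' y. True} \<union>
     {pure (x, y + y') - pure (x, y) - pure (x, y') | x y y'. True} \<union>
     {pure (s1 c x, y) - free_scale c (pure (x, y)) | c x y. True} \<union>
     {pure (x, s2 c y) - free_scale c (pure (x, y)) | c x y. True} \<subseteq> {t. lin_ext s3 F t = 0}"
      by (auto simp: lmap_diff[OF L] lin_ext_free_scale[OF s] s bilin_add[OF F] bilin_scale[OF F])
  qed
  then show ?thesis by simp
qed

lemma lin_ext_tensor_eq: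
  assumes "tensor_eq s1 s2 t u" "vector_space s3" "bilin s1 s2 s3 (\<lambda>x y. F (x, y))"
  shows "lin_ext s3 F t = lin_ext s3 F u"
  using lin_ext_tensor_null[of "t - u" s1 s2 s3 F] assms
  by (simp add: tensor_eq_def lmap_diff[OF lmap_lin_ext[of s3 F]])

lemma lin_ext_tensor3_eq:
  assumes t: "tensor3_eq s1 t u" and s: "vector_space s"
    and F: "\<And>y z. lmap s1 s (\<lambda>x. F (x, y, z))" "\<And>x z. lmap s1 s (\<lambda>y. F (x, y, z))"
      "\<And>x y. lmap s1 s (\<lambda>z. F (x, y, z))"
  shows "lin_ext s F t = lin_ext s F u"
proof -
  interpret v: vector_space s by fact
  interpret f: vector_space free_scale by (rule vector_space_free_scale)
  note L = lmap_lin_ext[OF s, of F]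
  have "t - u \<in> {t. lin_ext s F t = 0}"
    using t unfolding tensor3_eq_def tensor3_null_def
  proof (rule f.span_minimal[THEN subsetD, rotated 2])
    show "f.subspace {t. lin_ext s F t = 0}"
      unfolding f.subspace_def by (auto simp: lin_ext_add[OF s] lin_ext_free_scale[OF s] lin_ext_def[of _ _ 0])
    show "{pure (x + x', y, z) - pure (x, y, z) - pure (x', y, z) | x x' y z. True} \<union>
     {pure (x, y + y', z) - pure (x, y, z) - pure (x, y', z) | x y y' z. True} \<union>
     {pure (x, y, z + z') - pure (x, y, z) - pure (x, y, z') | x y z z'. True} \<union>
     {pure (s1 c x, y, z) - free_scale c (pure (x, y, z)) | c x y z. True} \<union>
     {pure (x, s1 c y, z) - free_scale c (pure (x, y, z)) | c x y z. True} \<union>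
     {pure (x, y, s1 c z) - free_scale c (pure (x, y, z)) | c x y z. True} \<subseteq> {t. lin_ext s F t = 0}"
      by (auto simp: lmap_diff[OF L] lin_ext_free_scale[OF s] s lmap_add[OF F(1)] lmap_add[OF F(2)]
          lmap_add[OF F(3)] lmap_scale[OF F(1)] lmap_scale[OF F(2)] lmap_scale[OF F(3)])
  qed
  then show ?thesis using lmap_diff[OF L] by simp
qed

lemma lin_ext_lin_ext:
  assumes "vector_space s"
  shows "lin_ext s F (lin_ext free_scale G t) = lin_ext s (\<lambda>z. lin_ext s F (G z)) t"
  by (rule lmap_of_lin_ext[OF lmap_lin_ext[OF assms]])

lemma lin_ext_tensor_map:
  assumes "vector_space s"
  shows "lin_ext s F (tensor_map f g t) = lin_ext s (\<lambda>(x, y). F (f x, g y)) t"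
  by (simp add: tensor_map_def lin_ext_lin_ext[OF assms] case_prod_unfold assms)

lemma tensor_eq_refl [simp]: "tensor_eq s1 s2 t t"
proof -
  interpret f: vector_space free_scale by (rule vector_space_free_scale)
  show ?thesis by (simp add: tensor_eq_def tensor_null_def f.span_zero)
qed

lemma tensor_eq_sym: "tensor_eq s1 s2 t u \<Longrightarrow> tensor_eq s1 s2 u t"
proof -
  interpret f: vector_space free_scale by (rule vector_space_free_scale)
  assume "tensor_eq s1 s2 t u"
  then show ?thesis
    using f.span_neg[of "t - u"] by (simp add: tensor_eq_def tensor_null_def)
qed

lemma keys_lin_ext_subset:
  fixes F :: "'a \<Rightarrow> 'b \<Rightarrow>\<^sub>0 'k::field"
  assumes "\<And>z. z \<in> Poly_Mapping.keys t \<Longrightarrow> Poly_Mapping.keys (F z) \<subseteq> K"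
  shows "Poly_Mapping.keys (lin_ext free_scale F t) \<subseteq> K"
proof -
  have "\<exists>z\<in>Poly_Mapping.keys t. x \<in> Poly_Mapping.keys (F z)" if "x \<in> Poly_Mapping.keys (lin_ext free_scale F t)" for x
  proof (rule ccontr)
    assume "\<not> ?thesis"
    then have "Poly_Mapping.lookup (lin_ext free_scale F t) x = 0"
      by (auto simp: lin_ext_def lookup_sum lookup_free_scale in_keys_iff intro!: sum.neutral)
    with that show False by (simp add: in_keys_iff)
  qed
  with assms show ?thesis by blast
qed

lemma keys_tensor_map:
  assumes "Poly_Mapping.keys t \<subseteq> X \<times> Y" "f ` X \<subseteq> X'" "g ` Y \<subseteq> Y'"
  shows "Poly_Mapping.keys (tensor_map f g t) \<subseteq> X' \<times> Y'"
  unfolding tensor_map_def by (rule keys_lin_ext_subset) (use assms in \<open>force simp: pure_def split: if_splits\<close>)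

text \<open>Expanding the first leg in a basis of \<open>X\<close> writes \<open>F\<close> on the
  support of \<open>w\<close> as a finite sum of products of a functional of the first leg and
  \<open>F b\<close>, a functional of the second. Products of functionals therefore detect
  everything that bilinear forms detect.\<close>

lemma lin_ext_bilinear_expand:
  assumes s1: "vector_space s1" and X: "module.subspace s1 X" "Poly_Mapping.keys w \<subseteq> X \<times> UNIV"
    and F: "bilin s1 s2 (*) F"
    and 0: "\<And>k b. lmap s1 (*) k \<Longrightarrow> b \<in> X \<Longrightarrow> lin_ext (*) (\<lambda>(x, y). k x * F b y) w = 0"
  shows "lin_ext (*) (\<lambda>(x, y). F x y) w = 0"
proof -
  interpret vector_space s1 by fact
  obtain P where P: "lmap s1 s1 P" "\<And>x. P x \<in> X" "\<And>x. x \<in> X \<Longrightarrow> P x = x"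
    using subspace_projection[OF X(1)] by blast
  obtain B where B: "B \<subseteq> X" "independent B" "X \<subseteq> span B"
    by (rule maximal_independent_subset)
  define k where "k b x = representation B (P x) b" for b x
  have k: "lmap s1 (*) (k b)" for b
    using B P by (auto simp: lmap_iff k_def representation_add representation_scale subset_eq)
  \<comment> \<open>\<open>X\<close> may have infinite dimension; only the basis vectors with a
    nonzero coordinate on a first leg of \<open>w\<close> enter, and \<open>w\<close> has finite
    support.\<close>
  define K where "K = (\<Union>z\<in>Poly_Mapping.keys w. {b. k b (fst z) \<noteq> 0})"
  have K: "finite K"
    by (auto simp: K_def k_def finite_representation)
  have KB: "K \<subseteq> B"
    by (auto simp: K_def k_def representation_ne_zero)
  have exp: "F x y = (\<Sum>b\<in>K. k b x * F b y)" if "(x, y) \<in> Poly_Mapping.keys w" for x y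
  proof -
    have x: "x \<in> X" using that X(2) by auto
    have "x = (\<Sum>b | representation B x b \<noteq> 0. s1 (representation B x b) b)"
      using sum_nonzero_representation_eq[OF B(2), of x] B(3) x by auto
    also have "\<dots> = (\<Sum>b\<in>K. s1 (k b x) b)"
      by (rule sum.mono_neutral_cong_left)
        (use K that P(3)[OF x] in \<open>force simp: K_def k_def\<close>)+
    finally have "F x y = F (\<Sum>b\<in>K. s1 (k b x) b) y" by simp
    also have "\<dots> = (\<Sum>b\<in>K. k b x * F b y)"
    proof -
      have "lmap s1 (*) (\<lambda>x. F x y)" using F by (simp add: bilin_def)
      then show ?thesis by (simp add: lmap_sum[of s1 "(*)" "\<lambda>x. F x y"] lmap_scale[of s1 "(*)" "\<lambda>x. F x y"])
    qed
    finally show ?thesis .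
  qed
  have "lin_ext (*) (\<lambda>(x, y). F x y) w = lin_ext (*) (\<lambda>(x, y). \<Sum>b\<in>K. k b x * F b y) w"
    by (rule lin_ext_cong) (auto simp: exp)
  also have "\<dots> = (\<Sum>b\<in>K. lin_ext (*) (\<lambda>(x, y). k b x * F b y) w)"
    unfolding lin_ext_def case_prod_unfold sum_distrib_left by (rule sum.swap)
  also have "\<dots> = 0"
    using 0[OF k] KB B(1) by (simp add: subset_eq)
  finally show ?thesis .
qed

text \<open>A functional that separates \<open>t - u\<close> from the relations is a bilinear form
  on pairs, and bilinear forms reduce to products of functionals. Tensor identities can thus be
  checked on scalar Sweedler sums.\<close>

lemma tensor_eq_if_functionals:
  assumes s1: "vector_space s1" and s2: "vector_space s2"
    and eq: "\<And>f g. lmap s1 (*) f \<Longrightarrow> lmap s2 (*) g \<Longrightarrow>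
      lin_ext (*) (\<lambda>(x, y). f x * g y) t = lin_ext (*) (\<lambda>(x, y). f x * g y) u"
  shows "tensor_eq s1 s2 t u"
proof (rule ccontr)
  interpret f: vector_space free_scale by (rule vector_space_free_scale)
  interpret v1: vector_space s1 by fact
  assume "\<not> ?thesis"
  then have "t - u \<notin> tensor_null s1 s2" by (simp add: tensor_eq_def)
  moreover have "f.subspace (tensor_null s1 s2)" by (simp add: tensor_null_def)
  ultimately obtain \<Phi> where \<Phi>: "lmap free_scale (*) \<Phi>"
    "\<And>x. x \<in> tensor_null s1 s2 \<Longrightarrow> \<Phi> x = 0" "\<Phi> (t - u) = 1"
    using f.subspace_functional by blast
  define F where "F x y = \<Phi> (pure (x, y))" for x y
  have mem: "pure (x + x', y) - pure (x, y) - pure (x', y) \<in> tensor_null s1 s2"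
    "pure (x, z + z') - pure (x, z) - pure (x, z') \<in> tensor_null s1 s2"
    "pure (s1 c x, y) - free_scale c (pure (x, y)) \<in> tensor_null s1 s2"
    "pure (x, s2 c y) - free_scale c (pure (x, y)) \<in> tensor_null s1 s2" for x x' y z z' c
    unfolding tensor_null_def by (rule f.span_base, blast)+
  have "bilin s1 s2 (*) F"
    using \<Phi>(2)[OF mem(1)] \<Phi>(2)[OF mem(2)] \<Phi>(2)[OF mem(3)] \<Phi>(2)[OF mem(4)]
    by (simp add: bilin_def lmap_iff F_def lmap_diff[OF \<Phi>(1)] lmap_add[OF \<Phi>(1)]
        lmap_scale[OF \<Phi>(1)] algebra_simps)
  moreover have "lin_ext (*) (\<lambda>(x, y). f x * g y) (t - u) = 0"
    if "lmap s1 (*) f" "lmap s2 (*) g" for f g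
    using eq[OF that] by (simp add: lmap_diff[OF lmap_lin_ext[OF vector_space_times]])
  ultimately have "lin_ext (*) (\<lambda>(x, y). F x y) (t - u) = 0"
    using lin_ext_bilinear_expand[OF s1 v1.subspace_UNIV, of "t - u" s2 F] by (simp add: bilin_def)
  moreover have "lin_ext (*) (\<lambda>(x, y). F x y) w = \<Phi> w" for w
  proof -
    have "w = lin_ext free_scale pure w"
      by (auto intro!: poly_mapping_eqI simp: lin_ext_def lookup_sum lookup_free_scale pure_def
          lookup_single when_def in_keys_iff if_distrib[of "\<lambda>x. _ * x"] cong: if_cong)
    then have "\<Phi> w = \<Phi> (lin_ext free_scale pure w)" by simp
    also have "\<dots> = lin_ext (*) (\<lambda>z. \<Phi> (pure z)) w"
      by (rule lmap_of_lin_ext[OF \<Phi>(1)])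
    finally show ?thesis by (simp add: F_def case_prod_unfold)
  qed
  ultimately show False using \<Phi>(3) by simp
qed

lemma tensor_eq_iff_functionals:
  assumes s1: "vector_space s1" and s2: "vector_space s2"
  shows "tensor_eq s1 s2 t u \<longleftrightarrow> (\<forall>f g. lmap s1 (*) f \<longrightarrow> lmap s2 (*) g \<longrightarrow>
      lin_ext (*) (\<lambda>(x, y). f x * g y) t = lin_ext (*) (\<lambda>(x, y). f x * g y) u)"
proof -
  have "bilin s1 s2 (*) (\<lambda>x y. (\<lambda>(x, y). f x * g y) (x, y))" if "lmap s1 (*) f" "lmap s2 (*) g" for f g
    using that by (simp add: bilin_def lmap_iff algebra_simps)
  then show ?thesis
    using tensor_eq_if_functionals[OF s1 s2, of t u] lin_ext_tensor_eq[OF _ vector_space_times] by blast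
qed

section \<open>Sweedler sums\<close>

context hopf_algebra
begin

abbreviation lin :: "('h \<Rightarrow> 'k) \<Rightarrow> bool" where "lin \<equiv> lmap scale (*)"
abbreviation endo :: "('h \<Rightarrow> 'h) \<Rightarrow> bool" where "endo \<equiv> lmap scale scale"
abbreviation blin :: "('h \<Rightarrow> 'h \<Rightarrow> 'k) \<Rightarrow> bool" where "blin \<equiv> bilin scale scale (*)"

text \<open>\<open>sw h F\<close> is \<open>F h\<^sub>1 h\<^sub>2\<close> in Sweedler notation.\<close>

definition sw :: "'h \<Rightarrow> ('h \<Rightarrow> 'h \<Rightarrow> 'k) \<Rightarrow> 'k" where
  "sw h F = lin_ext (*) (\<lambda>(x, y). F x y) (\<Delta> h)"

lemma sw_plus: "sw h (\<lambda>x y. F x y + G x y) = sw h F + sw h G"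
  unfolding sw_def case_prod_unfold by (rule lin_ext_plus[OF vector_space_times])

lemma sw_cmult: "sw h (\<lambda>x y. c * F x y) = c * sw h F"
  unfolding sw_def case_prod_unfold by (rule lin_ext_cmult[OF vector_space_times])

lemma sw_multc: "sw h (\<lambda>x y. F x y * c) = sw h F * c"
  using sw_cmult[of h c F] by (simp add: mult.commute)

lemma sw_zero: "sw h (\<lambda>x y. 0) = 0"
  using sw_cmult[of h 0] by simp

lemma sw_sum: "sw h (\<lambda>x y. \<Sum>i\<in>I. F i x y) = (\<Sum>i\<in>I. sw h (F i))"
  by (induction I rule: infinite_finite_induct) (auto simp: sw_zero sw_plus)

lemma sw_swap: "sw h (\<lambda>x y. sw k (\<lambda>u v. F x y u v)) = sw k (\<lambda>u v. sw h (\<lambda>x y. F x y u v))"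
  unfolding sw_def case_prod_unfold by (rule lin_ext_swap[OF vector_space_times])

lemma sw_add:
  assumes "blin F" shows "sw (h + k) F = sw h F + sw k F"
proof -
  have "sw (h + k) F = lin_ext (*) (\<lambda>(x, y). F x y) (\<Delta> h + \<Delta> k)"
    unfolding sw_def by (rule lin_ext_tensor_eq[OF comult_add vector_space_times]) (use assms in auto)
  then show ?thesis by (simp add: lin_ext_add[OF vector_space_times] sw_def)
qed

lemma sw_scale:
  assumes "blin F" shows "sw (scale c h) F = c * sw h F"
proof -
  have "sw (scale c h) F = lin_ext (*) (\<lambda>(x, y). F x y) (free_scale c (\<Delta> h))"
    unfolding sw_def by (rule lin_ext_tensor_eq[OF comult_scale vector_space_times]) (use assms in auto)
  then show ?thesis by (simp add: lin_ext_free_scale[OF vector_space_times] sw_def)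
qed

lemma counit_add: "\<epsilon> (x + y) = \<epsilon> x + \<epsilon> y" and counit_scale: "\<epsilon> (scale c x) = c * \<epsilon> x"
  using counit_linear by (auto simp: linear_on_def)

lemma antipode_add: "S (x + y) = S x + S y" and antipode_scale: "S (scale c x) = scale c (S x)"
  using antipode_linear by (auto simp: linear_on_def)

text \<open>Rewrite rules that reduce linearity of a nested Sweedler expression in one of its
  arguments to an identity that the simplifier closes.\<close>

lemmas lin_simps = lmap_iff bilin_def sw_plus sw_cmult sw_multc sw_add sw_scale counit_add counit_scale
  antipode_add antipode_scale distrib_left distrib_right scale_mult_left scale_mult_right
  mult.assoc mult.left_commute[where 'a='k] scale_right_distrib scale_left_distrib

lemma lin_sw: "blin F \<Longrightarrow> lin (\<lambda>h. sw h F)"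
  by (simp add: lmap_iff sw_add sw_scale)

lemma sw_coassoc:
  assumes "\<And>y z. lin (\<lambda>x. G x y z)" "\<And>x z. lin (\<lambda>y. G x y z)" "\<And>x y. lin (G x y)"
  shows "sw h (\<lambda>p z. sw p (\<lambda>x y. G x y z)) = sw h (\<lambda>x q. sw q (\<lambda>y z. G x y z))"
proof -
  have "sw h (\<lambda>p z. sw p (\<lambda>x y. G x y z)) = lin_ext (*) (\<lambda>(x, y, z). G x y z)
      (lin_ext free_scale (\<lambda>(u, v). lin_ext free_scale (\<lambda>(u1, u2). pure (u1, u2, v)) (\<Delta> u)) (\<Delta> h))"
    by (simp add: lin_ext_lin_ext[OF vector_space_times] case_prod_unfold vector_space_times sw_def)
  also have "\<dots> = lin_ext (*) (\<lambda>(x, y, z). G x y z)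
      (lin_ext free_scale (\<lambda>(u, v). lin_ext free_scale (\<lambda>(v1, v2). pure (u, v1, v2)) (\<Delta> v)) (\<Delta> h))"
    by (rule lin_ext_tensor3_eq[OF coassoc[OF UNIV_I] vector_space_times]) (simp_all add: assms)
  also have "\<dots> = sw h (\<lambda>x q. sw q (\<lambda>y z. G x y z))"
    by (simp add: lin_ext_lin_ext[OF vector_space_times] case_prod_unfold vector_space_times sw_def)
  finally show ?thesis .
qed

lemma sw_counit_left:
  assumes "lin f" shows "sw h (\<lambda>x y. \<epsilon> x * f y) = f h"
  using arg_cong[OF counit_left[of h], of f] lmap_scale[OF assms]
  by (simp add: sw_def case_prod_unfold lmap_of_lin_ext[OF assms])

lemma sw_counit_right:
  assumes "lin f" shows "sw h (\<lambda>x y. \<epsilon> y * f x) = f h"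
  using arg_cong[OF counit_right[of h], of f] lmap_scale[OF assms]
  by (simp add: sw_def case_prod_unfold lmap_of_lin_ext[OF assms])

lemma sw_counit_right': "lin f \<Longrightarrow> sw h (\<lambda>x y. f x * \<epsilon> y) = f h"
  using sw_counit_right[of f h] by (simp add: mult.commute)

lemma sw_antipode_left:
  assumes "lin f" shows "sw h (\<lambda>x y. f (S x * y)) = \<epsilon> h * f 1"
  using arg_cong[OF antipode_left[of h], of f] lmap_scale[OF assms]
  by (simp add: sw_def case_prod_unfold lmap_of_lin_ext[OF assms])

lemma sw_antipode_right:
  assumes "lin f" shows "sw h (\<lambda>x y. f (x * S y)) = \<epsilon> h * f 1"
  using arg_cong[OF antipode_right[of h], of f] lmap_scale[OF assms]
  by (simp add: sw_def case_prod_unfold lmap_of_lin_ext[OF assms])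

lemma sw_one: "blin F \<Longrightarrow> sw 1 F = F 1 1"
  using lin_ext_tensor_eq[OF comult_one vector_space_times, of "\<lambda>(x, y). F x y"]
  by (simp add: sw_def vector_space_times)

lemma sw_mult:
  assumes "blin F" shows "sw (h * k) F = sw h (\<lambda>x y. sw k (\<lambda>u v. F (x * u) (y * v)))"
proof -
  have "sw (h * k) F = lin_ext (*) (\<lambda>(x, y). F x y) (tensor_mult (\<Delta> h) (\<Delta> k))"
    unfolding sw_def by (rule lin_ext_tensor_eq[OF comult_mult vector_space_times]) (use assms in auto)
  also have "\<dots> = sw h (\<lambda>x y. sw k (\<lambda>u v. F (x * u) (y * v)))"
    by (simp add: tensor_mult_def lin_ext_lin_ext[OF vector_space_times] case_prod_unfold
        vector_space_times sw_def)
  finally show ?thesis .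
qed

text \<open>\<open>F\<close> and \<open>G\<close> are bilinear on all of \<open>H\<close> but agree
  only on legs in \<open>X\<close> and \<open>Y\<close>: the sum may be computed from a
  representative supported there. In this way facts that hold only on \<open>A\<close> or
  \<open>C\<close> enter a Sweedler computation.\<close>

lemma sw_cong_sub:
  assumes "tensor_in scale scale X Y (\<Delta> h)" "blin F" "blin G"
    "\<And>x y. x \<in> X \<Longrightarrow> y \<in> Y \<Longrightarrow> F x y = G x y"
  shows "sw h F = sw h G"
proof -
  obtain u where u: "Poly_Mapping.keys u \<subseteq> X \<times> Y" "tensor_eq scale scale u (\<Delta> h)"
    using assms(1) by (auto simp: tensor_in_def)
  have "sw h F = lin_ext (*) (\<lambda>(x, y). F x y) u"
    unfolding sw_def by (rule lin_ext_tensor_eq[OF tensor_eq_sym[OF u(2)] vector_space_times]) (use assms in auto)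
  also have "\<dots> = lin_ext (*) (\<lambda>(x, y). G x y) u"
    by (rule lin_ext_cong) (use u(1) assms(4) in auto)
  also have "\<dots> = sw h G"
    unfolding sw_def by (rule lin_ext_tensor_eq[OF u(2) vector_space_times]) (use assms in auto)
  finally show ?thesis .
qed

text \<open>Coassociativity of the coalgebra \<open>H \<otimes> H\<close> at
  \<open>a \<otimes> b\<close>, the form needed when products \<open>a1 * b1\<close> and
  \<open>a2 * b2\<close> of legs are regrouped.\<close>

lemma sw_coassoc_pair:
  assumes "\<And>a2 a3 b1 b2 b3. lin (\<lambda>a1. G a1 a2 a3 b1 b2 b3)" "\<And>a1 a3 b1 b2 b3. lin (\<lambda>a2. G a1 a2 a3 b1 b2 b3)"
    "\<And>a1 a2 b1 b2 b3. lin (\<lambda>a3. G a1 a2 a3 b1 b2 b3)" "\<And>a1 a2 a3 b2 b3. lin (\<lambda>b1. G a1 a2 a3 b1 b2 b3)"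
    "\<And>a1 a2 a3 b1 b3. lin (\<lambda>b2. G a1 a2 a3 b1 b2 b3)" "\<And>a1 a2 a3 b1 b2. lin (\<lambda>b3. G a1 a2 a3 b1 b2 b3)"
  shows "sw a (\<lambda>a1 a'. sw b (\<lambda>b1 b'. sw a' (\<lambda>a2 a3. sw b' (\<lambda>b2 b3. G a1 a2 a3 b1 b2 b3)))) =
    sw a (\<lambda>p a3. sw b (\<lambda>q b3. sw p (\<lambda>a1 a2. sw q (\<lambda>b1 b2. G a1 a2 a3 b1 b2 b3))))" (is "?L = ?R")
proof -
  have "?L = sw a (\<lambda>a1 a'. sw a' (\<lambda>a2 a3. sw b (\<lambda>b1 b'. sw b' (\<lambda>b2 b3. G a1 a2 a3 b1 b2 b3))))"
    by (subst (2) sw_swap) (rule refl)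
  also have "\<dots> = sw a (\<lambda>a1 a'. sw a' (\<lambda>a2 a3. sw b (\<lambda>q b3. sw q (\<lambda>b1 b2. G a1 a2 a3 b1 b2 b3))))"
    by (subst sw_coassoc[symmetric]) (use assms in auto)
  also have "\<dots> = sw a (\<lambda>p a3. sw p (\<lambda>a1 a2. sw b (\<lambda>q b3. sw q (\<lambda>b1 b2. G a1 a2 a3 b1 b2 b3))))"
    by (rule sw_coassoc[symmetric]) (use assms in \<open>simp_all add: lin_simps\<close>)
  also have "\<dots> = ?R"
    by (subst (2) sw_swap) (rule refl)
  finally show ?thesis .
qed

lemma lin_counit: "lin \<epsilon>"
  by (simp add: lin_simps)

lemma sw_cong:
  assumes "\<And>x y. F x y = G x y" shows "sw h F = sw h G"
proof -
  have "F = G" by (intro ext assms)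
  then show ?thesis by simp
qed

lemma lin_sw_param: "(\<And>x y. lin (\<lambda>u. F u x y)) \<Longrightarrow> lin (\<lambda>u. sw h (F u))"
  unfolding lmap_iff by (auto simp flip: sw_plus sw_cmult intro!: sw_cong)

text \<open>Both sides are convolution inverse to the multiplication of \<open>H\<close>: the
  product \<open>S (a1 * b1) * (a2 * b2) * S b3 * S a3\<close> collapses from its left end to the
  right-hand side and from its right end to the left-hand side.\<close>

lemma antipode_mult: "S (a * b) = S b * S a"
proof (rule eq_if_functionals)
  fix f assume f: "lin f"
  note f' = f[unfolded lmap_iff]
  have *: "sw b' (\<lambda>b2 b3. f (w * (a2 * b2) * S b3 * S a3)) = \<epsilon> b' * f (w * a2 * S a3)" for w a2 a3 b'
    using sw_antipode_right[of "\<lambda>z. f (w * a2 * z * S a3)" b'] f' by (simp add: lin_simps)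
  have **: "sw a' (\<lambda>a2 a3. f (w * a2 * S a3)) = \<epsilon> a' * f w" for w a'
    using sw_antipode_right[of "\<lambda>z. f (w * z)" a'] f' by (simp add: lin_simps)
  have "f (S (a * b)) = sw a (\<lambda>a1 a'. \<epsilon> a' * sw b (\<lambda>b1 b'. \<epsilon> b' * f (S (a1 * b1))))"
    using sw_counit_right[of "\<lambda>x. f (S (a * x))" b] sw_counit_right[of "\<lambda>x. sw b (\<lambda>b1 b'. \<epsilon> b' * f (S (x * b1)))" a] f'
    by (simp add: lin_simps)
  also have "\<dots> = sw a (\<lambda>a1 a'. sw b (\<lambda>b1 b'. sw a' (\<lambda>a2 a3. sw b' (\<lambda>b2 b3.
      f (S (a1 * b1) * (a2 * b2) * S b3 * S a3)))))"
    by (simp only: * sw_cmult **) (simp add: sw_cmult[symmetric] mult.left_commute)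
  also have "\<dots> = sw a (\<lambda>p a3. sw b (\<lambda>q b3. sw p (\<lambda>a1 a2. sw q (\<lambda>b1 b2.
      f (S (a1 * b1) * (a2 * b2) * S b3 * S a3)))))"
    by (rule sw_coassoc_pair) (use f' in \<open>simp_all add: lin_simps\<close>)
  also have "\<dots> = sw a (\<lambda>p a3. sw b (\<lambda>q b3. sw (p * q) (\<lambda>x y. f (S x * y * S b3 * S a3))))"
    by (intro sw_cong sw_mult[symmetric]) (use f' in \<open>simp_all add: lin_simps\<close>)
  also have "\<dots> = sw a (\<lambda>p a3. sw b (\<lambda>q b3. \<epsilon> p * (\<epsilon> q * f (S b3 * S a3))))"
    using sw_antipode_left[of "\<lambda>z. f (z * S y * S x)" for x y] f' by (simp add: lin_simps counit_mult)
  also have "\<dots> = f (S b * S a)"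
    using sw_counit_left[of "\<lambda>x. f (S x * y)" for y] sw_counit_left[of "\<lambda>x. f (S b * S x)"] f'
    by (simp add: lin_simps)
  finally show "f (S (a * b)) = f (S b * S a)" .
qed

lemma antipode_one: "S 1 = 1"
proof (rule eq_if_functionals)
  fix f assume f: "lin f"
  then show "f (S 1) = f 1"
    using sw_antipode_left[of f 1] sw_one[of "\<lambda>x y. f (S x * y)"] by (simp add: lin_simps counit_one)
qed

lemma counit_antipode: "\<epsilon> (S h) = \<epsilon> h"
  using sw_antipode_left[OF lin_counit, of h] sw_counit_right'[of "\<lambda>x. \<epsilon> (S x)" h]
  by (simp add: counit_mult counit_one lin_simps)

lemma sw_coassoc4:
  assumes "\<And>b c d. lin (\<lambda>a. G a b c d)" "\<And>a c d. lin (\<lambda>b. G a b c d)"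
    "\<And>a b d. lin (\<lambda>c. G a b c d)" "\<And>a b c. lin (G a b c)"
  shows "sw r (\<lambda>p q. sw p (\<lambda>a b. sw q (\<lambda>c d. G a b c d))) =
    sw r (\<lambda>a r'. sw r' (\<lambda>w d. sw w (\<lambda>b c. G a b c d)))"
proof -
  have "sw r (\<lambda>p q. sw p (\<lambda>a b. sw q (\<lambda>c d. G a b c d))) =
      sw r (\<lambda>a r'. sw r' (\<lambda>b q. sw q (\<lambda>c d. G a b c d)))"
    by (rule sw_coassoc) (use assms in \<open>auto intro!: lin_sw_param lin_sw simp: bilin_def\<close>)
  also have "\<dots> = sw r (\<lambda>a r'. sw r' (\<lambda>w d. sw w (\<lambda>b c. G a b c d)))"
    by (intro sw_cong sw_coassoc[symmetric]) (use assms in auto)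
  finally show ?thesis .
qed

text \<open>The same convolution argument for maps into \<open>H \<otimes> H\<close>. The auxiliary
  \<open>?M\<close> applies \<open>F\<close> to \<Delta>(S(h1) h2) multiplied by S(h4) \<otimes>
  S(h3): the antipode axiom removes either the first two legs or, from the inside, the legs after
  the first.\<close>

lemma sw_antipode:
  assumes F: "blin F"
  shows "sw (S h) F = sw h (\<lambda>x y. F (S y) (S x))"
proof -
  note F' = F[unfolded bilin_def lmap_iff]
  let ?M = "sw h (\<lambda>p q. sw p (\<lambda>h1 h'. sw (S h1 * h') (\<lambda>u v. sw q (\<lambda>x y. F (u * S y) (v * S x)))))"
  have "?M = sw h (\<lambda>p q. \<epsilon> p * sw 1 (\<lambda>u v. sw q (\<lambda>x y. F (u * S y) (v * S x))))"
    by (intro sw_cong sw_antipode_left) (use F' in \<open>simp add: lin_simps\<close>)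
  also have "\<dots> = sw h (\<lambda>p q. \<epsilon> p * sw q (\<lambda>x y. F (S y) (S x)))"
    by (subst sw_one) (use F' in \<open>simp_all add: lin_simps\<close>)
  also have "\<dots> = sw h (\<lambda>x y. F (S y) (S x))"
    by (rule sw_counit_left) (use F' in \<open>simp add: lin_simps\<close>)
  finally have 1: "?M = sw h (\<lambda>x y. F (S y) (S x))" .
  have a: "sw w (\<lambda>b c. F x (v * b * S c)) = \<epsilon> w * F x v" for w x v
    using sw_antipode_right[of "\<lambda>z. F x (v * z)" w] F' by (simp add: lin_simps)
  have b: "sw r' (\<lambda>w d. \<epsilon> w * F (x * S d) v) = F (x * S r') v" for r' x v
    by (rule sw_counit_left) (use F' in \<open>simp add: lin_simps\<close>)
  have c: "sw r (\<lambda>a d. F (u * a * S d) v) = \<epsilon> r * F u v" for r u v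
    using sw_antipode_right[of "\<lambda>z. F (u * z) v" r] F' by (simp add: lin_simps)
  have "?M = sw h (\<lambda>p q. sw p (\<lambda>h1 h'. sw (S h1) (\<lambda>u v. sw h' (\<lambda>u' v'.
      sw q (\<lambda>x y. F (u * u' * S y) (v * v' * S x))))))"
    by (subst sw_mult) (use F' in \<open>simp_all add: lin_simps\<close>)
  also have "\<dots> = sw h (\<lambda>h1 r. sw r (\<lambda>h' q. sw (S h1) (\<lambda>u v. sw h' (\<lambda>u' v'.
      sw q (\<lambda>x y. F (u * u' * S y) (v * v' * S x))))))"
    by (rule sw_coassoc) (use F' in \<open>simp_all add: lin_simps\<close>)
  also have "\<dots> = sw h (\<lambda>h1 r. sw (S h1) (\<lambda>u v. sw r (\<lambda>h' q. sw h' (\<lambda>u' v'.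
      sw q (\<lambda>x y. F (u * u' * S y) (v * v' * S x))))))"
    by (subst (2) sw_swap) (rule refl)
  also have "\<dots> = sw h (\<lambda>h1 r. sw (S h1) (\<lambda>u v. sw r (\<lambda>u' r'. sw r' (\<lambda>w y. sw w (\<lambda>v' x.
      F (u * u' * S y) (v * v' * S x))))))"
    by (subst sw_coassoc4) (use F' in \<open>simp_all add: lin_simps\<close>)
  also have "\<dots> = sw h (\<lambda>h1 r. \<epsilon> r * sw (S h1) F)"
    by (simp only: a b c sw_cmult)
  also have "\<dots> = sw (S h) F"
    by (rule sw_counit_right) (use F' in \<open>simp add: lin_simps\<close>)
  finally show ?thesis using 1 by simp
qed

end

section \<open>Integrals\<close>

context hopf_algebra
begin

lemma tensor_in_UNIV: "tensor_in scale scale UNIV UNIV t"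
  by (auto simp: tensor_in_def intro!: exI[of _ t])

lemma hopf_subalgebra_UNIV: "hopf_subalgebra scale \<Delta> S UNIV"
  by (simp add: hopf_subalgebra_def subcoalgebra_def tensor_in_UNIV)

lemma hopf_subalgebraD:
  assumes "hopf_subalgebra scale \<Delta> S A"
  shows "subspace A" "a \<in> A \<Longrightarrow> tensor_in scale scale A A (\<Delta> a)" "1 \<in> A"
    "a \<in> A \<Longrightarrow> b \<in> A \<Longrightarrow> a * b \<in> A" "a \<in> A \<Longrightarrow> S a \<in> A"
  using assms by (auto simp: hopf_subalgebra_def subcoalgebra_def)

lemma sw_expand:
  assumes h: "tensor_in scale scale X Y (\<Delta> h)" and X: "subspace X" and K: "blin K"
    and 0: "\<And>k b. lin k \<Longrightarrow> b \<in> X \<Longrightarrow> sw h (\<lambda>x y. k x * K b y) = 0"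
  shows "sw h K = 0"
proof -
  obtain u where u: "Poly_Mapping.keys u \<subseteq> X \<times> Y" "tensor_eq scale scale u (\<Delta> h)"
    using h by (auto simp: tensor_in_def)
  have eq: "lin_ext (*) (\<lambda>(x, y). F x y) u = sw h F" if "blin F" for F
    unfolding sw_def by (rule lin_ext_tensor_eq[OF u(2) vector_space_times]) (use that in auto)
  have "lin_ext (*) (\<lambda>(x, y). K x y) u = 0"
  proof (rule lin_ext_bilinear_expand[OF vector_space_axioms X _ K])
    show "lin_ext (*) (\<lambda>(x, y). k x * K b y) u = 0" if "lin k" "b \<in> X" for k b
    proof -
      have "blin (\<lambda>x y. k x * K b y)" using that K by (simp add: lin_simps)
      then show ?thesis using eq 0[OF that] by simp
    qed
  qed (use u in auto)
  then show ?thesis using eq[OF K] by simp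
qed

text \<open>This and \<open>hitl\<close> are the two hit actions of the dual of \<open>H\<close> on
  \<open>H\<close>. As the functional varies, they run through the right and the left legs of
  \<open>h\<close>.\<close>

definition hit :: "('h \<Rightarrow> 'k) \<Rightarrow> 'h \<Rightarrow> 'h" where
  "hit f h = lin_ext scale (\<lambda>(x, y). scale (f x) y) (\<Delta> h)"

definition hitl :: "('h \<Rightarrow> 'k) \<Rightarrow> 'h \<Rightarrow> 'h" where
  "hitl f h = lin_ext scale (\<lambda>(x, y). scale (f y) x) (\<Delta> h)"

lemma lin_hit: "lin g \<Longrightarrow> g (hit f h) = sw h (\<lambda>x y. f x * g y)"
  by (simp add: hit_def lmap_of_lin_ext sw_def case_prod_unfold lmap_scale)

lemma lin_hitl: "lin g \<Longrightarrow> g (hitl f h) = sw h (\<lambda>x y. g x * f y)"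
  by (simp add: hitl_def lmap_of_lin_ext sw_def case_prod_unfold lmap_scale mult.commute)

lemma endo_hit:
  assumes "lin f" shows "endo (hit f)"
proof -
  have "hit f (x + y) = hit f x + hit f y" for x y
    by (rule eq_if_functionals) (use assms in \<open>simp add: lmap_add[of scale "(*)"] lin_hit sw_add lin_simps\<close>)
  moreover have "hit f (scale c x) = scale c (hit f x)" for c x
    by (rule eq_if_functionals) (use assms in \<open>simp add: lmap_scale[of scale "(*)"] lin_hit sw_scale lin_simps\<close>)
  ultimately show ?thesis by (simp add: lmap_iff)
qed

lemma hit_add: "hit f h + hit g h = hit (\<lambda>x. f x + g x) h"
  by (rule eq_if_functionals) (simp add: lmap_add[of scale "(*)"] lin_hit lin_simps)

lemma hit_scale: "scale c (hit f h) = hit (\<lambda>x. c * f x) h"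
  by (rule eq_if_functionals) (simp add: lmap_scale[of scale "(*)"] lin_hit lin_simps)

lemma subspace_hits: "subspace {hit f h | f. lin f}"
  unfolding subspace_def
proof (intro conjI ballI allI)
  have "hit (\<lambda>x. 0) h = 0" "lin (\<lambda>x. 0)" by (simp_all add: hit_def lin_ext_def lmap_iff case_prod_unfold)
  then show "0 \<in> {hit f h | f. lin f}" by force
next
  fix x y assume "x \<in> {hit f h | f. lin f}" "y \<in> {hit f h | f. lin f}"
  then obtain f g where fg: "x = hit f h" "y = hit g h" "lin f" "lin g" by auto
  then have "lin (\<lambda>x. f x + g x)" by (simp add: lin_simps)
  then show "x + y \<in> {hit f h | f. lin f}" using fg hit_add by auto
next
  fix x c assume "x \<in> {hit f h | f. lin f}"
  then obtain f where fg: "x = hit f h" "lin f" by auto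
  then have "lin (\<lambda>x. c * f x)" by (simp add: lin_simps)
  then show "scale c x \<in> {hit f h | f. lin f}" using fg hit_scale by auto
qed

lemma hit_mem:
  assumes "tensor_in scale scale X Y (\<Delta> h)" "subspace Y" "lin f" shows "hit f h \<in> Y"
proof (rule mem_if_functionals[OF assms(2)])
  fix g assume g: "lin g" "\<And>y. y \<in> Y \<Longrightarrow> g y = 0"
  have "sw h (\<lambda>x y. f x * g y) = sw h (\<lambda>x y. 0)"
    by (rule sw_cong_sub[OF assms(1)]) (use assms g in \<open>simp_all add: lin_simps\<close>)
  then show "g (hit f h) = 0" using g by (simp add: lin_hit sw_zero)
qed

lemma hitl_mem:
  assumes "tensor_in scale scale X Y (\<Delta> h)" "subspace X" "lin f" shows "hitl f h \<in> X"
proof (rule mem_if_functionals[OF assms(2)])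
  fix g assume g: "lin g" "\<And>y. y \<in> X \<Longrightarrow> g y = 0"
  have "sw h (\<lambda>x y. g x * f y) = sw h (\<lambda>x y. 0)"
    by (rule sw_cong_sub[OF assms(1)]) (use assms g in \<open>simp_all add: lin_simps\<close>)
  then show "g (hitl f h) = 0" using g by (simp add: lin_hitl sw_zero)
qed

definition left_integral :: "'h set \<Rightarrow> 'h \<Rightarrow> bool" where
  "left_integral A t \<longleftrightarrow> t \<in> A \<and> (\<forall>a\<in>A. a * t = scale (\<epsilon> a) t)"

text \<open>Replace \<epsilon>(a2) t by a2 t: the legs become S(a1) a2 t1 and a3 t2, and the
  antipode axiom leaves t1 and a t2.\<close>

lemma integral_shift:
  assumes A: "hopf_subalgebra scale \<Delta> S A" and t: "left_integral A t" and a: "a \<in> A" and F: "blin F"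
  shows "sw t (\<lambda>x y. F (S a * x) y) = sw t (\<lambda>x y. F x (a * y))"
proof -
  note F' = F[unfolded bilin_def lmap_iff]
  note Ain = hopf_subalgebraD[OF A]
  have "sw t (\<lambda>x y. F (S a * x) y) = sw a (\<lambda>p q. \<epsilon> q * sw t (\<lambda>x y. F (S p * x) y))"
    by (rule sw_counit_right[symmetric]) (use F' in \<open>simp add: lin_simps bilin_fun[OF F]\<close>)
  also have "\<dots> = sw a (\<lambda>p q. sw (q * t) (\<lambda>x y. F (S p * x) y))"
  proof (rule sw_cong_sub[OF Ain(2)[OF a]])
    fix x y assume "x \<in> A" "y \<in> A"
    then have "y * t = scale (\<epsilon> y) t" using t by (auto simp: left_integral_def)
    then show "\<epsilon> y * sw t (\<lambda>u v. F (S x * u) v) = sw (y * t) (\<lambda>u v. F (S x * u) v)"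
      using F' by (simp add: lin_simps bilin_fun[OF F])
  qed (use F' in \<open>simp_all add: lin_simps bilin_fun[OF F]\<close>)
  also have "\<dots> = sw a (\<lambda>p q. sw q (\<lambda>u v. sw t (\<lambda>x y. F (S p * (u * x)) (v * y))))"
    by (subst sw_mult) (use F' in \<open>simp_all add: lin_simps bilin_fun[OF F]\<close>)
  also have "\<dots> = sw a (\<lambda>p q. sw p (\<lambda>u v. sw t (\<lambda>x y. F (S u * (v * x)) (q * y))))"
    by (rule sw_coassoc[symmetric]) (use F' in \<open>simp_all add: lin_simps bilin_fun[OF F]\<close>)
  also have "\<dots> = sw a (\<lambda>p q. \<epsilon> p * sw t (\<lambda>x y. F x (q * y)))"
    using sw_antipode_left[of "\<lambda>z. sw t (\<lambda>x y. F (z * x) (q * y))" for q] F' by (simp add: lin_simps bilin_fun[OF F])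
  also have "\<dots> = sw t (\<lambda>x y. F x (a * y))"
    by (rule sw_counit_left) (use F' in \<open>simp add: lin_simps bilin_fun[OF F]\<close>)
  finally show ?thesis .
qed

text \<open>The right legs of a nonzero left integral form a left ideal and a left coideal; applying
  \<open>S(r\<^sub>1) r\<^sub>2 = \<epsilon>(r) 1\<close> to them shows that the unit is among them.\<close>

lemma integral_right_legs:
  assumes A: "hopf_subalgebra scale \<Delta> S A" and t: "left_integral A t" "t \<noteq> 0" and a: "a \<in> A"
  obtains f where "lin f" "hit f t = a"
proof -
  note Ain = hopf_subalgebraD[OF A]
  have tA: "t \<in> A" using t by (simp add: left_integral_def)
  define R where "R = {hit f t | f. lin f}"
  have lmul: "b * hit f t = hit (\<lambda>x. f (S b * x)) t" if "b \<in> A" "lin f" for b f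
  proof (rule eq_if_functionals)
    fix g assume g: "lin g"
    have g': "lin (\<lambda>x. g (b * x))" using g by (simp add: lin_simps)
    have "g (b * hit f t) = sw t (\<lambda>x y. f x * g (b * y))"
      using lin_hit[OF g'] by simp
    also have "\<dots> = sw t (\<lambda>x y. f (S b * x) * g y)"
      by (rule integral_shift[OF A t(1) that(1), symmetric]) (use that g in \<open>simp add: lin_simps\<close>)
    finally show "g (b * hit f t) = g (hit (\<lambda>x. f (S b * x)) t)" using lin_hit[OF g] by simp
  qed
  have R_mult: "b * r \<in> R" if b: "b \<in> A" and r: "r \<in> R" for b r
  proof -
    obtain f where f: "lin f" "r = hit f t" using r R_def by auto
    have "lin (\<lambda>x. f (S b * x))" using f(1) by (simp add: lin_simps)
    then show ?thesis using lmul[OF b f(1)] f(2) by (auto simp: R_def)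
  qed
  have "subspace R" unfolding R_def by (rule subspace_hits)
  have "1 \<in> R"
  proof (rule mem_if_functionals[OF \<open>subspace R\<close>])
    fix g assume g: "lin g" "\<And>y. y \<in> R \<Longrightarrow> g y = 0"
    note g' = g(1)[unfolded lmap_iff]
    have "t \<notin> {0}" using t by simp
    then obtain f where f: "lin f" "f t = 1"
      using subspace_functional[OF subspace_single_0] by metis
    note f' = f(1)[unfolded lmap_iff]
    \<comment> \<open>Evaluated the other way below, this sum is \<open>f t * g 1\<close>. It
      vanishes because after \<open>sw_expand\<close> the first leg enters only through a functional
      \<open>k\<close>; contraction leaves \<open>hit k t\<close> in \<open>R\<close>, which is
      stable under left multiplication by \<open>S z\<close>.\<close>
    have "sw t (\<lambda>p y. sw p (\<lambda>x z. f x * g (S z * y))) = 0"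
    proof (rule sw_expand[OF Ain(2)[OF tA] Ain(1)])
      show "blin (\<lambda>p y. sw p (\<lambda>x z. f x * g (S z * y)))"
        using f' g' by (simp add: lin_simps)
      fix k b assume k: "lin k" and b: "b \<in> A"
      note k' = k[unfolded lmap_iff]
      have "sw t (\<lambda>p y. k p * sw b (\<lambda>x z. f x * g (S z * y)))
          = sw b (\<lambda>x z. f x * sw t (\<lambda>p y. k p * g (S z * y)))"
        by (simp add: sw_cmult[symmetric] mult.left_commute) (rule sw_swap)
      also have "\<dots> = sw b (\<lambda>x z. 0)"
      proof (rule sw_cong_sub[OF Ain(2)[OF b]])
        fix x z assume "z \<in> A"
        have gz: "lin (\<lambda>y. g (S z * y))" using g' by (simp add: lin_simps)
        have "sw t (\<lambda>p y. k p * g (S z * y)) = g (S z * hit k t)"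
          using lin_hit[OF gz] by simp
        also have "\<dots> = 0"
          using R_mult[OF Ain(5)[OF \<open>z \<in> A\<close>], of "hit k t"] k g(2) by (auto simp: R_def)
        finally show "f x * sw t (\<lambda>p y. k p * g (S z * y)) = 0" by simp
      qed (use f' g' k' in \<open>simp_all add: lin_simps\<close>)
      finally show "sw t (\<lambda>p y. k p * sw b (\<lambda>x z. f x * g (S z * y))) = 0"
        by (simp add: sw_zero)
    qed
    moreover have "sw t (\<lambda>p y. sw p (\<lambda>x z. f x * g (S z * y))) = sw t (\<lambda>x q. sw q (\<lambda>z y. f x * g (S z * y)))"
      by (rule sw_coassoc) (use f' g' in \<open>simp_all add: lin_simps\<close>)
    moreover have "\<dots> = sw t (\<lambda>x q. f x * (\<epsilon> q * g 1))"
      by (simp add: sw_cmult sw_antipode_left[OF g(1)])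
    moreover have "\<dots> = g 1 * f t"
      using sw_counit_right[of "\<lambda>x. f x * g 1" t] f' by (simp add: lin_simps mult_ac)
    ultimately show "g 1 = 0" using f(2) by simp
  qed
  then have "a \<in> R" using R_mult[OF a, of 1] by simp
  then show ?thesis using that by (auto simp: R_def)
qed

text \<open>With \<open>hit f t = 1\<close>, the shift rule writes \<open>a\<close> as the
  contraction of S(a) t1 \<otimes> t2 against \<open>f\<close>, so \<open>S a\<close> determines
  \<open>a\<close>.\<close>

lemma integral_antipode_inj:
  assumes A: "hopf_subalgebra scale \<Delta> S A" and t: "left_integral A t" "t \<noteq> 0"
    and a: "a \<in> A" "S a = 0"
  shows "a = 0"
proof -
  obtain f where f: "lin f" "hit f t = 1"
    using integral_right_legs[OF A t hopf_subalgebraD(3)[OF A]] by blast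
  show ?thesis
  proof (rule zero_if_functionals)
    fix g assume g: "lin g"
    have g': "lin (\<lambda>x. g (a * x))" using g by (simp add: lin_simps)
    have "g a = sw t (\<lambda>x y. f x * g (a * y))" using lin_hit[OF g', of f t] f(2) by simp
    also have "\<dots> = sw t (\<lambda>x y. f (S a * x) * g y)"
      by (rule integral_shift[OF A t(1) a(1), symmetric]) (use f g in \<open>simp add: lin_simps\<close>)
    also have "\<dots> = 0" using a(2) lmap_zero[OF f(1)] by (simp add: sw_zero)
    finally show "g a = 0" .
  qed
qed

text \<open>The right legs of \<open>t\<close> exhaust \<open>A\<close>, and they are combinations
  of the finitely many second components of the representative \<open>\<Delta> t\<close>. Finite
  dimension of \<open>H\<close> itself is obtained from this lemma with \<open>H\<close> in place of
  \<open>A\<close>.\<close>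

lemma integral_finite_dim:
  assumes A: "hopf_subalgebra scale \<Delta> S A" and t: "left_integral A t" "t \<noteq> 0"
  obtains B where "finite B" "A \<subseteq> span B"
proof (rule that)
  show "finite (snd ` Poly_Mapping.keys (\<Delta> t))" by simp
  show "A \<subseteq> span (snd ` Poly_Mapping.keys (\<Delta> t))"
  proof
    fix a assume "a \<in> A"
    then obtain f where f: "hit f t = a" using integral_right_legs[OF A t] by blast
    show "a \<in> span (snd ` Poly_Mapping.keys (\<Delta> t))"
      unfolding f[symmetric] hit_def lin_ext_def
      by (force intro!: span_sum span_scale intro: span_base split: prod.splits)
  qed
qed

text \<open>The kernel of the counit has a complement \<open>L\<close> among the left ideals. The
  component \<Lambda> of 1 in \<open>L\<close> is an integral, since (h - \<epsilon>(h)) \<Lambda>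
  lies in both.\<close>

lemma semisimple_integral:
  assumes "semisimple_ring TYPE('h)"
  obtains \<Lambda> where "left_integral UNIV \<Lambda>" "\<epsilon> \<Lambda> = 1"
proof -
  define K where "K = {h. \<epsilon> h = 0}"
  have "left_ideal K" unfolding K_def
    using lmap_zero[OF lin_counit] by (auto simp: left_ideal_def counit_add counit_mult)
  with assms have "\<exists>L. left_ideal L \<and> K \<inter> L = {0} \<and> (\<forall>h. \<exists>x\<in>K. \<exists>y\<in>L. h = x + y)"
    by (simp add: semisimple_ring_def)
  then obtain L where L: "left_ideal L" "K \<inter> L = {0}" "\<forall>h. \<exists>x\<in>K. \<exists>y\<in>L. h = x + y"
    by (elim exE conjE)
  from L(3)[THEN spec, of 1] obtain x \<Lambda> where \<Lambda>: "x \<in> K" "\<Lambda> \<in> L" "1 = x + \<Lambda>" by (elim bexE)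
  have \<epsilon>: "\<epsilon> \<Lambda> = 1"
    using counit_one \<Lambda> counit_add[of x \<Lambda>] by (simp add: K_def)
  have "h * \<Lambda> = scale (\<epsilon> h) \<Lambda>" for h
  proof -
    have "(h + scale (- \<epsilon> h) 1) * \<Lambda> \<in> L" using L(1) \<Lambda>(2) by (simp add: left_ideal_def)
    moreover have "\<epsilon> ((h + scale (- \<epsilon> h) 1) * \<Lambda>) = 0"
      by (simp add: counit_mult counit_add counit_scale counit_one lmap_diff[OF lin_counit])
    ultimately have "(h + scale (- \<epsilon> h) 1) * \<Lambda> = 0" using L(2) by (auto simp: K_def)
    then show ?thesis by (simp add: left_diff_distrib scale_mult_left)
  qed
  then have "left_integral UNIV \<Lambda>" by (simp add: left_integral_def)
  then show ?thesis using that \<epsilon> by blast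
qed

end

text \<open>A finite basis whose coordinate functionals are defined on the whole type; it serves to
  write traces and to compare dimensions by cardinalities.\<close>

definition coords ::
  "('k::field \<Rightarrow> 'a::ab_group_add \<Rightarrow> 'a) \<Rightarrow> 'a set \<Rightarrow> 'a set \<Rightarrow> ('a \<Rightarrow> 'a \<Rightarrow> 'k) \<Rightarrow> bool" where
  "coords s X B \<beta> \<longleftrightarrow> finite B \<and> B \<subseteq> X \<and> (\<forall>b\<in>B. lmap s (*) (\<beta> b)) \<and>
     (\<forall>x\<in>X. x = (\<Sum>b\<in>B. s (\<beta> b x) b)) \<and> (\<forall>b\<in>B. \<forall>c\<in>B. \<beta> b c = (if b = c then 1 else 0))"

context vector_space
begin

lemma coords_exist:
  assumes X: "subspace X" "finite B0" "X \<subseteq> span B0"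
  obtains B \<beta> where "coords scale X B \<beta>" "card B \<le> card B0"
proof -
  obtain P where P: "lmap scale scale P" "\<And>x. P x \<in> X" "\<And>x. x \<in> X \<Longrightarrow> P x = x"
    using subspace_projection[OF X(1)] by blast
  obtain B where B: "B \<subseteq> X" "independent B" "X \<subseteq> span B"
    by (rule maximal_independent_subset)
  have fin: "finite B" "card B \<le> card B0"
    using independent_span_bound[OF X(2) B(2)] B(1) X(3) by auto
  define \<beta> where "\<beta> b x = representation B (P x) b" for b x
  have "lmap scale (*) (\<beta> b)" for b
    using B P by (auto simp: lmap_iff \<beta>_def representation_add representation_scale subset_eq)
  moreover have "x = (\<Sum>b\<in>B. scale (\<beta> b x) b)" if "x \<in> X" for x
  proof -
    have "x = (\<Sum>b | representation B x b \<noteq> 0. scale (representation B x b) b)"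
      using sum_nonzero_representation_eq[OF B(2), of x] B(3) that by auto
    also have "\<dots> = (\<Sum>b\<in>B. scale (\<beta> b x) b)"
      by (rule sum.mono_neutral_cong_left)
        (use fin P(3)[OF that] in \<open>auto simp: \<beta>_def representation_ne_zero\<close>)
    finally show ?thesis .
  qed
  moreover have "\<beta> b c = (if b = c then 1 else 0)" if "b \<in> B" "c \<in> B" for b c
    using that B(1) by (auto simp: \<beta>_def P(3) subset_eq representation_basis[OF B(2)])
  ultimately have "coords scale X B \<beta>" using fin B(1) by (simp add: coords_def)
  then show ?thesis using that fin(2) by blast
qed

lemma trace_commute:
  assumes c: "coords scale X B \<beta>"
    and T: "lmap scale scale T" "\<And>x. x \<in> X \<Longrightarrow> T x \<in> X"
    and U: "lmap scale scale U" "\<And>x. x \<in> X \<Longrightarrow> U x \<in> X"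
  shows "(\<Sum>b\<in>B. \<beta> b (T (U b))) = (\<Sum>b\<in>B. \<beta> b (U (T b)))"
proof -
  have exp: "\<beta> b (T' (U' b)) = (\<Sum>c\<in>B. \<beta> c (U' b) * \<beta> b (T' c))"
    if "b \<in> B" "lmap scale scale T'" "U' b \<in> X" for b T' U'
  proof -
    have b: "lmap scale (*) (\<beta> b)" and U': "U' b = (\<Sum>c\<in>B. scale (\<beta> c (U' b)) c)"
      using that c by (auto simp: coords_def)
    have "\<beta> b (T' (U' b)) = \<beta> b (T' (\<Sum>c\<in>B. scale (\<beta> c (U' b)) c))"
      by (subst U') (rule refl)
    then show ?thesis
      by (simp add: lmap_sum[OF b] lmap_sum[OF that(2)] lmap_scale[OF b] lmap_scale[OF that(2)])
  qed
  have "B \<subseteq> X" using c by (simp add: coords_def)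
  then have "(\<Sum>b\<in>B. \<beta> b (T (U b))) = (\<Sum>b\<in>B. \<Sum>c\<in>B. \<beta> c (U b) * \<beta> b (T c))"
    using T U by (intro sum.cong exp) auto
  also have "\<dots> = (\<Sum>c\<in>B. \<Sum>b\<in>B. \<beta> c (U b) * \<beta> b (T c))"
    by (rule sum.swap)
  also have "\<dots> = (\<Sum>b\<in>B. \<Sum>c\<in>B. \<beta> c (T b) * \<beta> b (U c))"
    by (intro sum.cong) (auto simp: mult.commute)
  also have "\<dots> = (\<Sum>b\<in>B. \<beta> b (U (T b)))"
    using T U \<open>B \<subseteq> X\<close> by (intro sum.cong exp[symmetric]) auto
  finally show ?thesis .
qed

end

section \<open>Existence of a nonzero left integral\<close>

context hopf_algebra
begin

text \<open>Every trace of the operators \<open>b \<mapsto> g(b\<^sub>1) S\<^sup>2(b\<^sub>2) y\<close> is invariant under \<open>g \<mapsto> g(a \<cdot>)\<close> up to \<open>\<epsilon>(a)\<close> by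
  cyclicity; as a functional of \<open>g\<close> it is given by a left integral.\<close>

lemma left_integral_exists:
  assumes A: "hopf_subalgebra scale \<Delta> S A" and fd: "finite B0" "A \<subseteq> span B0"
  obtains t where "left_integral A t" "t \<noteq> 0"
proof -
  note Ain = hopf_subalgebraD[OF A]
  obtain B \<beta> where c: "coords scale A B \<beta>"
    using coords_exist[OF Ain(1) fd] by blast
  have BA: "b \<in> A" and \<beta>: "lin (\<beta> b)" if "b \<in> B" for b using that c by (auto simp: coords_def)
  have exp: "x = (\<Sum>b\<in>B. scale (\<beta> b x) b)" if "x \<in> A" for x using that c by (simp add: coords_def)
  \<comment> \<open>\<open>T y\<close> represents the trace of \<open>\<Theta> g y\<close> on
    \<open>A\<close> as a functional of \<open>g\<close>, as \<open>gT\<close> shows.\<close>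
  define \<Theta> where "\<Theta> g y b = S (S (hit g b)) * y" for g y b
  define T where "T y = (\<Sum>b\<in>B. hitl (\<lambda>z. \<beta> b (S (S z) * y)) b)" for y
  have gT: "g (T y) = (\<Sum>b\<in>B. \<beta> b (\<Theta> g y b))" if g: "lin g" for g y
  proof -
    have "g (T y) = (\<Sum>b\<in>B. sw b (\<lambda>u v. g u * \<beta> b (S (S v) * y)))"
      by (simp add: T_def lmap_sum[OF g] lin_hitl[OF g])
    also have "\<dots> = (\<Sum>b\<in>B. \<beta> b (\<Theta> g y b))"
    proof (rule sum.cong[OF refl])
      fix b assume "b \<in> B"
      have "lin (\<lambda>z. \<beta> b (S (S z) * y))" using \<beta>[OF \<open>b \<in> B\<close>] by (simp add: lin_simps)
      from lin_hit[OF this, of g b] show "sw b (\<lambda>u v. g u * \<beta> b (S (S v) * y)) = \<beta> b (\<Theta> g y b)"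
        by (simp add: \<Theta>_def)
    qed
    finally show ?thesis .
  qed
  have hitA: "hit g b \<in> A" if "b \<in> A" "lin g" for g b
    using hit_mem[OF Ain(2)[OF that(1)] Ain(1) that(2)] .
  have endo\<Theta>: "endo (\<Theta> g y)" if "lin g" for g y
    using endo_hit[OF that] by (simp add: \<Theta>_def lin_simps)
  have \<Theta>A: "\<Theta> g y b \<in> A" if "b \<in> A" "y \<in> A" "lin g" for g y b
    using hitA[OF that(1,3)] that Ain by (simp add: \<Theta>_def)
  \<comment> \<open>The squared antipode is there for this cancellation: for the legs a1, a2, a3 of
    \<open>a\<close>, the product S(a3) S(S(a2)) equals S(S(a2) a3) and collapses.\<close>
  have shift: "\<phi> (\<Theta> (\<lambda>x. g (a * x)) y b) = sw a (\<lambda>p q. \<phi> (S q * \<Theta> g y (p * b)))"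
    if g: "lin g" and \<phi>: "lin \<phi>" for \<phi> g a y b
  proof -
    note g' = g[unfolded lmap_iff] and \<phi>' = \<phi>[unfolded lmap_iff]
    have l: "lin (\<lambda>z. \<phi> (S q * (S (S z) * y)))" for q using \<phi>' by (simp add: lin_simps)
    have l1: "lin (\<lambda>z. \<phi> (S (S z) * y))" using \<phi>' by (simp add: lin_simps)
    have "sw a (\<lambda>p q. \<phi> (S q * \<Theta> g y (p * b))) = sw a (\<lambda>p q. sw (p * b) (\<lambda>u v. g u * \<phi> (S q * (S (S v) * y))))"
      using lin_hit[OF l] by (simp add: \<Theta>_def)
    also have "\<dots> = sw a (\<lambda>p q. sw p (\<lambda>p1 p2. sw b (\<lambda>u v. g (p1 * u) * \<phi> (S q * (S (S (p2 * v)) * y)))))"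
      by (subst sw_mult) (use g' \<phi>' in \<open>simp_all add: lin_simps\<close>)
    also have "\<dots> = sw a (\<lambda>p q. sw q (\<lambda>p1 p2. sw b (\<lambda>u v. g (p * u) * \<phi> (S p2 * (S (S (p1 * v)) * y)))))"
      by (rule sw_coassoc) (use g' \<phi>' in \<open>simp_all add: lin_simps\<close>)
    also have "\<dots> = sw a (\<lambda>p q. sw b (\<lambda>u v. sw q (\<lambda>p1 p2. g (p * u) * \<phi> (S p2 * (S (S (p1 * v)) * y)))))"
      by (subst (2) sw_swap) (rule refl)
    also have "\<dots> = sw a (\<lambda>p q. sw b (\<lambda>u v. g (p * u) * sw q (\<lambda>p1 p2. \<phi> (S (S p1 * p2) * (S (S v) * y)))))"
      by (simp add: sw_cmult antipode_mult mult.assoc)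
    also have "\<dots> = sw a (\<lambda>p q. sw b (\<lambda>u v. g (p * u) * (\<epsilon> q * \<phi> (S (S v) * y))))"
      using sw_antipode_left[of "\<lambda>z. \<phi> (S z * (S (S v) * y))" for v] \<phi>'
      by (simp add: lin_simps antipode_one)
    also have "\<dots> = sw a (\<lambda>p q. \<epsilon> q * sw b (\<lambda>u v. g (p * u) * \<phi> (S (S v) * y)))"
      by (simp add: sw_cmult[symmetric] mult.left_commute)
    also have "\<dots> = sw b (\<lambda>u v. g (a * u) * \<phi> (S (S v) * y))"
      by (rule sw_counit_right) (use g' \<phi>' in \<open>simp add: lin_simps\<close>)
    also have "\<dots> = \<phi> (\<Theta> (\<lambda>x. g (a * x)) y b)"
      using lin_hit[OF l1] by (simp add: \<Theta>_def)
    finally show ?thesis by simp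
  qed
  have integral: "left_integral A (T y)" if y: "y \<in> A" for y
    unfolding left_integral_def
  proof (intro conjI ballI)
    show "T y \<in> A"
      unfolding T_def
    proof (intro subspace_sum[OF Ain(1)])
      fix b assume b: "b \<in> B"
      show "hitl (\<lambda>z. \<beta> b (S (S z) * y)) b \<in> A"
        by (rule hitl_mem[OF Ain(2)[OF BA[OF b]] Ain(1)]) (use \<beta>[OF b] in \<open>simp add: lin_simps\<close>)
    qed
    fix a assume a: "a \<in> A"
    show "a * T y = scale (\<epsilon> a) (T y)"
    proof (rule eq_if_functionals)
      fix g assume g: "lin g"
      have ga: "lin (\<lambda>x. g (a * x))" using g by (simp add: lin_simps)
      note E = endo\<Theta>[OF g, of y, unfolded lmap_iff]
      have "g (a * T y) = (\<Sum>b\<in>B. sw a (\<lambda>p q. \<beta> b (S q * \<Theta> g y (p * b))))"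
        using gT[OF ga] by (simp add: shift[OF g \<beta>])
      also have "\<dots> = sw a (\<lambda>p q. \<Sum>b\<in>B. \<beta> b (S q * \<Theta> g y (p * b)))"
        by (simp add: sw_sum)
      also have "\<dots> = sw a (\<lambda>p q. \<Sum>b\<in>B. \<beta> b (\<Theta> g y (p * (S q * b))))"
      proof (rule sw_cong_sub[OF Ain(2)[OF a]])
        fix p q assume pq: "p \<in> A" "q \<in> A"
        show "(\<Sum>b\<in>B. \<beta> b (S q * \<Theta> g y (p * b))) = (\<Sum>b\<in>B. \<beta> b (\<Theta> g y (p * (S q * b))))"
          by (rule trace_commute[OF c, of "\<lambda>z. S q * z" "\<lambda>z. \<Theta> g y (p * z)"])
            (use E \<Theta>A[OF _ y g] Ain pq in \<open>auto simp: lin_simps\<close>)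
      qed (use E \<beta> in \<open>auto simp: lin_simps sum.distrib sum_distrib_left\<close>)
      also have "\<dots> = (\<Sum>b\<in>B. sw a (\<lambda>p q. \<beta> b (\<Theta> g y ((p * S q) * b))))"
        by (simp add: sw_sum mult.assoc)
      also have "\<dots> = (\<Sum>b\<in>B. \<epsilon> a * \<beta> b (\<Theta> g y b))"
      proof (rule sum.cong[OF refl])
        fix b assume "b \<in> B"
        have "lin (\<lambda>z. \<beta> b (\<Theta> g y (z * b)))" using \<beta>[OF \<open>b \<in> B\<close>] E by (simp add: lin_simps)
        from sw_antipode_right[OF this, of a]
        show "sw a (\<lambda>p q. \<beta> b (\<Theta> g y ((p * S q) * b))) = \<epsilon> a * \<beta> b (\<Theta> g y b)" by simp
      qed
      also have "\<dots> = g (scale (\<epsilon> a) (T y))"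
        by (simp add: lmap_scale[OF g] gT[OF g] sum_distrib_left)
      finally show "g (a * T y) = g (scale (\<epsilon> a) (T y))" .
    qed
  qed
  have "\<exists>y\<in>A. T y \<noteq> 0"
  proof (rule ccontr)
    assume "\<not> ?thesis"
    then have T0: "T y = 0" if "y \<in> A" for y using that by blast
    have lS: "lin (\<lambda>x. \<beta> b (S x))" if "b \<in> B" for b using \<beta>[OF that] by (simp add: lin_simps)
    \<comment> \<open>Taking \<open>y = c\<close> and the coordinate of the antipode along
      \<open>c\<close>, the sum recombines to S(S(b2)) S(b1) = S(b1 S(b2)), that is \<epsilon>(b) 1.
      This operator has trace \<epsilon>(1) = 1, but its trace is also the sum of the
      \<open>\<beta> c (S (T c))\<close>, all of which are 0.\<close>
    have "(\<Sum>c\<in>B. \<Theta> (\<lambda>x. \<beta> c (S x)) c b) = scale (\<epsilon> b) 1" if b: "b \<in> A" for b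
    proof (rule eq_if_functionals)
      fix \<phi> assume \<phi>: "lin \<phi>"
      note \<phi>' = \<phi>[unfolded lmap_iff]
      have l: "lin (\<lambda>z. \<phi> (S (S z) * c))" for c using \<phi>' by (simp add: lin_simps)
      have l2: "lin (\<lambda>z. \<phi> (S z))" using \<phi>' by (simp add: lin_simps)
      have "\<phi> (\<Sum>c\<in>B. \<Theta> (\<lambda>x. \<beta> c (S x)) c b) = (\<Sum>c\<in>B. sw b (\<lambda>u v. \<beta> c (S u) * \<phi> (S (S v) * c)))"
        using lin_hit[OF l] by (simp add: lmap_sum[OF \<phi>] \<Theta>_def)
      also have "\<dots> = sw b (\<lambda>u v. \<Sum>c\<in>B. \<beta> c (S u) * \<phi> (S (S v) * c))"
        by (simp add: sw_sum)
      also have "\<dots> = sw b (\<lambda>u v. \<phi> (S (u * S v)))"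
      proof (rule sw_cong_sub[OF Ain(2)[OF b]])
        fix u v assume "u \<in> A"
        then have "S u = (\<Sum>c\<in>B. scale (\<beta> c (S u)) c)" using exp Ain by simp
        then have "\<phi> (S (S v) * S u) = \<phi> (S (S v) * (\<Sum>c\<in>B. scale (\<beta> c (S u)) c))" by simp
        also have "\<dots> = (\<Sum>c\<in>B. \<beta> c (S u) * \<phi> (S (S v) * c))"
          by (simp add: sum_distrib_left lmap_sum[OF \<phi>] lmap_scale[OF \<phi>] scale_mult_right)
        finally show "(\<Sum>c\<in>B. \<beta> c (S u) * \<phi> (S (S v) * c)) = \<phi> (S (u * S v))"
          by (simp add: antipode_mult)
      qed (use \<phi>' \<beta> in \<open>auto simp: lin_simps sum.distrib sum_distrib_left\<close>)
      also have "\<dots> = \<phi> (scale (\<epsilon> b) 1)"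
        using sw_antipode_right[OF l2] by (simp add: antipode_one lmap_scale[OF \<phi>])
      finally show "\<phi> (\<Sum>c\<in>B. \<Theta> (\<lambda>x. \<beta> c (S x)) c b) = \<phi> (scale (\<epsilon> b) 1)" .
    qed
    then have "(\<Sum>b\<in>B. \<beta> b (\<Sum>c\<in>B. \<Theta> (\<lambda>x. \<beta> c (S x)) c b)) = (\<Sum>b\<in>B. \<epsilon> b * \<beta> b 1)"
      using \<beta> BA by (intro sum.cong) (auto simp: lmap_scale[of scale "(*)"])
    also have "\<dots> = \<epsilon> (\<Sum>b\<in>B. scale (\<beta> b 1) b)"
      by (simp add: lmap_sum[OF lin_counit] counit_scale mult.commute)
    also have "\<dots> = 1" using exp[OF Ain(3)] counit_one by simp
    finally have "(\<Sum>b\<in>B. \<beta> b (\<Sum>c\<in>B. \<Theta> (\<lambda>x. \<beta> c (S x)) c b)) = 1" .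
    moreover have "(\<Sum>b\<in>B. \<beta> b (\<Sum>c\<in>B. \<Theta> (\<lambda>x. \<beta> c (S x)) c b)) = (\<Sum>b\<in>B. \<Sum>c\<in>B. \<beta> b (\<Theta> (\<lambda>x. \<beta> c (S x)) c b))"
      using \<beta> by (intro sum.cong) (auto simp: lmap_sum[of scale "(*)"])
    moreover have "\<dots> = (\<Sum>c\<in>B. \<Sum>b\<in>B. \<beta> b (\<Theta> (\<lambda>x. \<beta> c (S x)) c b))" by (rule sum.swap)
    moreover have "\<dots> = (\<Sum>c\<in>B. \<beta> c (S (T c)))"
      using gT[OF lS] by simp
    moreover have "\<dots> = 0"
      using T0 BA lmap_zero[OF lS] by simp
    ultimately show False by simp
  qed
  then show ?thesis using integral that by blast
qed


section \<open>Averages over an integral of \<open>H\<close>\<close>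

definition tlin :: "('h \<Rightarrow> 'h \<Rightarrow> 'h \<Rightarrow> 'k) \<Rightarrow> bool" where
  "tlin G \<longleftrightarrow> (\<forall>b c. lin (\<lambda>a. G a b c)) \<and> (\<forall>a c. lin (\<lambda>b. G a b c)) \<and> (\<forall>a b. lin (G a b))"

lemma tlin_fun:
  assumes "tlin G"
  shows "G (x + y) = (\<lambda>b c. G x b c + G y b c)" "G (scale k x) = (\<lambda>b c. k * G x b c)"
    "G a (x + y) = (\<lambda>c. G a x c + G a y c)" "G a (scale k x) = (\<lambda>c. k * G a x c)"
    "G a b (x + y) = G a b x + G a b y" "G a b (scale k x) = k * G a b x"
  using assms by (simp_all add: tlin_def lmap_iff fun_eq_iff)

lemma sw_coassoc_right:
  assumes "\<And>b c d. lin (\<lambda>a. K a b c d)" "\<And>a c d. lin (\<lambda>b. K a b c d)"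
    "\<And>a b d. lin (\<lambda>c. K a b c d)" "\<And>a b c. lin (K a b c)"
  shows "sw h (\<lambda>p d. sw p (\<lambda>a q. sw q (\<lambda>b c. K a b c d))) =
    sw h (\<lambda>a p. sw p (\<lambda>b q. sw q (\<lambda>c d. K a b c d)))"
proof -
  have "sw h (\<lambda>p d. sw p (\<lambda>a q. sw q (\<lambda>b c. K a b c d))) =
      sw h (\<lambda>a p. sw p (\<lambda>q d. sw q (\<lambda>b c. K a b c d)))"
    by (rule sw_coassoc) (use assms in \<open>auto intro!: lin_sw_param lin_sw simp: bilin_def\<close>)
  also have "\<dots> = sw h (\<lambda>a p. sw p (\<lambda>b q. sw q (\<lambda>c d. K a b c d)))"
    by (intro sw_cong sw_coassoc) (use assms in auto)
  finally show ?thesis .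
qed

text \<open>The antipode reverses the order of legs, so the legs of \<open>S r\<close> meet those of
  \<open>q\<close> as s2 S(s3) and s1 S(s4). These collapse from the inside, and only the antipode
  of \<open>s\<close> in the first slot survives.\<close>

lemma sw_antipode_cancel:
  assumes R: "tlin R"
  shows "sw s (\<lambda>q r. sw q (\<lambda>s1 s2. sw (S r) (\<lambda>a1 a'. sw a' (\<lambda>a2 a3. R a1 (S (s2 * a3)) (S (s1 * a2))))))
    = R (S s) 1 1"
proof -
  note R' = tlin_fun[OF R]
  have one: "sw w (\<lambda>s2 x1. R u (S (s2 * S x1)) v) = \<epsilon> w * R u 1 v" for w u v
    using sw_antipode_right[of "\<lambda>z. R u (S z) v" w] by (simp add: lin_simps R' antipode_one)
  have two: "sw w (\<lambda>s1 x2. R u v (S (s1 * S x2))) = \<epsilon> w * R u v 1" for w u v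
    using sw_antipode_right[of "\<lambda>z. R u v (S z)" w] by (simp add: lin_simps R' antipode_one)
  have "sw s (\<lambda>q r. sw q (\<lambda>s1 s2. sw (S r) (\<lambda>a1 a'. sw a' (\<lambda>a2 a3. R a1 (S (s2 * a3)) (S (s1 * a2))))))
      = sw s (\<lambda>q r. sw q (\<lambda>s1 s2. sw r (\<lambda>x y. sw x (\<lambda>x1 x2. R (S y) (S (s2 * S x1)) (S (s1 * S x2))))))"
    by (simp add: sw_antipode lin_simps R')
  also have "\<dots> = sw s (\<lambda>s1 r0. sw r0 (\<lambda>s2 r. sw r (\<lambda>x y. sw x (\<lambda>x1 x2. R (S y) (S (s2 * S x1)) (S (s1 * S x2))))))"
    by (rule sw_coassoc) (simp_all add: lin_simps R')
  also have "\<dots> = sw s (\<lambda>s1 r0. sw r0 (\<lambda>s2 r. sw r (\<lambda>x1 z. sw z (\<lambda>x2 y. R (S y) (S (s2 * S x1)) (S (s1 * S x2))))))"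
    by (intro sw_cong sw_coassoc) (simp_all add: lin_simps R')
  also have "\<dots> = sw s (\<lambda>s1 r0. sw r0 (\<lambda>w z. sw w (\<lambda>s2 x1. sw z (\<lambda>x2 y. R (S y) (S (s2 * S x1)) (S (s1 * S x2))))))"
    by (intro sw_cong sw_coassoc[symmetric]) (simp_all add: lin_simps R')
  also have "\<dots> = sw s (\<lambda>s1 r0. sw r0 (\<lambda>w z. sw z (\<lambda>x2 y. sw w (\<lambda>s2 x1. R (S y) (S (s2 * S x1)) (S (s1 * S x2))))))"
    by (intro sw_cong sw_swap)
  also have "\<dots> = sw s (\<lambda>s1 r0. sw r0 (\<lambda>w z. \<epsilon> w * sw z (\<lambda>x2 y. R (S y) 1 (S (s1 * S x2)))))"
    by (simp add: one sw_cmult)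
  also have "\<dots> = sw s (\<lambda>s1 r0. sw r0 (\<lambda>x2 y. R (S y) 1 (S (s1 * S x2))))"
    by (intro sw_cong sw_counit_left) (simp add: lin_simps R')
  also have "\<dots> = sw s (\<lambda>w y. sw w (\<lambda>s1 x2. R (S y) 1 (S (s1 * S x2))))"
    by (rule sw_coassoc[symmetric]) (simp_all add: lin_simps R')
  also have "\<dots> = sw s (\<lambda>w y. \<epsilon> w * R (S y) 1 1)"
    by (simp add: two)
  also have "\<dots> = R (S s) 1 1"
    by (rule sw_counit_left) (simp add: lin_simps R')
  finally show ?thesis .
qed

text \<open>If \<open>\<pi>\<close> is an \<open>A\<close>-linear map from \<open>H\<close> to \<open>A\<close>, the terms with \<open>\<pi>\<close> factor through a free \<open>A\<close>-module and
  vanish in a sum that starts with \<open>g(\<Lambda>\<^sub>1)\<close>, where \<open>g\<close> is zero on \<open>tH\<close>.\<close>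

lemma integral_projection_vanishes:
  assumes A: "hopf_subalgebra scale \<Delta> S A" and t: "left_integral A t" "t \<noteq> 0"
    and s: "s \<in> A" "S s = t" and \<Lambda>: "left_integral UNIV \<Lambda>"
    and g: "lin g" "\<And>h. g (t * h) = 0"
    and \<pi>: "endo \<pi>" "\<And>h. \<pi> h \<in> A" "\<And>a h. a \<in> A \<Longrightarrow> \<pi> (a * h) = a * \<pi> h"
    and G: "tlin G" "\<And>c b a h. c \<in> A \<Longrightarrow> G b (a * c) h = G (c * b) a h"
  shows "sw \<Lambda> (\<lambda>x1 y. g x1 * sw y (\<lambda>x2 r. sw r (\<lambda>x3 v. sw v (\<lambda>x4 x5. G x5 (S x2) (S x3 * \<pi> (x4 * x)))))) = 0"
proof -
  note Ain = hopf_subalgebraD[OF A]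
  note G' = tlin_fun[OF G(1)]
  note g' = g(1)[unfolded lmap_iff] and \<pi>' = \<pi>(1)[unfolded lmap_iff]
  obtain \<phi> where \<phi>: "lin \<phi>" "hit \<phi> t = 1"
    using integral_right_legs[OF A t Ain(3)] by blast
  note \<phi>' = \<phi>(1)[unfolded lmap_iff]
  \<comment> \<open>Since \<open>t = S s\<close> and \<open>hit \<phi> t = 1\<close>, this recovers
    \<open>a\<close> from values of \<phi>: the dual basis formula of a Frobenius algebra.\<close>
  have C1: "sw s (\<lambda>s1 s2. \<phi> (S (s2 * a)) * f (S s1)) = f a" if a: "a \<in> A" and f: "lin f" for a f
  proof -
    note f' = f[unfolded lmap_iff]
    have l: "lin (\<lambda>x. f (a * x))" using f' by (simp add: lin_simps)
    have "f a = sw t (\<lambda>x y. \<phi> x * f (a * y))" using lin_hit[OF l, of \<phi> t] \<phi>(2) by simp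
    also have "\<dots> = sw t (\<lambda>x y. \<phi> (S a * x) * f y)"
      by (rule integral_shift[OF A t(1) a, symmetric]) (use f' \<phi>' in \<open>simp add: lin_simps\<close>)
    also have "\<dots> = sw s (\<lambda>s1 s2. \<phi> (S a * S s2) * f (S s1))"
      unfolding s(2)[symmetric] by (rule sw_antipode) (use f' \<phi>' in \<open>simp add: lin_simps\<close>)
    finally show ?thesis by (simp add: antipode_mult)
  qed
  \<comment> \<open>\<open>E\<close> sees \<open>\<pi> h\<close> through \<phi> and one leg moved
    into \<open>G\<close>; \<open>AB\<close> reconstructs the original term from \<open>E\<close> by
    inserting the legs of \<open>s\<close>. This is the factorization through a free module, written
    with functionals.\<close>
  define E where "E b c u h = sw (\<pi> h) (\<lambda>p1 p2. \<phi> (S p1) * G (S p2 * b) c u)" for b c u h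
  have E': "E (x + y) = (\<lambda>c u h. E x c u h + E y c u h)" "E (scale k x) = (\<lambda>c u h. k * E x c u h)"
    "E b (x + y) = (\<lambda>u h. E b x u h + E b y u h)" "E b (scale k x) = (\<lambda>u h. k * E b x u h)"
    "E b c (x + y) = (\<lambda>h. E b c x h + E b c y h)" "E b c (scale k x) = (\<lambda>h. k * E b c x h)"
    "E b c u (x + y) = E b c u x + E b c u y" "E b c u (scale k x) = k * E b c u x"
    for b c u x y k
    using \<phi>' \<pi>' by (simp_all add: E_def fun_eq_iff lin_simps G')
  have AB: "G b c (u * \<pi> h) = sw s (\<lambda>q r. sw q (\<lambda>s1 s2. sw r (\<lambda>s3 s4.
      E (s4 * b) (c * S s1) (u * S s2) (s3 * h))))" for b c u h
  proof -
    define p where "p = \<pi> h"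
    have pA: "p \<in> A" by (simp add: p_def \<pi>)
    have B: "sw r (\<lambda>s3 s4. E (s4 * b) c' u' (s3 * h)) = sw p (\<lambda>p1 p2. \<phi> (S (r * p1)) * G (S p2 * b) c' u')"
      if r: "r \<in> A" for r c' u'
    proof -
      have anti: "sw w (\<lambda>y s4. G (S p2 * (S y * s4) * b) c' u') = \<epsilon> w * G (S p2 * b) c' u'" for w p2
        using sw_antipode_left[of "\<lambda>z. G (S p2 * z * b) c' u'" w] by (simp add: lin_simps G')
      have "sw r (\<lambda>s3 s4. E (s4 * b) c' u' (s3 * h))
          = sw r (\<lambda>s3 s4. sw (s3 * p) (\<lambda>p1 p2. \<phi> (S p1) * G (S p2 * (s4 * b)) c' u'))"
        by (rule sw_cong_sub[OF Ain(2)[OF r]])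
          (use \<phi>' \<pi>' in \<open>simp_all add: E' lin_simps G'\<close>, simp add: E_def p_def \<pi>(3))
      also have "\<dots> = sw r (\<lambda>s3 s4. sw s3 (\<lambda>x y. sw p (\<lambda>p1 p2. \<phi> (S (x * p1)) * G (S p2 * (S y * s4) * b) c' u')))"
        using \<phi>' by (simp add: sw_mult lin_simps G' antipode_mult)
      also have "\<dots> = sw r (\<lambda>x w. sw w (\<lambda>y s4. sw p (\<lambda>p1 p2. \<phi> (S (x * p1)) * G (S p2 * (S y * s4) * b) c' u')))"
        by (rule sw_coassoc) (use \<phi>' in \<open>simp_all add: lin_simps G'\<close>)
      also have "\<dots> = sw r (\<lambda>x w. sw p (\<lambda>p1 p2. sw w (\<lambda>y s4. \<phi> (S (x * p1)) * G (S p2 * (S y * s4) * b) c' u')))"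
        by (intro sw_cong sw_swap)
      also have "\<dots> = sw r (\<lambda>x w. \<epsilon> w * sw p (\<lambda>p1 p2. \<phi> (S (x * p1)) * G (S p2 * b) c' u'))"
        by (simp add: sw_cmult anti) (simp add: sw_cmult[symmetric] mult.left_commute)
      also have "\<dots> = sw p (\<lambda>p1 p2. \<phi> (S (r * p1)) * G (S p2 * b) c' u')"
        by (rule sw_counit_right) (use \<phi>' in \<open>simp add: lin_simps G'\<close>)
      finally show ?thesis .
    qed
    have f: "lin (\<lambda>z. sw z (\<lambda>x y. G d (c * y) (u * x)))" for d
      by (simp add: lin_simps G')
    have anti: "sw w (\<lambda>y p2. G b (c * (y * S p2)) x) = \<epsilon> w * G b c x" for w x
      using sw_antipode_right[of "\<lambda>z. G b (c * z) x" w] by (simp add: lin_simps G')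
    have "sw s (\<lambda>q r. sw q (\<lambda>s1 s2. sw r (\<lambda>s3 s4. E (s4 * b) (c * S s1) (u * S s2) (s3 * h))))
        = sw s (\<lambda>q r. sw q (\<lambda>s1 s2. sw p (\<lambda>p1 p2. \<phi> (S (r * p1)) * G (S p2 * b) (c * S s1) (u * S s2))))"
      by (rule sw_cong_sub[OF Ain(2)[OF s(1)]]) (use \<phi>' in \<open>simp_all add: E' lin_simps G'\<close>, simp add: B)
    also have "\<dots> = sw s (\<lambda>q r. sw p (\<lambda>p1 p2. sw q (\<lambda>s1 s2. \<phi> (S (r * p1)) * G (S p2 * b) (c * S s1) (u * S s2))))"
      by (intro sw_cong sw_swap)
    also have "\<dots> = sw p (\<lambda>p1 p2. sw s (\<lambda>q r. \<phi> (S (r * p1)) * sw (S q) (\<lambda>x y. G (S p2 * b) (c * y) (u * x))))"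
      by (subst sw_swap) (simp add: sw_cmult sw_antipode lin_simps G')
    also have "\<dots> = sw p (\<lambda>p1 p2. sw p1 (\<lambda>x y. G b (c * (y * S p2)) (u * x)))"
    proof (rule sw_cong_sub[OF Ain(2)[OF pA]])
      fix p1 p2 assume p12: "p1 \<in> A" "p2 \<in> A"
      have "sw s (\<lambda>q r. \<phi> (S (r * p1)) * sw (S q) (\<lambda>x y. G (S p2 * b) (c * y) (u * x)))
          = sw p1 (\<lambda>x y. G (S p2 * b) (c * y) (u * x))"
        by (rule C1[OF p12(1) f])
      also have "\<dots> = sw p1 (\<lambda>x y. G b (c * (y * S p2)) (u * x))"
        using G(2)[OF Ain(5)[OF p12(2)], of b "c * y" for y] by (simp add: mult.assoc)
      finally show "sw s (\<lambda>q r. \<phi> (S (r * p1)) * sw (S q) (\<lambda>x y. G (S p2 * b) (c * y) (u * x)))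
          = sw p1 (\<lambda>x y. G b (c * (y * S p2)) (u * x))" .
    qed (use \<phi>' in \<open>simp_all add: lin_simps G'\<close>)
    also have "\<dots> = sw p (\<lambda>x w. sw w (\<lambda>y p2. G b (c * (y * S p2)) (u * x)))"
      by (rule sw_coassoc) (simp_all add: lin_simps G')
    also have "\<dots> = sw p (\<lambda>x w. \<epsilon> w * G b c (u * x))"
      by (simp only: anti)
    also have "\<dots> = G b c (u * p)"
      by (rule sw_counit_right) (simp add: lin_simps G')
    finally show ?thesis by (simp add: p_def)
  qed
  define M where "M q X w = sw X (\<lambda>x1 y. g x1 * sw y (\<lambda>x2 x3. sw q (\<lambda>s1 s2. sw w (\<lambda>x4 x5.
      E x5 (S x2 * S s1) (S x3 * S s2) (x4 * x)))))" for q X w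
  have M': "blin (M q)" for q
    using g' by (simp add: M_def[abs_def] lin_simps E')
  have "sw \<Lambda> (\<lambda>x1 y. g x1 * sw y (\<lambda>x2 r. sw r (\<lambda>x3 v. sw v (\<lambda>x4 x5. G x5 (S x2) (S x3 * \<pi> (x4 * x))))))
      = sw \<Lambda> (\<lambda>x1 y. sw y (\<lambda>x2 r. sw r (\<lambda>x3 v. g x1 * sw v (\<lambda>x4 x5. G x5 (S x2) (S x3 * \<pi> (x4 * x))))))"
    by (simp add: sw_cmult)
  also have "\<dots> = sw \<Lambda> (\<lambda>X v. sw X (\<lambda>x1 y. sw y (\<lambda>x2 x3. g x1 * sw v (\<lambda>x4 x5. G x5 (S x2) (S x3 * \<pi> (x4 * x))))))"
    by (rule sw_coassoc_right[symmetric]) (use g' \<pi>' in \<open>simp_all add: lin_simps G'\<close>)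
  also have "\<dots> = sw \<Lambda> (\<lambda>X v. sw s (\<lambda>q r. M q X (r * v)))"
  proof (intro sw_cong)
    fix X v
    have "sw v (\<lambda>x4 x5. G x5 (S x2) (S x3 * \<pi> (x4 * x)))
        = sw s (\<lambda>q r. sw q (\<lambda>s1 s2. sw (r * v) (\<lambda>x4 x5. E x5 (S x2 * S s1) (S x3 * S s2) (x4 * x))))" for x2 x3
    proof -
      have "sw v (\<lambda>x4 x5. G x5 (S x2) (S x3 * \<pi> (x4 * x)))
        = sw v (\<lambda>x4 x5. sw s (\<lambda>q r. sw q (\<lambda>s1 s2. sw r (\<lambda>s3 s4.
            E (s4 * x5) (S x2 * S s1) (S x3 * S s2) (s3 * (x4 * x))))))"
        by (simp only: AB)
      also have "\<dots> = sw s (\<lambda>q r. sw v (\<lambda>x4 x5. sw q (\<lambda>s1 s2. sw r (\<lambda>s3 s4.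
            E (s4 * x5) (S x2 * S s1) (S x3 * S s2) (s3 * (x4 * x))))))"
        by (rule sw_swap)
      also have "\<dots> = sw s (\<lambda>q r. sw q (\<lambda>s1 s2. sw v (\<lambda>x4 x5. sw r (\<lambda>s3 s4.
            E (s4 * x5) (S x2 * S s1) (S x3 * S s2) (s3 * (x4 * x))))))"
        by (intro sw_cong sw_swap)
      also have "\<dots> = sw s (\<lambda>q r. sw q (\<lambda>s1 s2. sw r (\<lambda>s3 s4. sw v (\<lambda>x4 x5.
            E (s4 * x5) (S x2 * S s1) (S x3 * S s2) (s3 * (x4 * x))))))"
        by (intro sw_cong sw_swap)
      also have "\<dots> = sw s (\<lambda>q r. sw q (\<lambda>s1 s2. sw (r * v) (\<lambda>x4 x5. E x5 (S x2 * S s1) (S x3 * S s2) (x4 * x))))"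
        by (simp add: sw_mult lin_simps E')
      finally show ?thesis .
    qed
    then have "sw X (\<lambda>x1 y. sw y (\<lambda>x2 x3. g x1 * sw v (\<lambda>x4 x5. G x5 (S x2) (S x3 * \<pi> (x4 * x)))))
      = sw X (\<lambda>x1 y. sw y (\<lambda>x2 x3. g x1 * sw s (\<lambda>q r. sw q (\<lambda>s1 s2. sw (r * v) (\<lambda>x4 x5. E x5 (S x2 * S s1) (S x3 * S s2) (x4 * x))))))"
      by simp
    also have "\<dots> = sw X (\<lambda>x1 y. sw s (\<lambda>q r. g x1 * sw y (\<lambda>x2 x3. sw q (\<lambda>s1 s2. sw (r * v) (\<lambda>x4 x5. E x5 (S x2 * S s1) (S x3 * S s2) (x4 * x))))))"
      unfolding sw_cmult by (intro sw_cong arg_cong2[where f = "(*)"] refl sw_swap)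
    also have "\<dots> = sw s (\<lambda>q r. M q X (r * v))"
      unfolding M_def by (rule sw_swap)
    finally show "sw X (\<lambda>x1 y. sw y (\<lambda>x2 x3. g x1 * sw v (\<lambda>x4 x5. G x5 (S x2) (S x3 * \<pi> (x4 * x)))))
      = sw s (\<lambda>q r. M q X (r * v))" .
  qed
  also have "\<dots> = sw s (\<lambda>q r. sw \<Lambda> (\<lambda>X v. M q X (r * v)))" by (rule sw_swap)
  \<comment> \<open>\<open>r\<close> acts on the trailing legs of \<Lambda>; the shift rule
    transfers it as \<open>S r\<close> to the leading legs, among them the argument of
    \<open>g\<close>.\<close>
  also have "\<dots> = sw s (\<lambda>q r. sw \<Lambda> (\<lambda>X v. M q (S r * X) v))"
    by (simp only: integral_shift[OF hopf_subalgebra_UNIV \<Lambda> UNIV_I M'])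
  also have "\<dots> = sw \<Lambda> (\<lambda>X v. sw s (\<lambda>q r. M q (S r * X) v))" by (rule sw_swap)
  also have "\<dots> = sw \<Lambda> (\<lambda>X v. 0)"
  proof (intro sw_cong)
    fix X v
    define R where "R \<alpha> \<beta> \<gamma> = sw X (\<lambda>x1 y. g (\<alpha> * x1) * sw y (\<lambda>x2 x3. sw v (\<lambda>x4 x5.
      E x5 (S x2 * \<gamma>) (S x3 * \<beta>) (x4 * x))))" for \<alpha> \<beta> \<gamma>
    have R: "tlin R" using g' by (simp add: R_def[abs_def] tlin_def lin_simps E')
    have "M q (S r * X) v = sw q (\<lambda>s1 s2. sw (S r) (\<lambda>a1 a'. sw a' (\<lambda>a2 a3. R a1 (S (s2 * a3)) (S (s1 * a2)))))" for q r
    proof -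
      have "M q (S r * X) v = sw (S r) (\<lambda>a1 a'. sw X (\<lambda>x1 y. g (a1 * x1) * sw (a' * y) (\<lambda>x2 x3. sw q (\<lambda>s1 s2. sw v (\<lambda>x4 x5.
          E x5 (S x2 * S s1) (S x3 * S s2) (x4 * x))))))"
        unfolding M_def by (rule sw_mult) (use g' in \<open>simp add: lin_simps E'\<close>)
      also have "\<dots> = sw (S r) (\<lambda>a1 a'. sw X (\<lambda>x1 y. sw a' (\<lambda>a2 a3. sw q (\<lambda>s1 s2. g (a1 * x1) * sw y (\<lambda>x2 x3. sw v (\<lambda>x4 x5.
          E x5 (S x2 * S (s1 * a2)) (S x3 * S (s2 * a3)) (x4 * x)))))))"
      proof (intro sw_cong)
        fix a1 a' x1 y
        have "sw (a' * y) (\<lambda>x2 x3. sw q (\<lambda>s1 s2. sw v (\<lambda>x4 x5. E x5 (S x2 * S s1) (S x3 * S s2) (x4 * x))))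
          = sw a' (\<lambda>a2 a3. sw y (\<lambda>x2 x3. sw q (\<lambda>s1 s2. sw v (\<lambda>x4 x5.
              E x5 (S x2 * S (s1 * a2)) (S x3 * S (s2 * a3)) (x4 * x)))))"
          by (subst sw_mult) (simp_all add: lin_simps E' antipode_mult)
        also have "\<dots> = sw a' (\<lambda>a2 a3. sw q (\<lambda>s1 s2. sw y (\<lambda>x2 x3. sw v (\<lambda>x4 x5.
              E x5 (S x2 * S (s1 * a2)) (S x3 * S (s2 * a3)) (x4 * x)))))"
          by (intro sw_cong sw_swap)
        finally show "g (a1 * x1) * sw (a' * y) (\<lambda>x2 x3. sw q (\<lambda>s1 s2. sw v (\<lambda>x4 x5. E x5 (S x2 * S s1) (S x3 * S s2) (x4 * x))))
          = sw a' (\<lambda>a2 a3. sw q (\<lambda>s1 s2. g (a1 * x1) * sw y (\<lambda>x2 x3. sw v (\<lambda>x4 x5.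
          E x5 (S x2 * S (s1 * a2)) (S x3 * S (s2 * a3)) (x4 * x)))))"
          by (simp add: sw_cmult)
      qed
      also have "\<dots> = sw (S r) (\<lambda>a1 a'. sw a' (\<lambda>a2 a3. sw X (\<lambda>x1 y. sw q (\<lambda>s1 s2. g (a1 * x1) * sw y (\<lambda>x2 x3. sw v (\<lambda>x4 x5.
          E x5 (S x2 * S (s1 * a2)) (S x3 * S (s2 * a3)) (x4 * x)))))))"
        by (intro sw_cong sw_swap)
      also have "\<dots> = sw (S r) (\<lambda>a1 a'. sw a' (\<lambda>a2 a3. sw q (\<lambda>s1 s2. R a1 (S (s2 * a3)) (S (s1 * a2)))))"
        unfolding R_def by (intro sw_cong sw_swap)
      also have "\<dots> = sw (S r) (\<lambda>a1 a'. sw q (\<lambda>s1 s2. sw a' (\<lambda>a2 a3. R a1 (S (s2 * a3)) (S (s1 * a2)))))"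
        by (intro sw_cong sw_swap)
      also have "\<dots> = sw q (\<lambda>s1 s2. sw (S r) (\<lambda>a1 a'. sw a' (\<lambda>a2 a3. R a1 (S (s2 * a3)) (S (s1 * a2)))))"
        by (rule sw_swap)
      finally show ?thesis .
    qed
    \<comment> \<open>Of the inserted legs only \<open>S s = t\<close> remains, as a left factor in
      the argument of \<open>g\<close>, and \<open>g\<close> vanishes there.\<close>
    then have "sw s (\<lambda>q r. M q (S r * X) v) = R (S s) 1 1"
      using sw_antipode_cancel[OF R] by simp
    also have "\<dots> = 0" using g(2) by (simp add: R_def s(2) sw_zero)
    finally show "sw s (\<lambda>q r. M q (S r * X) v) = 0" .
  qed
  finally show ?thesis by (simp add: sw_zero)
qed

end

text \<open>Elimination: an equation \<open>q0\<close> with nonzero coefficient at \<open>p0\<close>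
  is solved for \<open>p0\<close> and substituted into the others. The dimension counts below, also
  those for tensor powers, use this lemma on finite index sets.\<close>

lemma homogeneous_system_solution:
  fixes M :: "'q \<Rightarrow> 'p \<Rightarrow> 'k::field"
  assumes "finite Q" "finite P" "card Q < card P"
  shows "\<exists>c. (\<exists>p\<in>P. c p \<noteq> 0) \<and> (\<forall>q\<in>Q. (\<Sum>p\<in>P. M q p * c p) = 0)"
  using assms
proof (induction Q arbitrary: P M rule: finite_induct)
  case empty
  then show ?case by (intro exI[of _ "\<lambda>p. 1"]) (auto simp: card_gt_0_iff)
next
  case (insert q0 Q)
  show ?case
  proof (cases "\<forall>p\<in>P. M q0 p = 0")
    case True
    have "card Q < card P" using insert by simp
    from insert.IH[OF insert.prems(1) this] True show ?thesis by simp
  next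
    case False
    then obtain p0 where p0: "p0 \<in> P" "M q0 p0 \<noteq> 0" by blast
    let ?P = "P - {p0}"
    have fin: "finite ?P" and card: "card Q < card ?P"
      using insert p0 by auto
    from insert.IH[OF fin card, of "\<lambda>q p. M q p - M q p0 * M q0 p / M q0 p0"]
    obtain c where c: "\<exists>p\<in>?P. c p \<noteq> 0" "\<And>q. q \<in> Q \<Longrightarrow> (\<Sum>p\<in>?P. (M q p - M q p0 * M q0 p / M q0 p0) * c p) = 0"
      by blast
    define z where "z = - (\<Sum>p\<in>?P. M q0 p * c p) / M q0 p0"
    define c' where "c' = c(p0 := z)"
    have sum: "(\<Sum>p\<in>P. M q p * c' p) = M q p0 * z + (\<Sum>p\<in>?P. M q p * c p)" for q
      by (subst sum.remove[OF insert.prems(1) p0(1)]) (simp add: c'_def)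
    have "(\<Sum>p\<in>P. M q p * c' p) = 0" if "q \<in> insert q0 Q" for q
    proof (cases "q = q0")
      case True
      then show ?thesis using p0(2) by (simp add: sum z_def)
    next
      case False
      then have "(\<Sum>p\<in>?P. M q p * c p - M q p0 * M q0 p / M q0 p0 * c p) = 0"
        using that c(2)[of q] by (simp add: left_diff_distrib)
      then have "(\<Sum>p\<in>?P. M q p * c p) = (\<Sum>p\<in>?P. M q p0 / M q0 p0 * (M q0 p * c p))"
        by (simp add: sum_subtractf mult.assoc)
      also have "\<dots> = M q p0 / M q0 p0 * (\<Sum>p\<in>?P. M q0 p * c p)"
        by (simp only: sum_distrib_left)
      finally show ?thesis unfolding sum z_def by simp
    qed
    moreover have "\<exists>p\<in>P. c' p \<noteq> 0" using c(1) by (auto simp: c'_def)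
    ultimately show ?thesis by blast
  qed
qed

section \<open>Tensor powers of \<open>H\<close> as \<open>A\<close>-modules\<close>

context hopf_algebra
begin

text \<open>Multilinear forms on \<open>H\<^sup>\<otimes>\<^sup>n\<close> are functions on lists; \<open>teval \<nu> xs F b\<close> is the value of \<open>F\<close> at
  \<open>\<nu>(b\<^sub>1 x\<^sub>1) \<otimes> \<dots> \<otimes> \<nu>(b\<^sub>n x\<^sub>n)\<close>, and \<open>teval_act \<nu> xs F b a\<close> is its value at \<open>a \<cdot> \<nu>\<^sup>\<otimes>\<^sup>n (b \<cdot> xs)\<close>.\<close>

definition mlin :: "('h list \<Rightarrow> 'k) \<Rightarrow> bool" where
  "mlin F \<longleftrightarrow> (\<forall>xs ys. lin (\<lambda>x. F (xs @ x # ys)))"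

primrec teval :: "('h \<Rightarrow> 'h) \<Rightarrow> 'h list \<Rightarrow> ('h list \<Rightarrow> 'k) \<Rightarrow> 'h \<Rightarrow> 'k" where
  "teval \<nu> [] F b = \<epsilon> b * F []"
| "teval \<nu> (x # xs) F b = sw b (\<lambda>p q. teval \<nu> xs (\<lambda>ys. F (\<nu> (p * x) # ys)) q)"

definition teval_act :: "('h \<Rightarrow> 'h) \<Rightarrow> 'h list \<Rightarrow> ('h list \<Rightarrow> 'k) \<Rightarrow> 'h \<Rightarrow> 'h \<Rightarrow> 'k" where
  "teval_act \<nu> xs F b a = teval \<nu> xs (\<lambda>ys. teval (\<lambda>x. x) ys F a) b"

lemma mlinD: "mlin F \<Longrightarrow> lin (\<lambda>x. F (xs @ x # ys))"
  by (simp add: mlin_def)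

lemma mlin_Cons: "mlin F \<Longrightarrow> mlin (\<lambda>ys. F (x # ys))"
  using mlinD[of F "x # xs" ys for xs ys] by (simp add: mlin_def[of "\<lambda>ys. F (x # ys)"])

lemma mlin_head: "mlin F \<Longrightarrow> lin (\<lambda>x. F (x # ys))"
  using mlinD[of F "[]"] by simp

lemma teval_add: "teval \<nu> xs (\<lambda>ys. F ys + G ys) b = teval \<nu> xs F b + teval \<nu> xs G b"
  by (induction xs arbitrary: F G b) (simp_all add: distrib_left sw_plus)

lemma teval_cmult: "teval \<nu> xs (\<lambda>ys. c * F ys) b = c * teval \<nu> xs F b"
  by (induction xs arbitrary: F b) (simp_all add: sw_cmult)

lemma teval_sw: "teval \<nu> xs (\<lambda>ys. sw a (\<lambda>u v. D u v ys)) b = sw a (\<lambda>u v. teval \<nu> xs (D u v) b)"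
proof (induction xs arbitrary: D b)
  case Nil
  then show ?case by (simp add: sw_cmult)
next
  case (Cons x xs)
  have "teval \<nu> (x # xs) (\<lambda>ys. sw a (\<lambda>u v. D u v ys)) b
    = sw b (\<lambda>p q. sw a (\<lambda>u v. teval \<nu> xs (\<lambda>ys. D u v (\<nu> (p * x) # ys)) q))"
    by (simp add: Cons.IH)
  then show ?case by (simp add: sw_swap[of b])
qed

lemma lin_teval_param:
  assumes "\<And>ys. lin (\<lambda>h. F h ys)" shows "lin (\<lambda>h. teval \<nu> xs (F h) b)"
proof -
  have "F (x + y) = (\<lambda>ys. F x ys + F y ys)" "F (scale c x) = (\<lambda>ys. c * F x ys)" for x y c
    using assms by (auto simp: lmap_iff)
  then show ?thesis by (simp add: lmap_iff teval_add teval_cmult)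
qed

lemma lin_comp_mult: "endo \<nu> \<Longrightarrow> lin f \<Longrightarrow> lin (\<lambda>p. f (\<nu> (p * x)))"
  by (simp add: lin_simps)

lemma lin_teval:
  assumes "endo \<nu>" "mlin F" shows "lin (teval \<nu> xs F)"
  using assms(2)
proof (induction xs arbitrary: F)
  case Nil
  then show ?case by (simp add: lin_simps)
next
  case (Cons x xs)
  have "blin (\<lambda>p q. teval \<nu> xs (\<lambda>ys. F (\<nu> (p * x) # ys)) q)"
    unfolding bilin_def
    using Cons.IH[OF mlin_Cons[OF Cons.prems]] lin_teval_param lin_comp_mult[OF assms(1) mlin_head[OF Cons.prems]]
    by auto
  then show ?case by (simp add: lin_sw[unfolded lmap_iff] lmap_iff)
qed

lemma mlin_teval:
  assumes "mlin F" shows "mlin (\<lambda>xs. teval (\<lambda>x. x) xs F a)"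
  unfolding mlin_def
proof (intro allI)
  fix xs ys
  show "lin (\<lambda>x. teval (\<lambda>x. x) (xs @ x # ys) F a)"
    using assms
  proof (induction xs arbitrary: F a)
    case Nil
    show ?case
    proof (simp, intro lin_sw_param lin_teval_param)
      fix p zs
      show "lin (\<lambda>x. F (p * x # zs))" using mlin_head[OF Nil, of zs] by (simp add: lin_simps)
    qed
  next
    case (Cons z xs)
    then show ?case by (simp, intro lin_sw_param Cons.IH mlin_Cons)
  qed
qed

lemma endo_ident: "endo (\<lambda>x. x)"
  by (simp add: lmap_iff)

lemma teval_act_Nil [simp]: "teval_act \<nu> [] F b a = \<epsilon> b * (\<epsilon> a * F [])"
  by (simp add: teval_act_def)

lemma teval_act_Cons: "teval_act \<nu> (x # xs) F b a = sw b (\<lambda>p q. sw a (\<lambda>u v. teval_act \<nu> xs (\<lambda>ys. F (u * \<nu> (p * x) # ys)) q v))"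
  by (simp add: teval_act_def teval_sw)

lemma teval_act_lin:
  assumes "endo \<nu>" "mlin F"
  shows "lin (\<lambda>a. teval_act \<nu> xs F b a)" "lin (\<lambda>b. teval_act \<nu> xs F b a)"
  unfolding teval_act_def
  using lin_teval_param[of "\<lambda>a ys. teval (\<lambda>x. x) ys F a"] lin_teval[OF endo_ident assms(2)]
    lin_teval[OF assms(1) mlin_teval[OF assms(2)]] by auto

lemma lin_teval_act_param:
  assumes "\<And>ys. lin (\<lambda>h. F h ys)" shows "lin (\<lambda>h. teval_act \<nu> xs (F h) b a)"
  unfolding teval_act_def by (intro lin_teval_param assms)

lemma tlin_teval_act:
  assumes "endo \<nu>" "mlin F"
  shows "tlin (\<lambda>b a h. teval_act \<nu> xs (\<lambda>ys. F (h # ys)) b a)"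
  unfolding tlin_def using teval_act_lin[OF assms(1) mlin_Cons[OF assms(2)]] lin_teval_act_param[OF mlin_head[OF assms(2)]]
  by auto

text \<open>The tensor power of \<nu> is \<open>A\<close>-linear for the diagonal action, because
  \<nu> is \<open>A\<close>-linear on each factor and the legs of \<open>c\<close> stay in
  \<open>A\<close>. Hence \<open>c\<close> may act after it or before it.\<close>

lemma teval_act_balanced:
  assumes A: "hopf_subalgebra scale \<Delta> S A" and \<nu>: "endo \<nu>" "\<And>a h. a \<in> A \<Longrightarrow> \<nu> (a * h) = a * \<nu> h"
    and F: "mlin F" and c: "c \<in> A"
  shows "teval_act \<nu> xs F b (a * c) = teval_act \<nu> xs F (c * b) a"
  using F c
proof (induction xs arbitrary: F c b a)
  case Nil
  then show ?case by (simp add: counit_mult)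
next
  case (Cons x xs)
  define G where "G b a h = teval_act \<nu> xs (\<lambda>ys. F (h # ys)) b a" for b a h
  have "tlin G" unfolding G_def[abs_def] by (rule tlin_teval_act[OF \<nu>(1) Cons.prems(1)])
  note T = tlin_fun[OF this]
  have teval_act_Cons_G: "teval_act \<nu> (x # xs) F b a = sw b (\<lambda>p q. sw a (\<lambda>u v. G q v (u * \<nu> (p * x))))" for b a
    by (simp add: teval_act_Cons G_def)
  note \<nu>' = \<nu>(1)[unfolded lmap_iff]
  note Ain = hopf_subalgebraD[OF A]
  have "teval_act \<nu> (x # xs) F b (a * c) = sw b (\<lambda>p q. sw a (\<lambda>u v. sw c (\<lambda>c1 c2.
      G q (v * c2) ((u * c1) * \<nu> (p * x)))))"
    unfolding teval_act_Cons_G by (subst sw_mult) (simp_all add: lin_simps T)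
  also have "\<dots> = sw b (\<lambda>p q. sw a (\<lambda>u v. sw c (\<lambda>c1 c2.
      G (c2 * q) v (u * \<nu> ((c1 * p) * x)))))"
  proof (rule sw_cong, rule sw_cong, rule sw_cong_sub[OF Ain(2)[OF Cons.prems(2)]])
    fix p q u v c1 c2 assume c: "c1 \<in> A" "c2 \<in> A"
    have "(u * c1) * \<nu> (p * x) = u * \<nu> ((c1 * p) * x)"
      by (simp add: \<nu>(2)[OF c(1)] mult.assoc)
    then show "G q (v * c2) ((u * c1) * \<nu> (p * x))
        = G (c2 * q) v (u * \<nu> ((c1 * p) * x))"
      by (simp add: G_def Cons.IH[OF mlin_Cons[OF Cons.prems(1)] c(2)])
  qed (use \<nu>' in \<open>simp_all add: lin_simps T\<close>)
  also have "\<dots> = sw b (\<lambda>p q. sw c (\<lambda>c1 c2. sw a (\<lambda>u v.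
      G (c2 * q) v (u * \<nu> ((c1 * p) * x)))))"
    by (intro sw_cong sw_swap)
  also have "\<dots> = sw c (\<lambda>c1 c2. sw b (\<lambda>p q. sw a (\<lambda>u v.
      G (c2 * q) v (u * \<nu> ((c1 * p) * x)))))"
    by (rule sw_swap)
  also have "\<dots> = teval_act \<nu> (x # xs) F (c * b) a"
    unfolding teval_act_Cons_G by (rule sw_mult[symmetric]) (use \<nu>' in \<open>simp add: lin_simps T\<close>)
  finally show ?case .
qed

text \<open>\<open>H\<^sup>\<otimes>\<^sup>n\<close> is the direct sum of a free \<open>A\<close>-module and \<open>N\<^sup>\<otimes>\<^sup>n\<close>, where \<open>N\<close> is the range of \<open>\<nu>\<close>; this expresses
  the identity of \<open>H\<^sup>\<otimes>\<^sup>n\<close> by maps that factor through \<open>N\<^sup>\<otimes>\<^sup>n\<close>.\<close>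

lemma integral_power_identity:
  assumes A: "hopf_subalgebra scale \<Delta> S A" and t: "left_integral A t" "t \<noteq> 0"
    and s: "s \<in> A" "S s = t" and \<Lambda>: "left_integral UNIV \<Lambda>"
    and g: "lin g" "\<And>h. g (t * h) = 0" "g \<Lambda> = 1"
    and \<pi>: "endo \<pi>" "\<And>h. \<pi> h \<in> A" "\<And>a h. a \<in> A \<Longrightarrow> \<pi> (a * h) = a * \<pi> h"
    and F: "mlin F"
  shows "sw \<Lambda> (\<lambda>x y. g x * sw y (\<lambda>u v. teval_act (\<lambda>h. h - \<pi> h) xs F v (S u))) = F xs"
  using F
proof (induction xs arbitrary: F)
  case Nil
  have "sw y (\<lambda>u v. \<epsilon> v * (\<epsilon> (S u) * F [])) = F [] * \<epsilon> y" for y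
  proof -
    have "sw y (\<lambda>u v. \<epsilon> v * (\<epsilon> (S u) * F [])) = sw y (\<lambda>u v. F [] * (\<epsilon> u * \<epsilon> v))"
      by (simp add: counit_antipode mult_ac)
    then show ?thesis using sw_counit_right'[OF lin_counit, of y] by (simp add: sw_cmult)
  qed
  then show ?case using sw_counit_right'[OF g(1), of \<Lambda>] g(3)
    by (simp add: mult.left_commute[of "g _"] sw_cmult)
next
  case (Cons x xs)
  define \<nu> where "\<nu> h = h - \<pi> h" for h
  note \<pi>' = \<pi>(1)[unfolded lmap_iff]
  have \<nu>: "endo \<nu>" using \<pi>' by (simp add: lmap_iff \<nu>_def scale_right_diff_distrib)
  have \<nu>A: "\<nu> (a * h) = a * \<nu> h" if "a \<in> A" for a h
    using \<pi>(3)[OF that] by (simp add: \<nu>_def right_diff_distrib)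
  define G where "G b a h = teval_act \<nu> xs (\<lambda>ys. F (h # ys)) b a" for b a h
  have G: "tlin G" unfolding G_def[abs_def] by (rule tlin_teval_act[OF \<nu> Cons.prems])
  note G' = tlin_fun[OF G]
  have bal: "G b (a * c) h = G (c * b) a h" if "c \<in> A" for a b c h
    unfolding G_def by (rule teval_act_balanced[OF A \<nu> \<nu>A mlin_Cons[OF Cons.prems] that])
  have G_diff: "G b a (u * \<nu> z) = G b a (u * z) - G b a (u * \<pi> z)" for b a u z
    using lmap_diff[of scale "(*)" "G b a"] G by (simp add: tlin_def \<nu>_def right_diff_distrib)
  \<comment> \<open>In the first factor \<nu> is the identity minus \<pi>. The identity part
    collapses through S(u2) p and leaves \<open>x\<close>; the other part is the sum treated by
    \<open>integral_projection_vanishes\<close>.\<close>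
  have split: "sw y (\<lambda>u v. teval_act \<nu> (x # xs) F v (S u))
    = sw y (\<lambda>u v. G v (S u) x) - sw y (\<lambda>x2 r. sw r (\<lambda>x3 v. sw v (\<lambda>x4 x5. G x5 (S x2) (S x3 * \<pi> (x4 * x)))))" for y
  proof -
    have "sw y (\<lambda>u v. teval_act \<nu> (x # xs) F v (S u)) = sw y (\<lambda>u v. sw v (\<lambda>p q. sw (S u) (\<lambda>u1 u2. G q u2 (u1 * \<nu> (p * x)))))"
      by (simp add: teval_act_Cons G_def)
    also have "\<dots> = sw y (\<lambda>u v. sw v (\<lambda>p q. sw u (\<lambda>u1 u2. G q (S u1) (S u2 * \<nu> (p * x)))))"
      by (simp add: sw_antipode lin_simps G')
    also have "\<dots> = sw y (\<lambda>u v. sw u (\<lambda>u1 u2. sw v (\<lambda>p q. G q (S u1) (S u2 * \<nu> (p * x)))))"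
      by (intro sw_cong sw_swap)
    also have "\<dots> = sw y (\<lambda>u1 r. sw r (\<lambda>u2 v. sw v (\<lambda>p q. G q (S u1) (S u2 * \<nu> (p * x)))))"
      by (rule sw_coassoc) (use \<nu> in \<open>simp_all add: lin_simps G'\<close>)
    also have "\<dots> = sw y (\<lambda>u1 r. sw r (\<lambda>u2 v. sw v (\<lambda>p q. G q (S u1) ((S u2 * p) * x))))
      - sw y (\<lambda>u1 r. sw r (\<lambda>u2 v. sw v (\<lambda>p q. G q (S u1) (S u2 * \<pi> (p * x)))))"
    proof -
      have minus: "sw h (\<lambda>x y. K x y - L x y) = sw h K - sw h L" for h K L
        using sw_plus[of h K "\<lambda>x y. - 1 * L x y"] sw_cmult[of h "- 1" L] by simp
      show ?thesis by (simp add: G_diff minus mult.assoc)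
    qed
    also have "sw y (\<lambda>u1 r. sw r (\<lambda>u2 v. sw v (\<lambda>p q. G q (S u1) ((S u2 * p) * x))))
      = sw y (\<lambda>u1 r. sw r (\<lambda>w q. sw w (\<lambda>u2 p. G q (S u1) ((S u2 * p) * x))))"
      by (intro sw_cong sw_coassoc[symmetric]) (simp_all add: lin_simps G')
    also have "\<dots> = sw y (\<lambda>u1 r. sw r (\<lambda>w q. \<epsilon> w * G q (S u1) x))"
      using sw_antipode_left[of "\<lambda>z. G q (S u1) (z * x)" for q u1] by (simp add: lin_simps G')
    also have "\<dots> = sw y (\<lambda>u1 r. G r (S u1) x)"
      by (intro sw_cong sw_counit_left) (simp add: lin_simps G')
    finally show ?thesis .
  qed
  have minus: "sw h (\<lambda>x y. K x y - L x y) = sw h K - sw h L" for h K L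
    using sw_plus[of h K "\<lambda>x y. - 1 * L x y"] sw_cmult[of h "- 1" L] by simp
  have "sw \<Lambda> (\<lambda>x' y. g x' * sw y (\<lambda>u v. teval_act \<nu> (x # xs) F v (S u)))
    = sw \<Lambda> (\<lambda>x' y. g x' * sw y (\<lambda>u v. G v (S u) x))
      - sw \<Lambda> (\<lambda>x1 y. g x1 * sw y (\<lambda>x2 r. sw r (\<lambda>x3 v. sw v (\<lambda>x4 x5. G x5 (S x2) (S x3 * \<pi> (x4 * x))))))"
    by (simp only: split right_diff_distrib minus)
  also have "\<dots> = sw \<Lambda> (\<lambda>x' y. g x' * sw y (\<lambda>u v. G v (S u) x))"
    using integral_projection_vanishes[OF A t s \<Lambda> g(1,2) \<pi> G bal] by simp
  also have "\<dots> = F (x # xs)"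
    using Cons.IH[OF mlin_Cons[OF Cons.prems], of x] by (simp add: G_def \<nu>_def[abs_def])
  finally show ?case by (simp add: \<nu>_def[abs_def])
qed

text \<open>\<open>D\<close> is evaluated only at vectors of \<open>N\<close>, and multilinearity
  expands these in the basis \<open>B\<close>.\<close>

lemma teval_vanishes:
  assumes c: "coords scale N B \<beta>" and \<nu>: "\<And>h. \<nu> h \<in> N" and D: "mlin D"
    and 0: "\<And>q. set q \<subseteq> B \<Longrightarrow> length q = length xs \<Longrightarrow> D q = 0"
  shows "teval \<nu> xs D b = 0"
  using D 0
proof (induction xs arbitrary: D b)
  case Nil
  then show ?case by simp
next
  case (Cons x xs)
  have "teval \<nu> xs (\<lambda>ys. D (\<nu> h # ys)) q = 0" for h q
  proof (rule Cons.IH)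
    show "mlin (\<lambda>ys. D (\<nu> h # ys))" by (rule mlin_Cons[OF Cons.prems(1)])
    fix ys assume ys: "set ys \<subseteq> B" "length ys = length xs"
    have "\<nu> h = (\<Sum>b\<in>B. scale (\<beta> b (\<nu> h)) b)" using c \<nu> by (simp add: coords_def)
    then have "D (\<nu> h # ys) = D ((\<Sum>b\<in>B. scale (\<beta> b (\<nu> h)) b) # ys)" by simp
    also have "\<dots> = (\<Sum>b\<in>B. \<beta> b (\<nu> h) * D (b # ys))"
      using lmap_sum[OF mlin_head[OF Cons.prems(1)], of _ B ys] lmap_scale[OF mlin_head[OF Cons.prems(1)], of _ _ ys]
      by simp
    also have "\<dots> = 0" using Cons.prems(2)[of "b # ys" for b] ys by simp
    finally show "D (\<nu> h # ys) = 0" .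
  qed
  then show ?case by (simp add: sw_zero)
qed

primrec coord_monomial :: "('h \<Rightarrow> 'h \<Rightarrow> 'k) \<Rightarrow> 'h list \<Rightarrow> 'h list \<Rightarrow> 'k" where
  "coord_monomial \<beta> [] xs = (if xs = [] then 1 else 0)"
| "coord_monomial \<beta> (b # p) xs = (case xs of [] \<Rightarrow> 0 | x # ys \<Rightarrow> \<beta> b x * coord_monomial \<beta> p ys)"

lemma mlin_coord_monomial:
  assumes "\<And>b. b \<in> B \<Longrightarrow> lin (\<beta> b)" "set p \<subseteq> B"
  shows "mlin (coord_monomial \<beta> p)"
  unfolding mlin_def
proof (intro allI)
  fix xs ys
  show "lin (\<lambda>x. coord_monomial \<beta> p (xs @ x # ys))"
    using assms(2)
  proof (induction p arbitrary: xs)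
    case Nil
    then show ?case by (simp add: lmap_iff)
  next
    case (Cons b p)
    show ?case
    proof (cases xs)
      case Nil
      then show ?thesis using assms(1) Cons.prems by (auto simp: lmap_iff algebra_simps)
    next
      case (Cons z zs)
      then show ?thesis using Cons.IH[of zs] Cons.prems by (auto simp: lmap_iff algebra_simps)
    qed
  qed
qed

lemma coord_monomial_basis:
  assumes "\<And>b c. b \<in> B \<Longrightarrow> c \<in> B \<Longrightarrow> \<beta> b c = (if b = c then 1 else 0)" "set p \<subseteq> B" "set q \<subseteq> B"
  shows "coord_monomial \<beta> p q = (if p = q then 1 else 0)"
  using assms(2,3)
proof (induction p arbitrary: q)
  case Nil
  then show ?case by auto
next
  case (Cons b p)
  then show ?case using assms(1) by (cases q) auto
qed

lemma mlin_sum: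
  assumes "\<And>i. i \<in> I \<Longrightarrow> mlin (F i)" shows "mlin (\<lambda>xs. \<Sum>i\<in>I. c i * F i xs)"
  using assms by (auto simp: mlin_def lmap_iff sum.distrib sum_distrib_left distrib_left mult.left_commute)

end

section \<open>Growth and comparison of dimensions\<close>

lemma exponential_gap:
  fixes w m d :: nat
  assumes "m < d" shows "\<exists>j. w * m ^ j < d ^ j"
proof (cases "m = 0")
  case True
  then show ?thesis using assms by (intro exI[of _ 1]) simp
next
  case False
  then have "1 < real d / real m" using assms by simp
  then obtain j where "real w < (real d / real m) ^ j"
    using real_arch_pow by blast
  then have "real w * real m ^ j < real d ^ j"
    using False by (simp add: power_divide pos_less_divide_eq)
  then have "real (w * m ^ j) < real (d ^ j)" by simp
  then show ?thesis unfolding of_nat_less_iff by blast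
qed

context vector_space
begin

text \<open>A dependence between \<open>y\<close> and the images of the basis either puts
  \<open>y\<close> in the image or contradicts injectivity. So \<open>Z\<close> contains
  \<open>card B + 1\<close> independent vectors.\<close>

lemma coords_card_less:
  assumes X: "coords scale X B \<beta>" "subspace X" and Z: "coords scale Z C \<gamma>"
    and f: "lmap scale scale f" "\<And>x. x \<in> X \<Longrightarrow> f x \<in> Z" "\<And>x. x \<in> X \<Longrightarrow> f x = 0 \<Longrightarrow> x = 0"
    and y: "y \<in> Z" "y \<notin> f ` X"
  shows "card B < card C"
proof (rule ccontr)
  assume "\<not> card B < card C"
  have fin: "finite B" "finite C" using X Z by (auto simp: coords_def)
  \<comment> \<open>\<open>None\<close> indexes \<open>y\<close>, and \<open>Some b\<close> the
    image of \<open>b\<close>.\<close>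
  define v where "v p = (case p of None \<Rightarrow> y | Some b \<Rightarrow> f b)" for p
  let ?P = "insert None (Some ` B)"
  have vZ: "v p \<in> Z" if "p \<in> ?P" for p
    using that y(1) f(2) X(1) by (auto simp: v_def coords_def)
  have "card C < card ?P"
    using \<open>\<not> card B < card C\<close> fin by (subst card_insert_disjoint) (auto simp: card_image)
  with homogeneous_system_solution[OF fin(2) _ this, of "\<lambda>c p. \<gamma> c (v p)"] fin
  obtain a where a: "\<exists>p\<in>?P. a p \<noteq> 0" "\<And>c. c \<in> C \<Longrightarrow> (\<Sum>p\<in>?P. \<gamma> c (v p) * a p) = 0"
    by auto
  have \<gamma>: "lmap scale (*) (\<gamma> c)" if "c \<in> C" for c using that Z by (simp add: coords_def)
  have "(\<Sum>p\<in>?P. scale (a p) (v p)) = (\<Sum>p\<in>?P. scale (a p) (\<Sum>c\<in>C. scale (\<gamma> c (v p)) c))"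
    using vZ Z by (intro sum.cong refl arg_cong[where f = "scale _"]) (auto simp: coords_def)
  also have "\<dots> = (\<Sum>c\<in>C. scale (\<Sum>p\<in>?P. \<gamma> c (v p) * a p) c)"
    by (simp add: scale_sum_right scale_sum_left mult.commute del: sum.insert) (rule sum.swap)
  also have "\<dots> = 0" using a(2) by simp
  finally have "scale (a None) y + (\<Sum>b\<in>B. scale (a (Some b)) (f b)) = 0"
    using fin(1) by (subst (asm) sum.insert) (auto simp: v_def sum.reindex)
  then have eq: "scale (a None) y + f (\<Sum>b\<in>B. scale (a (Some b)) b) = 0"
    by (simp add: lmap_sum[OF f(1)] lmap_scale[OF f(1)])
  have X': "(\<Sum>b\<in>B. scale (a (Some b)) b) \<in> X"
    using X by (intro subspace_sum subspace_scale) (auto simp: coords_def)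
  show False
  proof (cases "a None = 0")
    case True
    then have 0: "(\<Sum>b\<in>B. scale (a (Some b)) b) = 0" using eq f(3)[OF X'] by simp
    have "a (Some b) = 0" if b: "b \<in> B" for b
    proof -
      have l: "lmap scale (*) (\<beta> b)" using X(1) b by (simp add: coords_def)
      have "0 = \<beta> b (\<Sum>b\<in>B. scale (a (Some b)) b)" using 0 lmap_zero[OF l] by simp
      also have "\<dots> = (\<Sum>c\<in>B. a (Some c) * \<beta> b c)" by (simp add: lmap_sum[OF l] lmap_scale[OF l])
      also have "\<dots> = (\<Sum>c\<in>B. if c = b then a (Some c) else 0)"
        using X(1) b by (intro sum.cong) (auto simp: coords_def)
      also have "\<dots> = a (Some b)" using b fin by simp
      finally show ?thesis by simp
    qed
    with a(1) True show False by auto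
  next
    case False
    have "scale (a None) y = f (- (\<Sum>b\<in>B. scale (a (Some b)) b))"
      using eq by (simp add: lmap_uminus[OF f(1)] eq_neg_iff_add_eq_0)
    then have "scale (1 / a None) (scale (a None) y) = f (scale (1 / a None) (- (\<Sum>b\<in>B. scale (a (Some b)) b)))"
      by (simp only: lmap_scale[OF f(1)])
    then have "y = f (scale (1 / a None) (- (\<Sum>b\<in>B. scale (a (Some b)) b)))"
      using False by simp
    moreover have "scale (1 / a None) (- (\<Sum>b\<in>B. scale (a (Some b)) b)) \<in> X"
      by (intro subspace_scale subspace_neg X X')
    ultimately show False using y(2) by blast
  qed
qed

lemma inj_endo_surj:
  assumes X: "subspace X" "finite B0" "X \<subseteq> span B0"
    and f: "lmap scale scale f" "\<And>x. x \<in> X \<Longrightarrow> f x \<in> X" "\<And>x. x \<in> X \<Longrightarrow> f x = 0 \<Longrightarrow> x = 0"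
    and y: "y \<in> X"
  obtains x where "x \<in> X" "f x = y"
proof -
  obtain B \<beta> where c: "coords scale X B \<beta>" using coords_exist[OF X] by blast
  have "y \<in> f ` X" using coords_card_less[OF c X(1) c f y] by blast
  then show ?thesis using that by auto
qed

end

section \<open>An \<open>A\<close>-linear projection onto \<open>A\<close> and the normalised
  integral\<close>

context hopf_algebra
begin

text \<open>Mirror image of \<open>integral_shift\<close>: replacing \<epsilon>(a1) t by a1 t gives
  the legs a1 t1 and S(t2) S(a2) a3, and the antipode axiom removes the last two factors.\<close>

lemma integral_shift_right:
  assumes A: "hopf_subalgebra scale \<Delta> S A" and t: "left_integral A t" and a: "a \<in> A" and F: "blin F"
  shows "sw t (\<lambda>x y. F (a * x) (S y)) = sw t (\<lambda>x y. F x (S y * a))"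
proof -
  note F' = F[unfolded bilin_def lmap_iff] bilin_fun[OF F]
  note Ain = hopf_subalgebraD[OF A]
  have anti: "sw q (\<lambda>p2 r. F x (S y * (S p2 * r))) = \<epsilon> q * F x (S y)" for q x y
    using sw_antipode_left[of "\<lambda>z. F x (S y * z)" q] F' by (simp add: lin_simps)
  have "sw t (\<lambda>x y. F x (S y * a)) = sw a (\<lambda>p q. \<epsilon> p * sw t (\<lambda>x y. F x (S y * q)))"
    by (rule sw_counit_left[symmetric]) (use F' in \<open>simp add: lin_simps\<close>)
  also have "\<dots> = sw a (\<lambda>p q. sw (p * t) (\<lambda>x y. F x (S y * q)))"
  proof (rule sw_cong_sub[OF Ain(2)[OF a]])
    fix x y assume "x \<in> A" "y \<in> A"
    then have "x * t = scale (\<epsilon> x) t" using t by (auto simp: left_integral_def)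
    then show "\<epsilon> x * sw t (\<lambda>u v. F u (S v * y)) = sw (x * t) (\<lambda>u v. F u (S v * y))"
      using F' by (simp add: lin_simps)
  qed (use F' in \<open>simp_all add: lin_simps\<close>)
  also have "\<dots> = sw a (\<lambda>p q. sw p (\<lambda>p1 p2. sw t (\<lambda>x y. F (p1 * x) (S y * (S p2 * q)))))"
    by (subst sw_mult) (use F' in \<open>simp_all add: lin_simps antipode_mult\<close>)
  also have "\<dots> = sw a (\<lambda>p1 q. sw q (\<lambda>p2 r. sw t (\<lambda>x y. F (p1 * x) (S y * (S p2 * r)))))"
    by (rule sw_coassoc) (use F' in \<open>simp_all add: lin_simps\<close>)
  also have "\<dots> = sw a (\<lambda>p1 q. sw t (\<lambda>x y. sw q (\<lambda>p2 r. F (p1 * x) (S y * (S p2 * r)))))"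
    by (intro sw_cong sw_swap)
  also have "\<dots> = sw a (\<lambda>p1 q. \<epsilon> q * sw t (\<lambda>x y. F (p1 * x) (S y)))"
    by (simp only: anti sw_cmult)
  also have "\<dots> = sw t (\<lambda>x y. F (a * x) (S y))"
    by (rule sw_counit_right) (use F' in \<open>simp add: lin_simps\<close>)
  finally show ?thesis by simp
qed

lemma antipode_surj:
  assumes A: "hopf_subalgebra scale \<Delta> S A" and t: "left_integral A t" "t \<noteq> 0" and a: "a \<in> A"
  obtains s where "s \<in> A" "S s = a"
proof -
  obtain B0 where "finite B0" "A \<subseteq> span B0" using integral_finite_dim[OF A t] by blast
  then show ?thesis
    using inj_endo_surj[OF hopf_subalgebraD(1)[OF A] _ _ antipode_linear hopf_subalgebraD(5)[OF A]
        integral_antipode_inj[OF A t] a] that by blast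
qed

text \<open>If functionals \<open>f x\<close> are indexed by elements of \<open>A\<close>, then x
  \<mapsto> t1 f(x, S(t2)) is an endomorphism of \<open>A\<close>. It is injective, because the
  right legs of \<open>t\<close> exhaust \<open>A\<close> and the antipode maps \<open>A\<close>
  onto \<open>A\<close>; by finite dimension it reaches 1.\<close>

lemma integral_left_leg_one:
  assumes A: "hopf_subalgebra scale \<Delta> S A" and t: "left_integral A t" "t \<noteq> 0"
  obtains k where "lin k" "hitl (\<lambda>y. k (S y)) t = 1"
proof -
  note Ain = hopf_subalgebraD[OF A]
  have tA: "t \<in> A" using t by (simp add: left_integral_def)
  obtain B0 where B0: "finite B0" "A \<subseteq> span B0" using integral_finite_dim[OF A t] by blast
  obtain B \<beta> where c: "coords scale A B \<beta>" using coords_exist[OF Ain(1) B0] by blast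
  have \<beta>: "lin (\<beta> b)" and BA: "b \<in> A" if "b \<in> B" for b using c that by (auto simp: coords_def)
  have finB: "finite B" using c by (simp add: coords_def)
  \<comment> \<open>The symmetric form for which \<open>B\<close> is orthonormal; what matters is
    that it is nondegenerate on \<open>A\<close>.\<close>
  define f where "f x y = (\<Sum>b\<in>B. \<beta> b x * \<beta> b y)" for x y
  have f: "blin f" using \<beta> by (auto simp: f_def bilin_def lmap_iff sum.distrib sum_distrib_left algebra_simps)
  note f' = f[unfolded bilin_def lmap_iff] bilin_fun[OF f]
  have fx: "lin (\<lambda>y. f x (S y))" for x using f' by (simp add: lin_simps)
  define \<Psi> where "\<Psi> x = hitl (\<lambda>y. f x (S y)) t" for x
  have \<Psi>: "endo \<Psi>"
  proof -
    have "\<Psi> (x + y) = \<Psi> x + \<Psi> y" for x y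
      by (rule eq_if_functionals) (use f' in \<open>simp add: \<Psi>_def lmap_add[of scale "(*)"] lin_hitl lin_simps\<close>)
    moreover have "\<Psi> (scale c x) = scale c (\<Psi> x)" for c x
      by (rule eq_if_functionals) (use f' in \<open>simp add: \<Psi>_def lmap_scale[of scale "(*)"] lin_hitl lin_simps\<close>)
    ultimately show ?thesis by (simp add: lmap_iff)
  qed
  have "\<exists>x\<in>A. \<Psi> x = 1"
  proof -
    have "\<Psi> x \<in> A" for x unfolding \<Psi>_def by (rule hitl_mem[OF Ain(2)[OF tA] Ain(1) fx])
    moreover have "x = 0" if x: "x \<in> A" "\<Psi> x = 0" for x
    proof -
      have "f x a = 0" if a: "a \<in> A" for a
      proof -
        obtain a' where a': "a' \<in> A" "S a' = a" using antipode_surj[OF A t a] by blast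
        obtain g where g: "lin g" "hit g t = a'" using integral_right_legs[OF A t a'(1)] by blast
        have "f x a = f x (S (hit g t))" using a' g by simp
        also have "\<dots> = sw t (\<lambda>u v. g u * f x (S v))" by (rule lin_hit[OF fx])
        also have "\<dots> = g (\<Psi> x)" unfolding \<Psi>_def by (rule lin_hitl[OF g(1), symmetric])
        finally show ?thesis using x(2) lmap_zero[OF g(1)] by simp
      qed
      then have f0: "f x b = 0" if "b \<in> B" for b using BA[OF that] by simp
      have "\<beta> b x = 0" if b: "b \<in> B" for b
      proof -
        have "f x b = (\<Sum>d\<in>B. if d = b then \<beta> d x else 0)"
          unfolding f_def using c b by (intro sum.cong) (auto simp: coords_def)
        then show ?thesis using f0[OF b] b finB by simp
      qed
      moreover have "x = (\<Sum>b\<in>B. scale (\<beta> b x) b)" using c x(1) by (simp add: coords_def)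
      ultimately show "x = 0" by simp
    qed
    ultimately show ?thesis
      using inj_endo_surj[OF Ain(1) B0 \<Psi> _ _ Ain(3)] by blast
  qed
  then obtain x where "\<Psi> x = 1" by blast
  moreover have "lin (f x)" using f by (simp add: bilin_def)
  ultimately show ?thesis using that[of "f x"] by (simp add: \<Psi>_def)
qed

text \<open>The map h \<mapsto> t1 k(S(t2) h) is \<open>A\<close>-linear for every functional
  \<open>k\<close>, by \<open>integral_shift_right\<close>. The functional is chosen such that 1 is
  fixed, and then all of \<open>A\<close> is.\<close>

lemma linear_projection_exists:
  assumes A: "hopf_subalgebra scale \<Delta> S A" and t: "left_integral A t" "t \<noteq> 0"
  obtains \<pi> where "endo \<pi>" "\<And>h. \<pi> h \<in> A" "\<And>a h. a \<in> A \<Longrightarrow> \<pi> (a * h) = a * \<pi> h" "\<pi> 1 = 1"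
proof -
  note Ain = hopf_subalgebraD[OF A]
  have tA: "t \<in> A" using t by (simp add: left_integral_def)
  obtain k where k: "lin k" "hitl (\<lambda>y. k (S y)) t = 1" using integral_left_leg_one[OF A t] by blast
  note k' = k(1)[unfolded lmap_iff]
  define \<pi> where "\<pi> h = hitl (\<lambda>y. k (S y * h)) t" for h
  have l: "lin (\<lambda>y. k (S y * h))" for h using k' by (simp add: lin_simps)
  have "endo \<pi>"
  proof -
    have "\<pi> (x + y) = \<pi> x + \<pi> y" for x y
      by (rule eq_if_functionals) (use k' in \<open>simp add: \<pi>_def lmap_add[of scale "(*)"] lin_hitl lin_simps\<close>)
    moreover have "\<pi> (scale c x) = scale c (\<pi> x)" for c x
      by (rule eq_if_functionals) (use k' in \<open>simp add: \<pi>_def lmap_scale[of scale "(*)"] lin_hitl lin_simps\<close>)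
    ultimately show ?thesis by (simp add: lmap_iff)
  qed
  moreover have "\<pi> h \<in> A" for h unfolding \<pi>_def by (rule hitl_mem[OF Ain(2)[OF tA] Ain(1) l])
  moreover have "\<pi> (a * h) = a * \<pi> h" if a: "a \<in> A" for a h
  proof (rule eq_if_functionals)
    fix g assume g: "lin g"
    note g' = g[unfolded lmap_iff]
    have ga: "lin (\<lambda>z. g (a * z))" using g' by (simp add: lin_simps)
    have "g (a * \<pi> h) = sw t (\<lambda>u v. g (a * u) * k (S v * h))"
      unfolding \<pi>_def using lin_hitl[OF ga] by simp
    also have "\<dots> = sw t (\<lambda>u v. g u * k ((S v * a) * h))"
      by (rule integral_shift_right[OF A t(1) a]) (use k' g' in \<open>simp add: lin_simps\<close>)
    also have "\<dots> = g (\<pi> (a * h))" unfolding \<pi>_def by (simp add: lin_hitl[OF g] mult.assoc)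
    finally show "g (\<pi> (a * h)) = g (a * \<pi> h)" by simp
  qed
  moreover have "\<pi> 1 = 1" using k by (simp add: \<pi>_def)
  ultimately show ?thesis using that by blast
qed

lemma teval_sum: "teval \<nu> xs (\<lambda>ys. \<Sum>i\<in>I. c i * F i ys) b = (\<Sum>i\<in>I. c i * teval \<nu> xs (F i) b)"
proof (induction I rule: infinite_finite_induct)
  case (insert i I)
  then show ?case by (simp add: teval_add teval_cmult)
qed (use teval_cmult[of \<nu> xs 0 "\<lambda>ys. 0" b] in auto)

text \<open>By Nichols and Zoeller, \<open>H\<close> is free over \<open>A\<close>, whence \<open>A\<close> is semisimple.  Freeness is avoided here: the
  non-free part \<open>N\<^sup>\<otimes>\<^sup>n\<close> of \<open>H\<^sup>\<otimes>\<^sup>n\<close> is too small for large \<open>n\<close> if \<open>\<epsilon>(t) = 0\<close>.\<close>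

theorem normalised_integral_exists:
  assumes ss: "semisimple_ring TYPE('h)" and A: "hopf_subalgebra scale \<Delta> S A"
  obtains e where "left_integral A e" "\<epsilon> e = 1"
proof -
  note Ain = hopf_subalgebraD[OF A]
  obtain \<Lambda> where \<Lambda>: "left_integral UNIV \<Lambda>" "\<epsilon> \<Lambda> = 1" using semisimple_integral[OF ss] by blast
  have "\<Lambda> \<noteq> 0" using \<Lambda>(2) lmap_zero[OF lin_counit] by auto
  then obtain B0 where B0: "finite B0" "UNIV \<subseteq> span B0"
    using integral_finite_dim[OF hopf_subalgebra_UNIV \<Lambda>(1)] by blast
  have "A \<subseteq> span B0" using B0(2) by auto
  then obtain t where t: "left_integral A t" "t \<noteq> 0"
    using left_integral_exists[OF A B0(1)] by blast
  have "\<epsilon> t \<noteq> 0"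
  proof
    assume \<epsilon>t: "\<epsilon> t = 0"
    have tA: "t \<in> A" using t by (simp add: left_integral_def)
    obtain s where s: "s \<in> A" "S s = t" using antipode_surj[OF A t tA] by blast
    have "endo (\<lambda>h. t * h)" by (simp add: lin_simps)
    then have subH: "subspace (range (\<lambda>h. t * h))"
      by (rule subspace_image[OF vector_space_axioms vector_space_axioms _ subspace_UNIV])
    have "\<Lambda> \<notin> range (\<lambda>h. t * h)"
    proof
      assume "\<Lambda> \<in> range (\<lambda>h. t * h)"
      then obtain h where "\<Lambda> = t * h" by blast
      then have "\<epsilon> \<Lambda> = 0" by (simp add: counit_mult \<epsilon>t)
      then show False using \<Lambda>(2) by simp
    qed
    then obtain g where g: "lin g" "\<And>x. x \<in> range (\<lambda>h. t * h) \<Longrightarrow> g x = 0" "g \<Lambda> = 1"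
      using subspace_functional[OF subH] by blast
    have gt: "g (t * h) = 0" for h using g(2) by blast
    obtain \<pi> where \<pi>: "endo \<pi>" "\<And>h. \<pi> h \<in> A" "\<And>a h. a \<in> A \<Longrightarrow> \<pi> (a * h) = a * \<pi> h" "\<pi> 1 = 1"
      using linear_projection_exists[OF A t] by blast
    define \<nu> where "\<nu> h = h - \<pi> h" for h
    note \<pi>' = \<pi>(1)[unfolded lmap_iff]
    have \<nu>: "endo \<nu>" using \<pi>' by (simp add: lmap_iff \<nu>_def scale_right_diff_distrib)
    define N where "N = range \<nu>"
    have N: "subspace N"
      unfolding N_def by (rule subspace_image[OF vector_space_axioms vector_space_axioms \<nu> subspace_UNIV])
    have "1 \<notin> N"
    proof
      assume "1 \<in> N"
      then obtain h where h: "1 = h - \<pi> h" by (auto simp: N_def \<nu>_def)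
      have "\<pi> (\<pi> h) = \<pi> h" using \<pi>(3)[OF \<pi>(2), of h 1] \<pi>(4) by simp
      then have "\<pi> (h - \<pi> h) = 0" using lmap_diff[OF \<pi>(1)] by simp
      then show False using \<pi>(4) h by simp
    qed
    obtain BH \<gamma> where H: "coords scale UNIV BH \<gamma>" using coords_exist[OF subspace_UNIV B0] by blast
    have "N \<subseteq> span B0" using B0(2) by auto
    then obtain BN \<beta> where cN: "coords scale N BN \<beta>" using coords_exist[OF N B0(1)] by blast
    have "card BN < card BH"
      by (rule coords_card_less[OF cN N H endo_ident, where y = 1]) (use \<open>1 \<notin> N\<close> in auto)
    \<comment> \<open>\<open>W\<close> bounds the number of terms in which the identity of a tensor
      power is written; it does not depend on the exponent.\<close>
    define W where "W = (\<Union>z\<in>Poly_Mapping.keys (\<Delta> \<Lambda>). Poly_Mapping.keys (\<Delta> (snd z)))"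
    have W0: "sw \<Lambda> (\<lambda>x y. g x * sw y K) = 0" if "\<And>u v. (u, v) \<in> W \<Longrightarrow> K u v = 0" for K
      using that by (force simp: sw_def lin_ext_def W_def intro!: sum.neutral)
    obtain j where j: "card W * card BN ^ j < card BH ^ j"
      using exponential_gap[OF \<open>card BN < card BH\<close>] by blast
    define P where "P = {p. set p \<subseteq> BH \<and> length p = j}"
    define Q where "Q = W \<times> {q. set q \<subseteq> BN \<and> length q = j}"
    have fin: "finite BH" "finite BN" "finite W" using H cN by (auto simp: coords_def W_def)
    have finPQ: "finite P" "finite Q"
      unfolding P_def Q_def using fin by (auto intro: finite_lists_length_eq)
    have "card Q < card P"
      unfolding P_def Q_def using j fin by (simp add: card_cartesian_product card_lists_length_eq)
    \<comment> \<open>The unknowns are the coefficients of a multilinear form of degree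
      \<open>j\<close>; the equations say that it vanishes on \<open>S u\<close> applied to lists
      over the basis of \<open>N\<close>. The resulting \<open>F\<close> is nonzero, yet
      \<open>integral_power_identity\<close> makes it vanish.\<close>
    from homogeneous_system_solution[OF finPQ(2,1) this,
        of "\<lambda>(w, q) p. teval (\<lambda>x. x) q (coord_monomial \<gamma> p) (S (fst w))"]
    obtain c where c: "\<exists>p\<in>P. c p \<noteq> 0"
      "\<And>w q. (w, q) \<in> Q \<Longrightarrow> (\<Sum>p\<in>P. teval (\<lambda>x. x) q (coord_monomial \<gamma> p) (S (fst w)) * c p) = 0"
      by fastforce
    define F where "F xs = (\<Sum>p\<in>P. c p * coord_monomial \<gamma> p xs)" for xs
    have \<gamma>: "\<And>b. b \<in> BH \<Longrightarrow> lin (\<gamma> b)" "\<And>b c. b \<in> BH \<Longrightarrow> c \<in> BH \<Longrightarrow> \<gamma> b c = (if b = c then 1 else 0)"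
      using H by (auto simp: coords_def)
    have F: "mlin F"
      unfolding F_def[abs_def] by (rule mlin_sum) (use mlin_coord_monomial[OF \<gamma>(1)] in \<open>auto simp: P_def\<close>)
    obtain p0 where p0: "p0 \<in> P" "c p0 \<noteq> 0" using c(1) by blast
    have "F p0 = (\<Sum>p\<in>P. if p = p0 then c p else 0)"
      unfolding F_def by (rule sum.cong) (use p0 in \<open>auto simp: P_def coord_monomial_basis[OF \<gamma>(2)]\<close>)
    then have "F p0 \<noteq> 0" using p0 finPQ by simp
    moreover have "F p0 = 0"
    proof -
      have "F p0 = sw \<Lambda> (\<lambda>x y. g x * sw y (\<lambda>u v. teval_act (\<lambda>h. h - \<pi> h) p0 F v (S u)))"
        by (rule integral_power_identity[OF A t s \<Lambda>(1) g(1) gt g(3) \<pi>(1-3) F, symmetric])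
      also have "\<dots> = 0"
      proof (rule W0)
        fix u v assume uv: "(u, v) \<in> W"
        have "teval \<nu> p0 (\<lambda>ys. teval (\<lambda>x. x) ys F (S u)) v = 0"
        proof (rule teval_vanishes[OF cN _ mlin_teval[OF F]])
          show "\<nu> h \<in> N" for h by (simp add: N_def)
          fix q assume "set q \<subseteq> BN" "length q = length p0"
          then have "((u, v), q) \<in> Q" using uv p0 by (auto simp: Q_def P_def)
          from c(2)[OF this] show "teval (\<lambda>x. x) q F (S u) = 0"
            unfolding F_def[abs_def] teval_sum by (simp add: mult.commute)
        qed
        then show "teval_act (\<lambda>h. h - \<pi> h) p0 F v (S u) = 0"
          by (simp add: teval_act_def \<nu>_def[abs_def])
      qed
      finally show ?thesis .
    qed
    ultimately show False by simp
  qed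
  define e where "e = scale (1 / \<epsilon> t) t"
  have "left_integral A e"
    using t subspace_scale[OF Ain(1)] by (simp add: left_integral_def e_def scale_mult_right mult.commute)
  moreover have "\<epsilon> e = 1" using \<open>\<epsilon> t \<noteq> 0\<close> by (simp add: e_def counit_scale)
  ultimately show ?thesis using that by blast
qed

end

section \<open>Irreducible algebras of operators\<close>

context
  fixes s :: "'k::alg_closed_field \<Rightarrow> 'a::ab_group_add \<Rightarrow> 'a"
  assumes s: "vector_space s"
begin

interpretation vector_space s by (rule s)

text \<open>A shortest linear relation among the iterates of \<open>w0\<close> is a polynomial in
  \<open>X\<close> that kills \<open>w0\<close>. Divide it by x - l for a root \<open>l\<close>:
  minimality makes the value of the quotient at \<open>w0\<close> nonzero, and this value is an
  eigenvector.\<close>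

lemma eigenvector_exists:
  assumes W: "subspace W" "finite B0" "W \<subseteq> span B0" and X: "lmap s s X" "\<And>w. w \<in> W \<Longrightarrow> X w \<in> W"
    and w0: "w0 \<in> W" "w0 \<noteq> 0"
  obtains l u where "u \<in> W" "u \<noteq> 0" "X u = s l u"
proof -
  obtain B \<beta> where c: "coords s W B \<beta>" using coords_exist[OF W] by blast
  define z where "z i = (X ^^ i) w0" for i
  have z: "z i \<in> W" for i by (induction i) (auto simp: z_def w0 X(2))
  define P where "P n a \<longleftrightarrow> a n \<noteq> 0 \<and> (\<Sum>i\<le>n. s (a i) (z i)) = 0" for n :: nat and a
  have "\<exists>n a. P n a"
  proof -
    have "card B < card {..card B}" "finite B" using c by (auto simp: coords_def)
    from homogeneous_system_solution[OF this(2) finite_atMost this(1), of "\<lambda>b i. \<beta> b (z i)"]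
    obtain a where a: "\<exists>i\<le>card B. a i \<noteq> 0" "\<And>b. b \<in> B \<Longrightarrow> (\<Sum>i\<le>card B. \<beta> b (z i) * a i) = 0"
      by auto
    have "(\<Sum>i\<le>card B. s (a i) (z i)) = (\<Sum>i\<le>card B. s (a i) (\<Sum>b\<in>B. s (\<beta> b (z i)) b))"
      using z c by (intro sum.cong refl arg_cong[where f = "s _"]) (auto simp: coords_def)
    also have "\<dots> = (\<Sum>b\<in>B. s (\<Sum>i\<le>card B. \<beta> b (z i) * a i) b)"
      by (simp add: scale_sum_right scale_sum_left mult.commute) (rule sum.swap)
    also have "\<dots> = 0" using a(2) by simp
    finally have 0: "(\<Sum>i\<le>card B. s (a i) (z i)) = 0" .
    define n where "n = Max {i. i \<le> card B \<and> a i \<noteq> 0}"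
    have "n \<in> {i. i \<le> card B \<and> a i \<noteq> 0}" unfolding n_def by (rule Max_in) (use a(1) in auto)
    moreover have "a i = 0" if "i \<le> card B" "n < i" for i
    proof (rule ccontr)
      assume "a i \<noteq> 0"
      then have "i \<le> n" unfolding n_def using that(1) by (intro Max_ge) auto
      then show False using that(2) by simp
    qed
    ultimately have "P n a"
      using 0 unfolding P_def by (subst sum.mono_neutral_left[of "{..card B}"]) auto
    then show ?thesis by blast
  qed
  define n where "n = (LEAST n. \<exists>a. P n a)"
  obtain a where a: "P n a" using LeastI_ex[OF \<open>\<exists>n a. P n a\<close>] by (auto simp: n_def)
  have least: "\<not> P m b" if "m < n" for m b using not_less_Least[of m "\<lambda>n. \<exists>a. P n a"] that by (auto simp: n_def)
  have "n \<noteq> 0"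
  proof
    assume "n = 0"
    then show False using a w0 by (simp add: P_def z_def)
  qed
  then obtain m where m: "n = Suc m" by (cases n) auto
  obtain l where l: "(\<Sum>i\<le>n. a i * l ^ i) = 0"
    using alg_closed[of n a] a m by (auto simp: P_def)
  \<comment> \<open>The coefficients of the quotient by x - l, from synthetic division; fact
    \<open>d0\<close> says that the remainder is 0.\<close>
  define d where "d j = (\<Sum>i=Suc j..n. a i * l ^ (i - Suc j))" for j
  have dm: "d m = a n" by (simp add: d_def m)
  have d_rec: "d j = a (Suc j) + l * d (Suc j)" if "j < n" for j
  proof -
    have "d j = a (Suc j) + (\<Sum>i=Suc (Suc j)..n. a i * l ^ (i - Suc j))"
      unfolding d_def using that by (subst sum.atLeast_Suc_atMost) auto
    also have "(\<Sum>i=Suc (Suc j)..n. a i * l ^ (i - Suc j)) = (\<Sum>i=Suc (Suc j)..n. l * (a i * l ^ (i - Suc (Suc j))))"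
      by (intro sum.cong refl) (auto simp: Suc_diff_Suc[symmetric] Suc_diff_le)
    finally show ?thesis by (simp add: d_def sum_distrib_left)
  qed
  have dn: "d n = 0" by (simp add: d_def)
  have d0: "a 0 + l * d 0 = 0"
  proof -
    have "(\<Sum>i\<le>n. a i * l ^ i) = a 0 + (\<Sum>i=Suc 0..n. a i * l ^ i)"
      by (simp add: atMost_atLeast0 sum.atLeast_Suc_atMost)
    also have "(\<Sum>i=Suc 0..n. a i * l ^ i) = (\<Sum>i=Suc 0..n. l * (a i * l ^ (i - Suc 0)))"
    proof (intro sum.cong refl)
      fix i assume "i \<in> {Suc 0..n}"
      then obtain k where "i = Suc k" by (cases i) auto
      then show "a i * l ^ i = l * (a i * l ^ (i - Suc 0))" by simp
    qed
    finally show ?thesis using l by (simp add: d_def sum_distrib_left)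
  qed
  define u where "u = (\<Sum>i\<le>m. s (d i) (z i))"
  have "u \<noteq> 0" using least[of m d] a dm m by (auto simp: P_def u_def)
  moreover have "u \<in> W" unfolding u_def by (intro subspace_sum subspace_scale W(1) z)
  moreover have "X u = s l u"
  proof -
    have Xz: "X (z i) = z (Suc i)" for i by (simp add: z_def)
    have "X u = (\<Sum>i\<le>m. s (d i) (z (Suc i)))"
      by (simp add: u_def lmap_sum[OF X(1)] lmap_scale[OF X(1)] Xz)
    also have "\<dots> = (\<Sum>i\<le>m. s (a (Suc i)) (z (Suc i))) + (\<Sum>i\<le>m. s (l * d (Suc i)) (z (Suc i)))"
      by (simp add: d_rec m scale_left_distrib sum.distrib)
    also have "(\<Sum>i\<le>m. s (a (Suc i)) (z (Suc i))) = - s (a 0) (z 0)"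
    proof -
      have "(\<Sum>i\<le>n. s (a i) (z i)) = s (a 0) (z 0) + (\<Sum>i\<le>m. s (a (Suc i)) (z (Suc i)))"
        unfolding m by (rule sum.atMost_Suc_shift)
      then show ?thesis using a by (simp add: P_def eq_neg_iff_add_eq_0 add.commute)
    qed
    also have "(\<Sum>i\<le>m. s (l * d (Suc i)) (z (Suc i))) = (\<Sum>i\<le>n. s (l * d i) (z i)) - s (l * d 0) (z 0)"
      unfolding m by (simp add: sum.atMost_Suc_shift del: sum.atMost_Suc)
    also have "(\<Sum>i\<le>n. s (l * d i) (z i)) = s l u"
      using dn by (simp add: m u_def scale_sum_right)
    also have "- s (a 0) (z 0) + (s l u - s (l * d 0) (z 0)) = s l u - s (a 0 + l * d 0) (z 0)"
      by (simp add: scale_left_distrib)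
    finally show ?thesis by (simp add: d0)
  qed
  ultimately show ?thesis using that by blast
qed

text \<open>Burnside's theorem.  A nonzero operator with maximal kernel has rank one, since \<open>T\<^sub>0 A T\<^sub>0 - l T\<^sub>0\<close> has a
  larger kernel for an eigenvalue \<open>l\<close> of \<open>T\<^sub>0 A\<close> on the range of \<open>T\<^sub>0\<close>.\<close>

lemma irreducible_operator_algebra:
  assumes V: "subspace V" "finite B0" "V \<subseteq> span B0" "V \<noteq> {0}"
    and op: "\<And>T. T \<in> \<A> \<Longrightarrow> lmap s s T" "\<And>T v. T \<in> \<A> \<Longrightarrow> v \<in> V \<Longrightarrow> T v \<in> V"
    and add: "\<And>T U. T \<in> \<A> \<Longrightarrow> U \<in> \<A> \<Longrightarrow> (\<lambda>x. T x + U x) \<in> \<A>"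
    and scale: "\<And>T c. T \<in> \<A> \<Longrightarrow> (\<lambda>x. s c (T x)) \<in> \<A>"
    and comp: "\<And>T U. T \<in> \<A> \<Longrightarrow> U \<in> \<A> \<Longrightarrow> (\<lambda>x. T (U x)) \<in> \<A>"
    and trans: "\<And>v w. v \<in> V \<Longrightarrow> v \<noteq> 0 \<Longrightarrow> w \<in> V \<Longrightarrow> \<exists>T\<in>\<A>. T v = w"
    and T: "linear_on s s V T" "T ` V \<subseteq> V"
  shows "\<exists>U\<in>\<A>. \<forall>v\<in>V. U v = T v"
proof -
  have V0: "0 \<in> V" by (rule subspace_0[OF V(1)])
  obtain v1 where v1: "v1 \<in> V" "v1 \<noteq> 0" using V(4) V0 by blast
  define ker where "ker T = {v \<in> V. T v = 0}" for T :: "'a \<Rightarrow> 'a"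
  have ker: "subspace (ker T)" if "T \<in> \<A>" for T
    using V(1) op(1)[OF that] unfolding ker_def subspace_def
    by (auto simp: lmap_iff lmap_zero[OF op(1)[OF that]])
  have kspan: "ker T \<subseteq> span B0" for T using V(3) by (auto simp: ker_def)
  define P where "P T \<longleftrightarrow> T \<in> \<A> \<and> (\<exists>v\<in>V. T v \<noteq> 0)" for T
  \<comment> \<open>\<open>m T\<close> is the dimension of the kernel, written as the least
    cardinality of a basis; \<open>bound\<close> ensures that a maximum is attained.\<close>
  define m where "m T = (LEAST n. \<exists>B \<beta>. coords s (ker T) B \<beta> \<and> card B = n)" for T
  have m: "\<exists>B \<beta>. coords s (ker T) B \<beta> \<and> card B = m T" if T: "T \<in> \<A>" for T
  proof -
    obtain B \<beta> where "coords s (ker T) B \<beta>" using coords_exist[OF ker[OF T] V(2) kspan] by blast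
    then have "\<exists>n B \<beta>. coords s (ker T) B \<beta> \<and> card B = n" by blast
    from LeastI_ex[OF this] show ?thesis by (simp add: m_def)
  qed
  have bound: "m T \<le> card B0" if T: "T \<in> \<A>" for T
  proof -
    obtain B \<beta> where B: "coords s (ker T) B \<beta>" "card B \<le> card B0" using coords_exist[OF ker[OF T] V(2) kspan] by blast
    then have "m T \<le> card B" unfolding m_def by (intro Least_le) blast
    then show ?thesis using B by simp
  qed
  obtain T1 where "T1 \<in> \<A>" "T1 v1 = v1" using trans[OF v1(1,2) v1(1)] by blast
  then have "P T1" using v1 by (auto simp: P_def intro!: bexI[of _ v1])
  have "\<exists>T0. P T0 \<and> (\<forall>T. P T \<longrightarrow> m T \<le> m T0)"
    by (rule ex_has_greatest_nat[of P T1 m "Suc (card B0)", OF \<open>P T1\<close>]) (use bound in \<open>auto simp: P_def less_Suc_eq_le\<close>)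
  then obtain T0 where T0: "P T0" "\<And>T. P T \<Longrightarrow> m T \<le> m T0" by blast
  have T0A: "T0 \<in> \<A>" using T0 by (simp add: P_def)
  note L0 = op(1)[OF T0A]
  obtain v0 where v0: "v0 \<in> V" "T0 v0 \<noteq> 0" using T0 by (auto simp: P_def)
  define w where "w = T0 v0"
  have wV: "w \<in> V" and w0: "w \<noteq> 0" using v0 op(2)[OF T0A] by (auto simp: w_def)
  have imW: "subspace (T0 ` V)" by (rule subspace_image[OF s s L0 V(1)])
  have eig: "\<exists>l. \<forall>v\<in>V. T0 (A (T0 v)) = s l (T0 v)" if A: "A \<in> \<A>" for A
  proof -
    have X: "lmap s s (\<lambda>x. T0 (A x))" by (rule lmap_compose[OF op(1)[OF A] L0])
    have XW: "T0 (A u) \<in> T0 ` V" if "u \<in> T0 ` V" for u using that op(2)[OF A] op(2)[OF T0A] by auto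
    have sp: "T0 ` V \<subseteq> span B0" using op(2)[OF T0A] V(3) by auto
    have wW: "w \<in> T0 ` V" using v0 by (simp add: w_def)
    have "\<exists>l u. u \<in> T0 ` V \<and> u \<noteq> 0 \<and> T0 (A u) = s l u"
      by (rule eigenvector_exists[of "T0 ` V" B0 "\<lambda>x. T0 (A x)" w, OF imW V(2) sp X XW wW w0]) (assumption, blast)
    then obtain l u where u: "u \<in> T0 ` V" "u \<noteq> 0" "T0 (A u) = s l u" by (elim exE conjE)
    define U where "U x = T0 (A (T0 x)) + s (- l) (T0 x)" for x
    have U: "U \<in> \<A>" unfolding U_def[abs_def]
      by (rule add[OF comp[OF T0A comp[OF A T0A]] scale[OF T0A]])
    have "\<not> P U"
    proof
      assume "P U"
      obtain v where v: "v \<in> V" "u = T0 v" using u(1) by blast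
      obtain B \<beta> where B: "coords s (ker T0) B \<beta>" "card B = m T0" using m[OF T0A] by blast
      obtain B' \<beta>' where B': "coords s (ker U) B' \<beta>'" "card B' = m U" using m[OF U] by blast
      have "card B < card B'"
      proof (rule coords_card_less[OF B(1) ker[OF T0A] B'(1), of "\<lambda>x. x" v])
        show "x \<in> ker U" if "x \<in> ker T0" for x
          using that lmap_zero[OF op(1)[OF A]] lmap_zero[OF L0] by (simp add: ker_def U_def)
        show "v \<in> ker U" using v u by (simp add: ker_def U_def)
        show "v \<notin> (\<lambda>x. x) ` ker T0" using v u by (simp add: ker_def)
      qed (auto simp: lmap_iff)
      then show False using T0(2)[OF \<open>P U\<close>] B B' by simp
    qed
    then have "T0 (A (T0 v)) = s l (T0 v)" if "v \<in> V" for v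
      using U that by (auto simp: P_def U_def)
    then show ?thesis by blast
  qed
  have rank: "\<exists>x. T0 v = s x w" if v: "v \<in> V" for v
  proof -
    obtain A where A: "A \<in> \<A>" "A w = v" using trans[OF wV w0 v] by blast
    obtain l where "\<forall>v\<in>V. T0 (A (T0 v)) = s l (T0 v)" using eig[OF A(1)] by blast
    then show ?thesis using A(2) v0(1) by (auto simp: w_def)
  qed
  \<comment> \<open>\<open>T0\<close> has rank one on \<open>V\<close> and equals \<xi>(v) w there.
    The coefficient is unique because \<open>w\<close> is nonzero, which makes \<xi> linear on
    \<open>V\<close>.\<close>
  define \<xi> where "\<xi> v = (SOME x. T0 v = s x w)" for v
  have \<xi>: "T0 v = s (\<xi> v) w" if "v \<in> V" for v unfolding \<xi>_def using someI_ex[OF rank[OF that]] .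
  have \<xi>_unique: "\<xi> v = x" if "v \<in> V" "T0 v = s x w" for v x using \<xi>[OF that(1)] that(2) w0 by simp
  have \<xi>_add: "\<xi> (x + y) = \<xi> x + \<xi> y" if "x \<in> V" "y \<in> V" for x y
    by (rule \<xi>_unique) (use that subspace_add[OF V(1)] \<xi> in \<open>simp_all add: lmap_add[OF L0] scale_left_distrib\<close>)
  have \<xi>_scale: "\<xi> (s c x) = c * \<xi> x" if "x \<in> V" for x c
    by (rule \<xi>_unique) (use that subspace_scale[OF V(1)] \<xi> in \<open>simp_all add: lmap_scale[OF L0]\<close>)
  have \<xi>_0: "\<xi> 0 = 0" by (rule \<xi>_unique[OF V0]) (simp add: lmap_zero[OF L0])
  have \<xi>_sum: "\<xi> (\<Sum>i\<in>I. s (c i) (g i)) = (\<Sum>i\<in>I. c i * \<xi> (g i))" if "\<And>i. i \<in> I \<Longrightarrow> g i \<in> V" for I c and g :: "'a \<Rightarrow> 'a"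
    using that
  proof (induction I rule: infinite_finite_induct)
    case (insert i I)
    then have "(\<Sum>i\<in>I. s (c i) (g i)) \<in> V" by (intro subspace_sum subspace_scale V(1)) auto
    with insert show ?case by (simp add: \<xi>_add \<xi>_scale subspace_scale[OF V(1)])
  qed (simp_all add: \<xi>_0)
  obtain B \<beta> where c: "coords s V B \<beta>" using coords_exist[OF V(1-3)] by blast
  have fin: "finite B" and BV: "\<And>b. b \<in> B \<Longrightarrow> b \<in> V" using c by (auto simp: coords_def)
  define \<delta> :: "'a \<Rightarrow> 'a \<Rightarrow> 'k" where "\<delta> b = (\<lambda>c. if c = b then 1 else 0)" for b
  define y where "y A = (\<lambda>b. if b \<in> B then \<xi> (A b) else 0)" for A :: "'a \<Rightarrow> 'a"
  interpret fs: vector_space "fun_scale :: 'k \<Rightarrow> ('a \<Rightarrow> 'k) \<Rightarrow> 'a \<Rightarrow> 'k" by (rule vector_space_fun_scale)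
  have Y: "fs.subspace (y ` \<A>)"
  proof (unfold fs.subspace_def, intro conjI ballI allI)
    have Z: "(\<lambda>x. s 0 (T0 x)) \<in> \<A>" by (rule scale[OF T0A])
    show "0 \<in> y ` \<A>" by (rule image_eqI[OF _ Z]) (auto simp: y_def \<xi>_0)
  next
    fix f g assume "f \<in> y ` \<A>" "g \<in> y ` \<A>"
    then obtain T U where TU: "T \<in> \<A>" "U \<in> \<A>" "f = y T" "g = y U" by blast
    show "f + g \<in> y ` \<A>"
      by (rule image_eqI[OF _ add[OF TU(1,2)]]) (use TU op(2) BV in \<open>auto simp: y_def \<xi>_add fun_eq_iff\<close>)
  next
    fix c f assume "f \<in> y ` \<A>"
    then obtain T where TU: "T \<in> \<A>" "f = y T" by blast
    show "fun_scale c f \<in> y ` \<A>"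
      by (rule image_eqI[OF _ scale[OF TU(1), of c]]) (use TU op(2) BV in \<open>auto simp: y_def \<xi>_scale fun_eq_iff fun_scale_def\<close>)
  qed
  \<comment> \<open>Every coordinate functional has the form of \<xi> after some \<open>A\<close>.
    Otherwise a functional \<Phi> that kills all rows \<open>y A\<close> amounts to evaluation at a
    nonzero vector \<open>z\<close>, so \<xi>(A z) = 0 for every \<open>A\<close>, although some
    \<open>A\<close> sends \<open>z\<close> to \<open>v0\<close>.\<close>
  have dual: "\<exists>A\<in>\<A>. y A = \<delta> b" if b: "b \<in> B" for b
  proof (rule ccontr)
    assume "\<not> ?thesis"
    then have "\<delta> b \<notin> y ` \<A>" by auto
    then obtain \<Phi> where \<Phi>: "lmap fun_scale (*) \<Phi>" "\<And>f. f \<in> y ` \<A> \<Longrightarrow> \<Phi> f = 0" "\<Phi> (\<delta> b) = 1"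
      using fs.subspace_functional[OF Y] by blast
    define z where "z = (\<Sum>c\<in>B. s (\<Phi> (\<delta> c)) c)"
    have zV: "z \<in> V" unfolding z_def by (intro subspace_sum subspace_scale V(1) BV)
    have "\<beta> b z = 1"
    proof -
      have l: "lmap s (*) (\<beta> b)" using c b by (simp add: coords_def)
      have "\<beta> b z = (\<Sum>d\<in>B. \<Phi> (\<delta> d) * \<beta> b d)" by (simp add: z_def lmap_sum[OF l] lmap_scale[OF l])
      also have "\<dots> = (\<Sum>d\<in>B. if d = b then \<Phi> (\<delta> d) else 0)"
        using c b by (intro sum.cong) (auto simp: coords_def)
      finally show ?thesis using fin b \<Phi>(3) by simp
    qed
    then have "z \<noteq> 0" using c b lmap_zero[of s "(*)" "\<beta> b"] by (auto simp: coords_def)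
    then obtain A where A: "A \<in> \<A>" "A z = v0" using trans[OF zV _ v0(1)] by blast
    have "\<xi> v0 = 1" by (rule \<xi>_unique[OF v0(1)]) (simp add: w_def)
    moreover have "\<xi> (A z) = (\<Sum>c\<in>B. \<Phi> (\<delta> c) * \<xi> (A c))"
      using \<xi>_sum[of B A "\<lambda>c. \<Phi> (\<delta> c)"] op(2)[OF A(1)] BV
      by (simp add: z_def lmap_sum[OF op(1)[OF A(1)]] lmap_scale[OF op(1)[OF A(1)]])
    moreover have "\<dots> = \<Phi> (\<Sum>c\<in>B. fun_scale (\<xi> (A c)) (\<delta> c))"
      by (simp add: lmap_sum[OF \<Phi>(1)] lmap_scale[OF \<Phi>(1)] mult.commute)
    moreover have "(\<Sum>c\<in>B. fun_scale (\<xi> (A c)) (\<delta> c)) = y A"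
    proof
      have sum_fun: "(\<Sum>i\<in>I. F i) x = (\<Sum>i\<in>I. F i x)" for I :: "'a set" and F :: "'a \<Rightarrow> 'a \<Rightarrow> 'k" and x
        by (induction I rule: infinite_finite_induct) auto
      fix x
      have "(\<Sum>c\<in>B. fun_scale (\<xi> (A c)) (\<delta> c)) x = (\<Sum>c\<in>B. if x = c then \<xi> (A c) else 0)"
        unfolding sum_fun by (intro sum.cong) (auto simp: fun_scale_def \<delta>_def)
      then show "(\<Sum>c\<in>B. fun_scale (\<xi> (A c)) (\<delta> c)) x = y A x" using fin by (simp add: y_def)
    qed
    ultimately show False using \<Phi>(2) A by auto
  qed
  \<comment> \<open>The composite of \<open>A'\<close>, \<open>T0\<close> and \<open>A\<close> has a
    single nonzero column, namely \<open>T b\<close> at \<open>b\<close>.\<close>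
  have elem: "\<exists>U\<in>\<A>. \<forall>c\<in>B. U c = (if c = b then T b else 0)" if b: "b \<in> B" for b
  proof -
    obtain A where A: "A \<in> \<A>" "y A = \<delta> b" using dual[OF b] by blast
    have "T b \<in> V" using T(2) BV[OF b] by auto
    then obtain A' where A': "A' \<in> \<A>" "A' w = T b" using trans[OF wV w0] by blast
    have "A' (T0 (A c)) = (if c = b then T b else 0)" if "c \<in> B" for c
    proof -
      have "\<xi> (A c) = \<delta> b c" using A(2) that by (auto simp: y_def dest!: fun_cong[of _ _ c])
      then show ?thesis
        using \<xi>[OF op(2)[OF A(1) BV[OF that]]] A'(2) lmap_zero[OF op(1)[OF A'(1)]]
        by (simp add: \<delta>_def lmap_scale[OF op(1)[OF A'(1)]])
    qed
    then show ?thesis using comp[OF A'(1) comp[OF T0A A(1)]] by (intro bexI) auto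
  qed
  have "\<exists>U\<in>\<A>. \<forall>c\<in>B. U c = (if c \<in> J then T c else 0)" if "finite J" "J \<subseteq> B" for J
    using that
  proof (induction J rule: finite_induct)
    case empty
    show ?case by (rule bexI[OF _ scale[OF T0A, of 0]]) simp
  next
    case (insert b J)
    then obtain U where U: "U \<in> \<A>" "\<forall>c\<in>B. U c = (if c \<in> J then T c else 0)" by auto
    obtain U' where U': "U' \<in> \<A>" "\<forall>c\<in>B. U' c = (if c = b then T b else 0)" using elem insert by blast
    show ?case by (rule bexI[OF _ add[OF U(1) U'(1)]]) (use U(2) U'(2) insert in auto)
  qed
  from this[OF fin order_refl] obtain U where U: "U \<in> \<A>" "\<And>c. c \<in> B \<Longrightarrow> U c = T c" by auto
  obtain T' where T': "lmap s s T'" "\<And>x. x \<in> V \<Longrightarrow> T' x = T x"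
    using linear_extension_from_subspace[OF V(1) T(1) s] by blast
  have "U v = T v" if v: "v \<in> V" for v
  proof -
    have e: "v = (\<Sum>b\<in>B. s (\<beta> b v) b)" using c v by (simp add: coords_def)
    have "U v = (\<Sum>b\<in>B. s (\<beta> b v) (U b))"
      by (subst e) (simp add: lmap_sum[OF op(1)[OF U(1)]] lmap_scale[OF op(1)[OF U(1)]])
    also have "\<dots> = (\<Sum>b\<in>B. s (\<beta> b v) (T' b))" using U(2) T'(2) BV by simp
    also have "\<dots> = T' v" by (subst (2) e) (simp add: lmap_sum[OF T'(1)] lmap_scale[OF T'(1)])
    finally show ?thesis using T'(2)[OF v] by simp
  qed
  then show ?thesis using U(1) by blast
qed

end

section \<open>Simple subcoalgebras and irreducible coideals\<close>

lemma tensor_restrict: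
  assumes "tensor_in s1 s2 X Y t"
  shows "Poly_Mapping.keys (tensor_restrict s1 s2 X Y t) \<subseteq> X \<times> Y"
    "tensor_eq s1 s2 (tensor_restrict s1 s2 X Y t) t"
proof -
  have "\<exists>u. Poly_Mapping.keys u \<subseteq> X \<times> Y \<and> tensor_eq s1 s2 u t"
    using assms by (simp add: tensor_in_def)
  from someI_ex[OF this] show "Poly_Mapping.keys (tensor_restrict s1 s2 X Y t) \<subseteq> X \<times> Y"
    "tensor_eq s1 s2 (tensor_restrict s1 s2 X Y t) t"
    by (auto simp: tensor_restrict_def)
qed

text \<open>It removes the choice in \<open>tensor_restrict\<close>: a map that matters only on legs
  in \<open>X\<close> and \<open>Y\<close> is replaced by a bilinear map on the whole spaces, for
  which every representative gives the same value.\<close>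

lemma lin_ext_tensor_restrict:
  assumes "tensor_in s1 s2 X Y t" "vector_space s3" "bilin s1 s2 s3 F"
    "\<And>x y. x \<in> X \<Longrightarrow> y \<in> Y \<Longrightarrow> G (x, y) = F x y"
  shows "lin_ext s3 G (tensor_restrict s1 s2 X Y t) = lin_ext s3 (\<lambda>(x, y). F x y) t"
proof -
  have "lin_ext s3 G (tensor_restrict s1 s2 X Y t) = lin_ext s3 (\<lambda>(x, y). F x y) (tensor_restrict s1 s2 X Y t)"
    by (rule lin_ext_cong) (use tensor_restrict(1)[OF assms(1)] assms(4) in auto)
  also have "\<dots> = lin_ext s3 (\<lambda>(x, y). F x y) t"
    by (rule lin_ext_tensor_eq[OF tensor_restrict(2)[OF assms(1)] assms(2)]) (use assms(3) in simp)
  finally show ?thesis .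
qed

text \<open>Projections \<open>P\<close> onto \<open>X\<close> and \<open>R\<close> onto
  \<open>Y\<close> map \<open>t\<close> to a tensor supported in \<open>X \<times> Y\<close>. No
  product of functionals distinguishes it from \<open>t\<close>, since f minus f after
  \<open>P\<close> vanishes on \<open>X\<close>, and g minus g after \<open>R\<close> on
  \<open>Y\<close>.\<close>

lemma tensor_inI:
  assumes s1: "vector_space s1" and s2: "vector_space s2"
    and X: "module.subspace s1 X" and Y: "module.subspace s2 Y"
    and fX: "\<And>f g. lmap s1 (*) f \<Longrightarrow> lmap s2 (*) g \<Longrightarrow> (\<And>x. x \<in> X \<Longrightarrow> f x = 0) \<Longrightarrow>
      lin_ext (*) (\<lambda>(x, y). f x * g y) t = 0"
    and gY: "\<And>f g. lmap s1 (*) f \<Longrightarrow> lmap s2 (*) g \<Longrightarrow> (\<And>y. y \<in> Y \<Longrightarrow> g y = 0) \<Longrightarrow>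
      lin_ext (*) (\<lambda>(x, y). f x * g y) t = 0"
  shows "tensor_in s1 s2 X Y t"
proof -
  interpret v1: vector_space s1 by fact
  interpret v2: vector_space s2 by fact
  obtain P where P: "lmap s1 s1 P" "\<And>x. P x \<in> X" "\<And>x. x \<in> X \<Longrightarrow> P x = x"
    using v1.subspace_projection[OF X] by blast
  obtain R where R: "lmap s2 s2 R" "\<And>x. R x \<in> Y" "\<And>x. x \<in> Y \<Longrightarrow> R x = x"
    using v2.subspace_projection[OF Y] by blast
  have "tensor_eq s1 s2 (tensor_map P R t) t"
  proof (rule tensor_eq_if_functionals[OF s1 s2])
    fix f g assume f: "lmap s1 (*) f" and g: "lmap s2 (*) g"
    have l1: "lmap s1 (*) (\<lambda>x. f x - f (P x))"
      using f P(1) by (simp add: lmap_iff algebra_simps)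
    have l2: "lmap s1 (*) (\<lambda>x. f (P x))" by (rule lmap_compose[OF P(1) f])
    have l3: "lmap s2 (*) (\<lambda>x. g x - g (R x))"
      using g R(1) by (simp add: lmap_iff algebra_simps)
    have "lin_ext (*) (\<lambda>(x, y). f x * g y) t = lin_ext (*) (\<lambda>z. (\<lambda>(x, y). (f x - f (P x)) * g y) z
        + ((\<lambda>(x, y). f (P x) * (g y - g (R y))) z + (\<lambda>(x, y). f (P x) * g (R y)) z)) t"
      by (rule lin_ext_cong) (auto simp: algebra_simps)
    also have "\<dots> = lin_ext (*) (\<lambda>(x, y). f (P x) * g (R y)) t"
      unfolding lin_ext_plus[OF vector_space_times]
      using fX[OF l1 g] gY[OF l2 l3] P(3) R(3) by simp
    finally show "lin_ext (*) (\<lambda>(x, y). f x * g y) (tensor_map P R t) = lin_ext (*) (\<lambda>(x, y). f x * g y) t"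
      by (simp add: lin_ext_tensor_map[OF vector_space_times])
  qed
  moreover have "Poly_Mapping.keys (tensor_map P R t) \<subseteq> X \<times> Y"
    by (rule keys_tensor_map[of _ UNIV UNIV]) (use P R in auto)
  ultimately show ?thesis by (auto simp: tensor_in_def)
qed

text \<open>\<open>B0\<close> and \<open>P\<close> are auxiliary data: finite dimension follows from
  the integral of \<open>H\<close>, and \<open>P\<close> is any linear projection onto
  \<open>C\<close>.\<close>

locale simple_coideal = hopf_algebra scale \<Delta> \<epsilon> S
  for scale :: "'k::alg_closed_field \<Rightarrow> 'h::ring_1 \<Rightarrow> 'h"
    and \<Delta> :: "'h \<Rightarrow> ('h \<times> 'h \<Rightarrow>\<^sub>0 'k)" and \<epsilon> :: "'h \<Rightarrow> 'k" and S :: "'h \<Rightarrow> 'h" +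
  fixes C V B0 :: "'h set" and P :: "'h \<Rightarrow> 'h"
  assumes finite_dim: "finite B0" "span B0 = UNIV"
    and C_simple: "simple_subcoalgebra scale \<Delta> C"
    and V_irreducible: "irreducible_left_coideal scale \<Delta> V" and V_subset: "V \<subseteq> C"
    and endo_P: "endo P" and P_in: "P x \<in> C" and P_id: "x \<in> C \<Longrightarrow> P x = x"
begin

abbreviation D where "D \<equiv> dual_algebra scale \<Delta> \<epsilon> C"

definition res :: "('h \<Rightarrow> 'k) \<Rightarrow> 'h \<Rightarrow> 'k" where
  "res f = (\<lambda>c. if c \<in> C then f c else 0)"

text \<open>Elements of \<open>C\<^sup>*\<close> are functions that vanish outside \<open>C\<close>.  Composition with \<open>P\<close> turns them into linear
  functionals on \<open>H\<close>, so that \<open>cmult\<close>, the product of \<open>C\<^sup>*\<close>, is a Sweedler sum.\<close>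

definition cmult :: "('h \<Rightarrow> 'k) \<Rightarrow> ('h \<Rightarrow> 'k) \<Rightarrow> 'h \<Rightarrow> 'k" where
  "cmult f g = (\<lambda>c. if c \<in> C then sw c (\<lambda>x y. f (P x) * g (P y)) else 0)"

lemma C_subspace: "subspace C" and C_tensor: "c \<in> C \<Longrightarrow> tensor_in scale scale C C (\<Delta> c)"
  using C_simple by (auto simp: simple_subcoalgebra_def subcoalgebra_def)

lemma V_subspace: "subspace V" and V_tensor: "v \<in> V \<Longrightarrow> tensor_in scale scale UNIV V (\<Delta> v)"
  and V_nonzero: "V \<noteq> {0}"
  using V_irreducible by (auto simp: irreducible_left_coideal_def left_coideal_def)

lemma P_zero: "P 0 = 0"
  by (rule lmap_zero[OF endo_P])

lemma carrier_D: "f \<in> carrier D \<longleftrightarrow> linear_on scale (*) C f \<and> (\<forall>x. x \<notin> C \<longrightarrow> f x = 0)"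
  by (simp add: dual_algebra_def)

lemma one_D: "\<one>\<^bsub>D\<^esub> = res \<epsilon>"
  by (simp add: dual_algebra_def res_def)

lemma smult_D: "c \<odot>\<^bsub>D\<^esub> f = fun_scale c f" and add_D: "f \<oplus>\<^bsub>D\<^esub> g = f + g"
  by (simp_all add: dual_algebra_def)

lemma res_carrier: "lin f \<Longrightarrow> res f \<in> carrier D"
  using subspace_add[OF C_subspace] subspace_scale[OF C_subspace]
  by (simp add: carrier_D res_def linear_on_def)

lemma carrier_lin: "f \<in> carrier D \<Longrightarrow> lin (\<lambda>x. f (P x))"
  using endo_P P_in by (simp add: carrier_D linear_on_def)

lemma carrier_res: "f \<in> carrier D \<Longrightarrow> res (\<lambda>x. f (P x)) = f"
  by (auto simp: carrier_D res_def P_id)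

lemma carrier_off: "f \<in> carrier D \<Longrightarrow> x \<notin> C \<Longrightarrow> f x = 0"
  by (simp add: carrier_D)

lemma mult_D:
  assumes "f \<in> carrier D" "g \<in> carrier D" shows "f \<otimes>\<^bsub>D\<^esub> g = cmult f g"
proof
  fix c
  show "(f \<otimes>\<^bsub>D\<^esub> g) c = cmult f g c"
  proof (cases "c \<in> C")
    case True
    have "lin_ext (*) (\<lambda>(x, y). f x * g y) (tensor_restrict scale scale C C (\<Delta> c))
      = lin_ext (*) (\<lambda>(x, y). f (P x) * g (P y)) (\<Delta> c)"
      by (rule lin_ext_tensor_restrict[OF C_tensor[OF True] vector_space_times])
        (use carrier_lin[OF assms(1)] carrier_lin[OF assms(2)] in \<open>auto simp: bilin_def lmap_iff algebra_simps P_id\<close>)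
    then show ?thesis using True by (simp add: dual_algebra_def cmult_def sw_def)
  qed (simp add: dual_algebra_def cmult_def)
qed

lemma cmult_res:
  assumes "lin f" "lin g" shows "cmult (res f) (res g) = res (\<lambda>c. sw c (\<lambda>x y. f x * g y))"
proof
  fix c
  have "sw c (\<lambda>x y. f (P x) * g (P y)) = sw c (\<lambda>x y. f x * g y)" if "c \<in> C"
    by (rule sw_cong_sub[OF C_tensor[OF that]])
      (use assms endo_P in \<open>simp_all add: lin_simps P_id\<close>)
  then show "cmult (res f) (res g) c = res (\<lambda>c. sw c (\<lambda>x y. f x * g y)) c"
    by (simp add: cmult_def res_def P_in)
qed

lemma cmult_as_res:
  assumes "f \<in> carrier D" "g \<in> carrier D"
  shows "cmult f g = res (\<lambda>c. sw c (\<lambda>x y. f (P x) * g (P y)))"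
  using cmult_res[OF carrier_lin[OF assms(1)] carrier_lin[OF assms(2)]] assms by (simp add: carrier_res)

lemma cmult_closed:
  assumes "f \<in> carrier D" "g \<in> carrier D" shows "cmult f g \<in> carrier D"
  unfolding cmult_as_res[OF assms]
  by (rule res_carrier) (use carrier_lin[OF assms(1)] carrier_lin[OF assms(2)] in \<open>simp add: lin_simps\<close>)

lemma res_eqI: "(\<And>c. c \<in> C \<Longrightarrow> f c = g c) \<Longrightarrow> res f = res g"
  by (auto simp: res_def)

lemma cmult_assoc:
  assumes "f \<in> carrier D" "g \<in> carrier D" "h \<in> carrier D"
  shows "cmult (cmult f g) h = cmult f (cmult g h)"
proof -
  note l = assms[THEN carrier_lin, unfolded lmap_iff]
  have 1: "lin (\<lambda>c. sw c (\<lambda>x y. f (P x) * g (P y)))" "lin (\<lambda>c. sw c (\<lambda>x y. g (P x) * h (P y)))"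
    using l by (simp_all add: lin_simps)
  have "cmult (cmult f g) h = res (\<lambda>c. sw c (\<lambda>p z. sw p (\<lambda>x y. f (P x) * g (P y)) * h (P z)))"
    using cmult_res[OF 1(1) carrier_lin[OF assms(3)]] assms by (simp add: carrier_res cmult_as_res)
  also have "\<dots> = res (\<lambda>c. sw c (\<lambda>p z. sw p (\<lambda>x y. f (P x) * g (P y) * h (P z))))"
    by (simp only: sw_multc)
  also have "\<dots> = res (\<lambda>c. sw c (\<lambda>x q. sw q (\<lambda>y z. f (P x) * g (P y) * h (P z))))"
    by (intro res_eqI sw_coassoc) (use l in \<open>simp_all add: lin_simps\<close>)
  also have "\<dots> = res (\<lambda>c. sw c (\<lambda>x q. f (P x) * sw q (\<lambda>y z. g (P y) * h (P z))))"
    by (simp only: sw_cmult mult.assoc)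
  also have "\<dots> = cmult f (cmult g h)"
    using cmult_res[OF carrier_lin[OF assms(1)] 1(2)] assms by (simp add: carrier_res cmult_as_res)
  finally show ?thesis .
qed

lemma one_carrier: "\<one>\<^bsub>D\<^esub> \<in> carrier D"
  by (simp add: one_D res_carrier lin_counit)

lemma cmult_one:
  assumes "f \<in> carrier D" shows "cmult \<one>\<^bsub>D\<^esub> f = f" "cmult f \<one>\<^bsub>D\<^esub> = f"
  using cmult_res[OF lin_counit carrier_lin[OF assms]] cmult_res[OF carrier_lin[OF assms] lin_counit] assms
  by (simp_all add: one_D carrier_res sw_counit_left[OF carrier_lin] sw_counit_right'[OF carrier_lin])

lemma cmult_sw_left: "cmult (\<lambda>c. sw a (\<lambda>x y. \<Psi> x y c)) h = (\<lambda>c. sw a (\<lambda>x y. cmult (\<Psi> x y) h c))"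
proof
  fix c
  have "sw c (\<lambda>x y. sw a (\<lambda>u v. \<Psi> u v (P x)) * h (P y)) = sw a (\<lambda>u v. sw c (\<lambda>x y. \<Psi> u v (P x) * h (P y)))"
    unfolding sw_multc[symmetric] by (rule sw_swap)
  then show "cmult (\<lambda>c. sw a (\<lambda>x y. \<Psi> x y c)) h c = sw a (\<lambda>x y. cmult (\<Psi> x y) h c)"
    by (simp add: cmult_def sw_zero)
qed

lemma cmult_sw_right: "cmult h (\<lambda>c. sw a (\<lambda>x y. \<Psi> x y c)) = (\<lambda>c. sw a (\<lambda>x y. cmult h (\<Psi> x y) c))"
proof
  fix c
  have "sw c (\<lambda>x y. h (P x) * sw a (\<lambda>u v. \<Psi> u v (P y))) = sw a (\<lambda>u v. sw c (\<lambda>x y. h (P x) * \<Psi> u v (P y)))"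
    unfolding sw_cmult[symmetric] by (rule sw_swap)
  then show "cmult h (\<lambda>c. sw a (\<lambda>x y. \<Psi> x y c)) c = sw a (\<lambda>x y. cmult h (\<Psi> x y) c)"
    by (simp add: cmult_def sw_zero)
qed

text \<open>The tensor lies in C \<otimes> C, as V \<subseteq> C, and in H \<otimes> V; the
  criterion \<open>tensor_inI\<close> intersects the two.\<close>

lemma V_tensor_C:
  assumes v: "v \<in> V" shows "tensor_in scale scale C V (\<Delta> v)"
proof (rule tensor_inI[OF vector_space_axioms vector_space_axioms C_subspace V_subspace])
  have vC: "v \<in> C" using v V_subset by blast
  fix f g assume fg: "lin f" "lin g"
  show "lin_ext (*) (\<lambda>(x, y). f x * g y) (\<Delta> v) = 0" if "\<And>x. x \<in> C \<Longrightarrow> f x = 0"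
  proof -
    have "sw v (\<lambda>x y. f x * g y) = sw v (\<lambda>x y. 0)"
      by (rule sw_cong_sub[OF C_tensor[OF vC]]) (use fg that in \<open>simp_all add: lin_simps\<close>)
    then show ?thesis by (simp add: sw_zero) (simp add: sw_def)
  qed
  show "lin_ext (*) (\<lambda>(x, y). f x * g y) (\<Delta> v) = 0" if "\<And>y. y \<in> V \<Longrightarrow> g y = 0"
  proof -
    have "sw v (\<lambda>x y. f x * g y) = sw v (\<lambda>x y. 0)"
      by (rule sw_cong_sub[OF V_tensor[OF v]]) (use fg that in \<open>simp_all add: lin_simps\<close>)
    then show ?thesis by (simp add: sw_zero) (simp add: sw_def)
  qed
qed

lemma hit_V: "v \<in> V \<Longrightarrow> lin f \<Longrightarrow> hit f v \<in> V"
  by (rule hit_mem[OF V_tensor V_subspace])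

lemma hit_cong_C:
  assumes v: "v \<in> V" and "lin f" "lin g" "\<And>c. c \<in> C \<Longrightarrow> f c = g c"
  shows "hit f v = hit g v"
proof (rule eq_if_functionals)
  fix \<phi> assume \<phi>: "lin \<phi>"
  have "sw v (\<lambda>x y. f x * \<phi> y) = sw v (\<lambda>x y. g x * \<phi> y)"
    by (rule sw_cong_sub[OF V_tensor_C[OF v]]) (use \<phi> assms in \<open>simp_all add: lin_simps\<close>)
  then show "\<phi> (hit f v) = \<phi> (hit g v)" by (simp add: lin_hit[OF \<phi>])
qed

text \<open>The order is reversed: \<open>hit\<close> turns convolution into composition backwards,
  whence the opposite algebras in the theorem.\<close>

lemma hit_hit:
  assumes "lin f" "lin g" shows "hit g (hit f h) = hit (\<lambda>c. sw c (\<lambda>x y. f x * g y)) h"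
proof (rule eq_if_functionals)
  fix \<phi> assume \<phi>: "lin \<phi>"
  have l: "lin (\<lambda>z. sw z (\<lambda>x y. g x * \<phi> y))" using assms \<phi> by (simp add: lin_simps)
  have "\<phi> (hit g (hit f h)) = sw h (\<lambda>x q. f x * sw q (\<lambda>y z. g y * \<phi> z))"
    using lin_hit[OF l] by (simp add: lin_hit[OF \<phi>])
  also have "\<dots> = sw h (\<lambda>x q. sw q (\<lambda>y z. f x * g y * \<phi> z))" by (simp only: sw_cmult mult.assoc)
  also have "\<dots> = sw h (\<lambda>p z. sw p (\<lambda>x y. f x * g y * \<phi> z))"
    by (rule sw_coassoc[symmetric]) (use assms \<phi> in \<open>simp_all add: lin_simps\<close>)
  also have "\<dots> = \<phi> (hit (\<lambda>c. sw c (\<lambda>x y. f x * g y)) h)" by (simp add: lin_hit[OF \<phi>] sw_multc)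
  finally show "\<phi> (hit g (hit f h)) = \<phi> (hit (\<lambda>c. sw c (\<lambda>x y. f x * g y)) h)" .
qed

lemma hit_counit: "hit \<epsilon> h = h"
  by (rule eq_if_functionals) (simp add: lin_hit sw_counit_left)

text \<open>The orbit of \<open>v\<close> is a nonzero left coideal inside \<open>V\<close>, hence
  all of \<open>V\<close>.\<close>

lemma hit_transitive:
  assumes v: "v \<in> V" "v \<noteq> 0" and w: "w \<in> V"
  obtains f where "lin f" "hit f v = w"
proof -
  define W where "W = {hit f v | f. lin f}"
  have W: "subspace W" unfolding W_def by (rule subspace_hits)
  have "left_coideal scale \<Delta> W"
    unfolding left_coideal_def
  proof (intro conjI ballI W)
    fix w assume "w \<in> W"
    then obtain f0 where f0: "w = hit f0 v" "lin f0" by (auto simp: W_def)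
    show "tensor_in scale scale UNIV W (\<Delta> w)"
    proof (rule tensor_inI[OF vector_space_axioms vector_space_axioms subspace_UNIV W])
      fix f g assume fg: "lin f" "lin g"
      show "lin_ext (*) (\<lambda>(x, y). f x * g y) (\<Delta> w) = 0" if "\<And>x. x \<in> UNIV \<Longrightarrow> f x = 0"
        using that by (simp add: lin_ext_def case_prod_unfold)
      have "lin (\<lambda>c. sw c (\<lambda>x y. f0 x * f y))" using f0 fg by (simp add: lin_simps)
      then have "hit f w \<in> W" using hit_hit[OF f0(2) fg(1)] f0(1) by (auto simp: W_def)
      moreover have "lin_ext (*) (\<lambda>(x, y). f x * g y) (\<Delta> w) = g (hit f w)"
        using lin_hit[OF fg(2)] by (simp add: sw_def)
      ultimately show "lin_ext (*) (\<lambda>(x, y). f x * g y) (\<Delta> w) = 0" if "\<And>y. y \<in> W \<Longrightarrow> g y = 0"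
        using that by simp
    qed
  qed
  moreover have "W \<subseteq> V" using hit_V[OF v(1)] by (auto simp: W_def)
  moreover have "v \<in> W" using hit_counit[of v] lin_counit unfolding W_def by force
  ultimately have "W = V" using V_irreducible v(2) by (auto simp: irreducible_left_coideal_def)
  then show ?thesis using w that by (auto simp: W_def)
qed

text \<open>The matrix coefficients of \<open>V\<close> span a nonzero subcoalgebra of
  \<open>C\<close>, which is \<open>C\<close> by simplicity. It is a subcoalgebra because a
  functional vanishing on it annihilates \<open>V\<close>, and a product of functionals takes at a
  coefficient the matrix entry of the composed action.\<close>

lemma C_coefficients: "span {hitl g v | g v. v \<in> V \<and> lin g} = C" (is "?K = C")
proof -
  have faith: "g (hit f v) = 0" if "lin f" "lin g" "v \<in> V" "\<And>x. x \<in> ?K \<Longrightarrow> f x = 0" for f g v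
  proof -
    have "hitl g v \<in> ?K" by (rule span_base) (use that in blast)
    then have "f (hitl g v) = 0" using that by blast
    then show ?thesis using lin_hitl[OF that(1)] lin_hit[OF that(2)] by simp
  qed
  then have faith': "hit f v = 0" if "lin f" "v \<in> V" "\<And>x. x \<in> ?K \<Longrightarrow> f x = 0" for f v
    using zero_if_functionals that by blast
  have "subcoalgebra scale \<Delta> ?K"
    unfolding subcoalgebra_def
  proof (intro conjI ballI subspace_span)
    fix c assume c: "c \<in> ?K"
    show "tensor_in scale scale ?K ?K (\<Delta> c)"
    proof (rule tensor_inI[OF vector_space_axioms vector_space_axioms subspace_span subspace_span])
      fix f g assume fg: "lin f" "lin g"
      have l: "lin (\<lambda>z. sw z (\<lambda>x y. f x * g y))" using fg by (simp add: lin_simps)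
      have ext: "sw c (\<lambda>x y. f x * g y) = 0"
        if gen: "\<And>g' v. v \<in> V \<Longrightarrow> lin g' \<Longrightarrow> sw (hitl g' v) (\<lambda>x y. f x * g y) = 0"
        using c
      proof (induction rule: span_induct_alt)
        case base
        show ?case using lmap_zero[OF l] .
      next
        case (step k x y)
        then show ?case using gen lmap_add[OF l] lmap_scale[OF l] by auto
      qed
      have eq: "sw (hitl g' v) (\<lambda>x y. f x * g y) = g' (hit g (hit f v))" if "lin g'" for g' v
      proof -
        have l': "lin (\<lambda>z. sw z (\<lambda>x y. g x * g' y))" using fg that by (simp add: lin_simps)
        have "sw (hitl g' v) (\<lambda>x y. f x * g y) = sw v (\<lambda>p z. sw p (\<lambda>x y. f x * g y) * g' z)"
          by (rule lin_hitl[OF l])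
        also have "\<dots> = g' (hit (\<lambda>c. sw c (\<lambda>x y. f x * g y)) v)"
          by (simp add: lin_hit[OF that])
        finally show ?thesis by (simp add: hit_hit[OF fg])
      qed
      show "lin_ext (*) (\<lambda>(x, y). f x * g y) (\<Delta> c) = 0" if "\<And>x. x \<in> ?K \<Longrightarrow> f x = 0"
        using ext[unfolded sw_def[of c]] eq faith'[OF fg(1) _ that] lmap_zero[OF endo_hit[OF fg(2)]]
        by (simp add: lmap_zero[of scale "(*)"])
      show "lin_ext (*) (\<lambda>(x, y). f x * g y) (\<Delta> c) = 0" if "\<And>y. y \<in> ?K \<Longrightarrow> g y = 0"
        using ext[unfolded sw_def[of c]] eq faith'[OF fg(2) hit_V[OF _ fg(1)] that]
        by (simp add: lmap_zero[of scale "(*)"])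
    qed
  qed
  moreover have "?K \<subseteq> C"
    by (rule span_minimal[OF _ C_subspace])
      (use hitl_mem[OF V_tensor_C C_subspace] in auto)
  moreover have "?K \<noteq> {0}"
  proof -
    obtain v where v: "v \<in> V" "v \<noteq> 0" using V_nonzero subspace_0[OF V_subspace] by blast
    then obtain g where g: "lin g" "g v = 1" using subspace_functional[OF subspace_single_0, of v] by (metis singletonD)
    have "\<epsilon> (hitl g v) = 1" using lin_hitl[OF lin_counit] sw_counit_left[OF g(1)] g(2) by simp
    then have "hitl g v \<noteq> 0" using lmap_zero[OF lin_counit] by auto
    moreover have "hitl g v \<in> ?K" by (rule span_base) (use v g in blast)
    ultimately show ?thesis by blast
  qed
  ultimately show ?thesis using C_simple by (auto simp: simple_subcoalgebra_def)
qed

lemma hit_faithful: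
  assumes f: "lin f" and "\<And>v. v \<in> V \<Longrightarrow> hit f v = 0" and c: "c \<in> C" shows "f c = 0"
proof -
  have "c \<in> span {hitl g v | g v. v \<in> V \<and> lin g}" using c C_coefficients by simp
  then show ?thesis
  proof (induction rule: span_induct_alt)
    case base
    show ?case by (rule lmap_zero[OF f])
  next
    case (step k x y)
    then obtain g v where x: "x = hitl g v" "v \<in> V" "lin g" by blast
    have "f x = g (hit f v)" using x lin_hitl[OF f] lin_hit[OF x(3)] by simp
    also have "\<dots> = 0" using assms(2)[OF x(2)] lmap_zero[OF x(3)] by simp
    finally show ?case using step lmap_add[OF f] lmap_scale[OF f] by simp
  qed
qed

lemma hit_surj:
  assumes "linear_on scale scale V T" "T ` V \<subseteq> V"
  obtains f where "lin f" "\<And>v. v \<in> V \<Longrightarrow> hit f v = T v"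
proof -
  have "\<exists>U\<in>{hit f | f. lin f}. \<forall>v\<in>V. U v = T v"
  proof (rule irreducible_operator_algebra[OF vector_space_axioms V_subspace finite_dim(1) _ V_nonzero _ _ _ _ _ _ assms])
    show "V \<subseteq> span B0" using finite_dim by simp
    show "\<exists>T\<in>{hit f | f. lin f}. T v = w" if "v \<in> V" "v \<noteq> 0" "w \<in> V" for v w
      using hit_transitive[OF that] by blast
    show "(\<lambda>x. T x + U x) \<in> {hit f | f. lin f}" if TU: "T \<in> {hit f | f. lin f}" "U \<in> {hit f | f. lin f}" for T U
    proof -
      obtain f g where fg: "T = hit f" "U = hit g" "lin f" "lin g" using TU by blast
      then have "lin (\<lambda>x. f x + g x)" by (simp add: lin_simps)
      then show ?thesis using fg hit_add by blast
    qed
    show "(\<lambda>x. scale c (T x)) \<in> {hit f | f. lin f}" if T: "T \<in> {hit f | f. lin f}" for T c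
    proof -
      obtain f where f: "T = hit f" "lin f" using T by blast
      then have "lin (\<lambda>x. c * f x)" by (simp add: lin_simps)
      then show ?thesis using f hit_scale by blast
    qed
    show "(\<lambda>x. T (U x)) \<in> {hit f | f. lin f}" if TU: "T \<in> {hit f | f. lin f}" "U \<in> {hit f | f. lin f}" for T U
    proof -
      obtain f g where fg: "T = hit f" "U = hit g" "lin f" "lin g" using TU by blast
      then have "lin (\<lambda>c. sw c (\<lambda>x y. g x * f y))" by (simp add: lin_simps)
      then show ?thesis using fg hit_hit[OF fg(4,3)] by blast
    qed
  qed (use endo_hit hit_V in auto)
  then show ?thesis using that by blast
qed

lemma dual_to_end_eq:
  assumes "f \<in> carrier D" "v \<in> V"
  shows "dual_to_end scale \<Delta> C V f v = hit (\<lambda>x. f (P x)) v"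
proof -
  have "lin_ext scale (\<lambda>(x, w). scale (f x) w) (tensor_restrict scale scale C V (\<Delta> v))
    = lin_ext scale (\<lambda>(x, w). scale (f (P x)) w) (\<Delta> v)"
    by (rule lin_ext_tensor_restrict[OF V_tensor_C[OF assms(2)] vector_space_axioms])
      (use carrier_lin[OF assms(1)] in \<open>auto simp: bilin_def lmap_iff scale_left_distrib scale_right_distrib P_id mult.commute\<close>)
  then show ?thesis using assms(2) by (simp add: dual_to_end_def coaction_def hit_def)
qed

lemma dual_to_end_off: "v \<notin> V \<Longrightarrow> dual_to_end scale \<Delta> C V f v = 0"
  by (simp add: dual_to_end_def)

lemma dual_to_end_res:
  assumes "lin f" "v \<in> V" shows "dual_to_end scale \<Delta> C V (res f) v = hit f v"
  unfolding dual_to_end_eq[OF res_carrier[OF assms(1)] assms(2)]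
  by (rule hit_cong_C[OF assms(2) carrier_lin[OF res_carrier[OF assms(1)]] assms(1)]) (simp add: res_def P_id)

lemma dual_to_end_closed:
  assumes "f \<in> carrier D" shows "dual_to_end scale \<Delta> C V f \<in> carrier (end_op scale V)"
proof -
  have "hit (\<lambda>x. f (P x)) (x + y) = hit (\<lambda>x. f (P x)) x + hit (\<lambda>x. f (P x)) y"
    "hit (\<lambda>x. f (P x)) (scale c x) = scale c (hit (\<lambda>x. f (P x)) x)" for x y c
    using endo_hit[OF carrier_lin[OF assms]] by (auto simp: lmap_iff)
  then show ?thesis
    using subspace_add[OF V_subspace] subspace_scale[OF V_subspace] hit_V[OF _ carrier_lin[OF assms]]
    by (auto simp: end_op_def linear_on_def dual_to_end_eq[OF assms] dual_to_end_off)
qed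

lemma dual_to_end_mult:
  assumes "f \<in> carrier D" "g \<in> carrier D"
  shows "dual_to_end scale \<Delta> C V (cmult f g) = dual_to_end scale \<Delta> C V g \<circ> dual_to_end scale \<Delta> C V f"
proof
  fix v
  show "dual_to_end scale \<Delta> C V (cmult f g) v = (dual_to_end scale \<Delta> C V g \<circ> dual_to_end scale \<Delta> C V f) v"
  proof (cases "v \<in> V")
    case True
    note l = assms[THEN carrier_lin]
    have l': "lin (\<lambda>c. sw c (\<lambda>x y. f (P x) * g (P y)))" using l by (simp add: lin_simps)
    show ?thesis
      using True hit_V[OF True l(1)]
      by (simp add: cmult_as_res[OF assms] dual_to_end_res[OF l'] dual_to_end_eq assms hit_hit l)
  next
    case False
    have "dual_to_end scale \<Delta> C V g 0 = 0"
      using dual_to_end_eq[OF assms(2) subspace_0[OF V_subspace]] lmap_zero[OF endo_hit[OF carrier_lin[OF assms(2)]]] by simp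
    with False show ?thesis by (simp add: dual_to_end_off)
  qed
qed

lemma dual_to_end_inj: "inj_on (dual_to_end scale \<Delta> C V) (carrier D)"
proof (rule inj_onI)
  fix f g assume fg: "f \<in> carrier D" "g \<in> carrier D" "dual_to_end scale \<Delta> C V f = dual_to_end scale \<Delta> C V g"
  have l: "lin (\<lambda>x. f (P x) + - 1 * g (P x))"
    using carrier_lin[OF fg(1)] carrier_lin[OF fg(2)] by (simp add: lmap_iff algebra_simps)
  have "hit (\<lambda>x. f (P x) + - 1 * g (P x)) v = 0" if "v \<in> V" for v
  proof -
    have "hit (\<lambda>x. f (P x) + - 1 * g (P x)) v = hit (\<lambda>x. f (P x)) v + scale (- 1) (hit (\<lambda>x. g (P x)) v)"
      by (simp only: hit_add hit_scale)
    then show ?thesis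
      using fun_cong[OF fg(3), of v] dual_to_end_eq[OF fg(1) that] dual_to_end_eq[OF fg(2) that] by simp
  qed
  from hit_faithful[OF l this] have "f c = g c" if "c \<in> C" for c using that by (force simp: P_id)
  then show "f = g" using fg carrier_off by (metis ext)
qed

lemma dual_to_end_iso: "dual_to_end scale \<Delta> C V \<in> algebra_iso D (end_op scale V)"
  unfolding algebra_iso_def algebra_hom_def
proof (intro CollectI conjI allI ballI ring_hom_memI)
  let ?I = "dual_to_end scale \<Delta> C V"
  show "?I f \<in> carrier (end_op scale V)" if "f \<in> carrier D" for f by (rule dual_to_end_closed[OF that])
  show "?I (f \<otimes>\<^bsub>D\<^esub> g) = ?I f \<otimes>\<^bsub>end_op scale V\<^esub> ?I g" if "f \<in> carrier D" "g \<in> carrier D" for f g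
    using that by (simp add: mult_D dual_to_end_mult end_op_def)
  show "?I (f \<oplus>\<^bsub>D\<^esub> g) = ?I f \<oplus>\<^bsub>end_op scale V\<^esub> ?I g" if fg: "f \<in> carrier D" "g \<in> carrier D" for f g
  proof
    fix v
    have fg': "f + g \<in> carrier D" using fg by (auto simp: carrier_D linear_on_def algebra_simps)
    show "?I (f \<oplus>\<^bsub>D\<^esub> g) v = (?I f \<oplus>\<^bsub>end_op scale V\<^esub> ?I g) v"
      by (cases "v \<in> V") (simp_all add: add_D end_op_def dual_to_end_eq fg fg' hit_add dual_to_end_off)
  qed
  show "?I \<one>\<^bsub>D\<^esub> = \<one>\<^bsub>end_op scale V\<^esub>"
  proof
    fix v show "?I \<one>\<^bsub>D\<^esub> v = \<one>\<^bsub>end_op scale V\<^esub> v"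
      by (cases "v \<in> V") (simp_all add: one_D end_op_def dual_to_end_res lin_counit hit_counit dual_to_end_off)
  qed
  show "?I (c \<odot>\<^bsub>D\<^esub> f) = c \<odot>\<^bsub>end_op scale V\<^esub> ?I f" if f: "f \<in> carrier D" for f c
  proof
    fix v
    have f': "fun_scale c f \<in> carrier D" using f by (auto simp: carrier_D linear_on_def fun_scale_def algebra_simps)
    show "?I (c \<odot>\<^bsub>D\<^esub> f) v = (c \<odot>\<^bsub>end_op scale V\<^esub> ?I f) v"
      by (cases "v \<in> V") (simp_all add: smult_D end_op_def dual_to_end_eq[OF f] dual_to_end_eq[OF f'] dual_to_end_off hit_scale,
        simp add: fun_scale_def)
  qed
  show "bij_betw ?I (carrier D) (carrier (end_op scale V))"
    unfolding bij_betw_def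
  proof (intro conjI dual_to_end_inj equalityI subsetI)
    fix T assume T: "T \<in> carrier (end_op scale V)"
    then obtain f where f: "lin f" "\<And>v. v \<in> V \<Longrightarrow> hit f v = T v"
      using hit_surj[of T] by (auto simp: end_op_def)
    have "T = ?I (res f)"
    proof
      fix v show "T v = ?I (res f) v"
        using T f by (cases "v \<in> V") (auto simp: dual_to_end_res dual_to_end_off end_op_def)
    qed
    then show "T \<in> ?I ` carrier D" using res_carrier[OF f(1)] by blast
  qed (use dual_to_end_closed in blast)
qed

end

section \<open>The map \<open>\<psi>\<close> and the twisted algebra\<close>

locale implemented_action = simple_coideal scale \<Delta> \<epsilon> S C V B0 P
  for scale :: "'k::alg_closed_field \<Rightarrow> 'h::ring_1 \<Rightarrow> 'h"
    and \<Delta> :: "'h \<Rightarrow> ('h \<times> 'h \<Rightarrow>\<^sub>0 'k)" and \<epsilon> :: "'h \<Rightarrow> 'k" and S :: "'h \<Rightarrow> 'h"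
    and C V B0 :: "'h set" and P :: "'h \<Rightarrow> 'h" +
  fixes A :: "'h set" and PA :: "'h \<Rightarrow> 'h" and \<psi> \<psi>' :: "'h \<Rightarrow> 'h \<Rightarrow> 'k"
  assumes A: "hopf_subalgebra scale \<Delta> S A" and ss: "semisimple_ring TYPE('h)"
    and CA: "c \<in> C \<Longrightarrow> a \<in> A \<Longrightarrow> c * a \<in> C"
    and endo_PA: "endo PA" and PA_in: "PA x \<in> A" and PA_id: "x \<in> A \<Longrightarrow> PA x = x"
    and impl: "implements_action scale \<Delta> \<epsilon> A C \<psi> \<psi>'"
begin

lemmas Ain = hopf_subalgebraD[OF A]

text \<open>\<open>\<psi>h\<close> and \<open>\<psi>h'\<close> extend \<psi> and \<psi>' linearly to
  \<open>H\<close>, so that they may occur in \<open>sw\<close>, whose legs are arbitrary elements.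
  In \<open>act\<close> the projection \<open>P\<close> plays this part for products that leave
  \<open>C\<close>.\<close>

definition \<psi>h where "\<psi>h x = \<psi> (PA x)"
definition \<psi>h' where "\<psi>h' x = \<psi>' (PA x)"
definition act where "act x f = (\<lambda>c. if c \<in> C then f (P (c * x)) else 0)"

lemma \<psi>_linear: "linear_on scale fun_scale A \<psi>" and \<psi>'_linear: "linear_on scale fun_scale A \<psi>'"
  and \<psi>_carrier: "a \<in> A \<Longrightarrow> \<psi> a \<in> carrier D" and \<psi>'_carrier: "a \<in> A \<Longrightarrow> \<psi>' a \<in> carrier D"
  and \<psi>_one: "\<psi> 1 = \<one>\<^bsub>D\<^esub>"
  using impl by (auto simp: implements_action_def Let_def)

lemma \<psi>h_carrier: "\<psi>h x \<in> carrier D" and \<psi>h'_carrier: "\<psi>h' x \<in> carrier D"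
  by (simp_all add: \<psi>h_def \<psi>h'_def \<psi>_carrier \<psi>'_carrier PA_in)

lemma \<psi>h_eq: "a \<in> A \<Longrightarrow> \<psi>h a = \<psi> a" and \<psi>h'_eq: "a \<in> A \<Longrightarrow> \<psi>h' a = \<psi>' a"
  by (simp_all add: \<psi>h_def \<psi>h'_def PA_id)

lemma \<psi>h_add: "\<psi>h (x + y) = (\<lambda>c. \<psi>h x c + \<psi>h y c)" "\<psi>h (scale k x) = (\<lambda>c. k * \<psi>h x c)"
  and \<psi>h'_add: "\<psi>h' (x + y) = (\<lambda>c. \<psi>h' x c + \<psi>h' y c)" "\<psi>h' (scale k x) = (\<lambda>c. k * \<psi>h' x c)"
  using \<psi>_linear \<psi>'_linear endo_PA PA_in
  by (auto simp: \<psi>h_def \<psi>h'_def linear_on_def fun_scale_def fun_eq_iff)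

lemma cmult_add: "cmult (\<lambda>c. f c + g c) h = (\<lambda>c. cmult f h c + cmult g h c)" "cmult h (\<lambda>c. f c + g c) = (\<lambda>c. cmult h f c + cmult h g c)"
  and cmult_scale: "cmult (\<lambda>c. k * f c) h = (\<lambda>c. k * cmult f h c)" "cmult h (\<lambda>c. k * f c) = (\<lambda>c. k * cmult h f c)"
proof -
  show "cmult (\<lambda>c. f c + g c) h = (\<lambda>c. cmult f h c + cmult g h c)" "cmult h (\<lambda>c. f c + g c) = (\<lambda>c. cmult h f c + cmult h g c)"
    by (auto simp: cmult_def distrib_left distrib_right sw_plus)
  have 1: "(k * f (P x)) * h (P y) = k * (f (P x) * h (P y))" "h (P x) * (k * f (P y)) = k * (h (P x) * f (P y))" for x y
    by (simp_all add: mult_ac)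
  show "cmult (\<lambda>c. k * f c) h = (\<lambda>c. k * cmult f h c)" "cmult h (\<lambda>c. k * f c) = (\<lambda>c. k * cmult h f c)"
    by (auto simp: cmult_def 1 sw_cmult)
qed

lemma act_carrier:
  assumes "f \<in> carrier D" shows "act x f \<in> carrier D"
proof -
  have "lin (\<lambda>c. f (P (c * x)))" using carrier_lin[OF assms] by (simp add: lin_simps)
  then have "res (\<lambda>c. f (P (c * x))) \<in> carrier D" by (rule res_carrier)
  then show ?thesis by (simp add: res_def act_def)
qed

lemma act_add:
  assumes "f \<in> carrier D"
  shows "act (x + y) f = (\<lambda>c. act x f c + act y f c)" "act (scale k x) f = (\<lambda>c. k * act x f c)"
  using carrier_lin[OF assms] by (auto simp: act_def lin_simps)

lemma act_act: "a \<in> A \<Longrightarrow> act a (act x f) = act (a * x) f"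
  by (auto simp: act_def CA P_id mult.assoc P_in)

lemmas \<psi>_simps = lin_simps \<psi>h_add \<psi>h'_add cmult_add cmult_scale act_add

lemma restrict_A:
  assumes "a \<in> A" "\<And>c. blin (\<lambda>x y. \<Psi> x y c)" "\<And>x y. x \<in> A \<Longrightarrow> y \<in> A \<Longrightarrow> G (x, y) = \<Psi> x y"
  shows "lin_ext fun_scale G (tensor_restrict scale scale A A (\<Delta> a)) = (\<lambda>c. sw a (\<lambda>x y. \<Psi> x y c))"
proof
  fix c
  show "lin_ext fun_scale G (tensor_restrict scale scale A A (\<Delta> a)) c = sw a (\<lambda>x y. \<Psi> x y c)"
    unfolding lin_ext_fun_scale sw_def
    by (rule lin_ext_tensor_restrict[OF Ain(2)[OF assms(1)] vector_space_times assms(2)]) (simp add: assms(3))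
qed

lemma conv_right: "a \<in> A \<Longrightarrow> (\<lambda>c. sw a (\<lambda>x y. cmult (\<psi>h x) (\<psi>h' y) c)) = (\<lambda>c. \<epsilon> a * \<one>\<^bsub>D\<^esub> c)"
  and conv_left: "a \<in> A \<Longrightarrow> (\<lambda>c. sw a (\<lambda>x y. cmult (\<psi>h' x) (\<psi>h y) c)) = (\<lambda>c. \<epsilon> a * \<one>\<^bsub>D\<^esub> c)"
  and action: "a \<in> A \<Longrightarrow> f \<in> carrier D \<Longrightarrow> act a f = (\<lambda>c. sw a (\<lambda>x y. cmult (cmult (\<psi>h x) f) (\<psi>h' y) c))"
proof -
  assume a: "a \<in> A"
  have "lin_ext fun_scale (\<lambda>(x, y). \<psi> x \<otimes>\<^bsub>D\<^esub> \<psi>' y) (tensor_restrict scale scale A A (\<Delta> a))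
      = (\<lambda>c. sw a (\<lambda>x y. cmult (\<psi>h x) (\<psi>h' y) c))"
    by (rule restrict_A[OF a]) (simp_all add: \<psi>_simps mult_D \<psi>_carrier \<psi>'_carrier \<psi>h_eq \<psi>h'_eq)
  then show "(\<lambda>c. sw a (\<lambda>x y. cmult (\<psi>h x) (\<psi>h' y) c)) = (\<lambda>c. \<epsilon> a * \<one>\<^bsub>D\<^esub> c)"
    using impl a by (simp add: implements_action_def Let_def fun_scale_def)
  have "lin_ext fun_scale (\<lambda>(x, y). \<psi>' x \<otimes>\<^bsub>D\<^esub> \<psi> y) (tensor_restrict scale scale A A (\<Delta> a))
      = (\<lambda>c. sw a (\<lambda>x y. cmult (\<psi>h' x) (\<psi>h y) c))"
    by (rule restrict_A[OF a]) (simp_all add: \<psi>_simps mult_D \<psi>_carrier \<psi>'_carrier \<psi>h_eq \<psi>h'_eq)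
  then show "(\<lambda>c. sw a (\<lambda>x y. cmult (\<psi>h' x) (\<psi>h y) c)) = (\<lambda>c. \<epsilon> a * \<one>\<^bsub>D\<^esub> c)"
    using impl a by (simp add: implements_action_def Let_def fun_scale_def)
  assume f: "f \<in> carrier D"
  have "lin_ext fun_scale (\<lambda>(x, y). \<psi> x \<otimes>\<^bsub>D\<^esub> f \<otimes>\<^bsub>D\<^esub> \<psi>' y) (tensor_restrict scale scale A A (\<Delta> a))
      = (\<lambda>c. sw a (\<lambda>x y. cmult (cmult (\<psi>h x) f) (\<psi>h' y) c))"
    by (rule restrict_A[OF a]) (simp_all add: \<psi>_simps mult_D \<psi>_carrier \<psi>'_carrier \<psi>h_eq \<psi>h'_eq f cmult_closed)
  moreover have "(\<lambda>c. if c \<in> C then f (c * a) else 0) = act a f"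
    using a by (auto simp: act_def CA P_id)
  moreover have "(\<lambda>c. if c \<in> C then f (c * a) else 0) =
      lin_ext fun_scale (\<lambda>(x, y). \<psi> x \<otimes>\<^bsub>D\<^esub> f \<otimes>\<^bsub>D\<^esub> \<psi>' y) (tensor_restrict scale scale A A (\<Delta> a))"
    using impl a f by (simp add: implements_action_def Let_def)
  ultimately show "act a f = (\<lambda>c. sw a (\<lambda>x y. cmult (cmult (\<psi>h x) f) (\<psi>h' y) c))" by metis
qed

lemmas closed = \<psi>h_carrier \<psi>h'_carrier cmult_closed act_carrier one_carrier

lemma cancel:
  assumes q: "q \<in> A" and g: "g \<in> carrier D"
  shows "sw q (\<lambda>v y. cmult (cmult g (\<psi>h' v)) (\<psi>h y) c) = \<epsilon> q * g c"
    "sw q (\<lambda>v y. cmult (cmult g (\<psi>h v)) (\<psi>h' y) c) = \<epsilon> q * g c"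
    "sw q (\<lambda>v y. cmult (\<psi>h v) (cmult (\<psi>h' y) g) c) = \<epsilon> q * g c"
    "sw q (\<lambda>v y. cmult (\<psi>h' v) (cmult (\<psi>h y) g) c) = \<epsilon> q * g c"
proof -
  have "sw q (\<lambda>v y. cmult (cmult g (\<psi>h' v)) (\<psi>h y) c) = cmult g (\<lambda>c. sw q (\<lambda>v y. cmult (\<psi>h' v) (\<psi>h y) c)) c"
    by (simp only: cmult_sw_right cmult_assoc closed g)
  then show "sw q (\<lambda>v y. cmult (cmult g (\<psi>h' v)) (\<psi>h y) c) = \<epsilon> q * g c"
    by (simp only: conv_left[OF q] cmult_scale cmult_one g)
  have "sw q (\<lambda>v y. cmult (cmult g (\<psi>h v)) (\<psi>h' y) c) = cmult g (\<lambda>c. sw q (\<lambda>v y. cmult (\<psi>h v) (\<psi>h' y) c)) c"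
    by (simp only: cmult_sw_right cmult_assoc closed g)
  then show "sw q (\<lambda>v y. cmult (cmult g (\<psi>h v)) (\<psi>h' y) c) = \<epsilon> q * g c"
    by (simp only: conv_right[OF q] cmult_scale cmult_one g)
  have "sw q (\<lambda>v y. cmult (\<psi>h v) (cmult (\<psi>h' y) g) c) = cmult (\<lambda>c. sw q (\<lambda>v y. cmult (\<psi>h v) (\<psi>h' y) c)) g c"
    by (simp only: cmult_sw_left cmult_assoc closed g)
  then show "sw q (\<lambda>v y. cmult (\<psi>h v) (cmult (\<psi>h' y) g) c) = \<epsilon> q * g c"
    by (simp only: conv_right[OF q] cmult_scale cmult_one g)
  have "sw q (\<lambda>v y. cmult (\<psi>h' v) (cmult (\<psi>h y) g) c) = cmult (\<lambda>c. sw q (\<lambda>v y. cmult (\<psi>h' v) (\<psi>h y) c)) g c"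
    by (simp only: cmult_sw_left cmult_assoc closed g)
  then show "sw q (\<lambda>v y. cmult (\<psi>h' v) (cmult (\<psi>h y) g) c) = \<epsilon> q * g c"
    by (simp only: conv_left[OF q] cmult_scale cmult_one g)
qed

text \<open>Insert \<psi>'(a2) \<psi>(a3) behind \<psi>(a1) f; since \<psi> implements the action,
  the first three factors are the transform of \<open>f\<close>.\<close>

lemma push_left:
  assumes a: "a \<in> A" and f: "f \<in> carrier D"
  shows "cmult (\<psi>h a) f = (\<lambda>c. sw a (\<lambda>x y. cmult (act x f) (\<psi>h y) c))"
proof
  fix c
  have "sw a (\<lambda>x y. cmult (act x f) (\<psi>h y) c)
      = sw a (\<lambda>p y. sw p (\<lambda>u v. cmult (cmult (cmult (\<psi>h u) f) (\<psi>h' v)) (\<psi>h y) c))"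
    by (rule sw_cong_sub[OF Ain(2)[OF a]]) (simp_all add: \<psi>_simps f action cmult_sw_left)
  also have "\<dots> = sw a (\<lambda>u q. sw q (\<lambda>v y. cmult (cmult (cmult (\<psi>h u) f) (\<psi>h' v)) (\<psi>h y) c))"
    by (rule sw_coassoc) (simp_all add: \<psi>_simps)
  also have "\<dots> = sw a (\<lambda>u q. \<epsilon> q * cmult (\<psi>h u) f c)"
    by (rule sw_cong_sub[OF Ain(2)[OF a]]) (simp_all add: \<psi>_simps cancel f closed)
  also have "\<dots> = cmult (\<psi>h a) f c"
    by (rule sw_counit_right) (simp add: \<psi>_simps)
  finally show "cmult (\<psi>h a) f c = sw a (\<lambda>x y. cmult (act x f) (\<psi>h y) c)" by simp
qed

text \<open>The companion rule: here \<psi>'(a1) \<psi>(a2) is inserted in front of f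
  \<psi>'(a3).\<close>

lemma push_right:
  assumes a: "a \<in> A" and f: "f \<in> carrier D"
  shows "cmult f (\<psi>h' a) = (\<lambda>c. sw a (\<lambda>x y. cmult (\<psi>h' x) (act y f) c))"
proof
  fix c
  have "sw a (\<lambda>x y. cmult (\<psi>h' x) (act y f) c)
      = sw a (\<lambda>x q. sw q (\<lambda>u v. cmult (\<psi>h' x) (cmult (\<psi>h u) (cmult f (\<psi>h' v))) c))"
    by (rule sw_cong_sub[OF Ain(2)[OF a]]) (simp_all add: \<psi>_simps f action cmult_sw_right cmult_assoc closed)
  also have "\<dots> = sw a (\<lambda>p v. sw p (\<lambda>x u. cmult (\<psi>h' x) (cmult (\<psi>h u) (cmult f (\<psi>h' v))) c))"
    by (rule sw_coassoc[symmetric]) (simp_all add: \<psi>_simps)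
  also have "\<dots> = sw a (\<lambda>p v. \<epsilon> p * cmult f (\<psi>h' v) c)"
    by (rule sw_cong_sub[OF Ain(2)[OF a]]) (simp_all add: \<psi>_simps cancel f closed)
  also have "\<dots> = cmult f (\<psi>h' a) c"
    by (rule sw_counit_left) (simp add: \<psi>_simps)
  finally show "cmult f (\<psi>h' a) c = sw a (\<lambda>x y. cmult (\<psi>h' x) (act y f) c)" by simp
qed

text \<open>The element of the dual of \<open>C\<close> from which \<alpha>(a, b) is read off once
  it is known to be scalar.\<close>

definition Z where "Z a b = (\<lambda>c. sw a (\<lambda>a1 a2. sw b (\<lambda>b1 b2. cmult (cmult (\<psi>h' (a1 * b1)) (\<psi>h a2)) (\<psi>h b2) c)))"

lemma sw_carrier:
  assumes "\<And>x y. \<Psi> x y \<in> carrier D" shows "(\<lambda>c. sw a (\<lambda>x y. \<Psi> x y c)) \<in> carrier D"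
  using assms by (auto simp: carrier_D linear_on_def sw_plus sw_cmult sw_zero)

lemma Z_carrier: "Z a b \<in> carrier D"
  unfolding Z_def by (intro sw_carrier closed)

text \<open>Passing \<open>f\<close> leftwards through \<psi>(b2) and \<psi>(a2) transforms it by a
  product of legs of \<open>a\<close> and \<open>b\<close>. Next to \<psi>' of the preceding legs
  this is \<open>push_right\<close> for the product \<open>p * q\<close>, read backwards, which
  brings the original \<open>f\<close> to the front.\<close>

lemma Z_central:
  assumes a: "a \<in> A" and b: "b \<in> A" and f: "f \<in> carrier D"
  shows "cmult (Z a b) f = cmult f (Z a b)"
proof
  fix c
  define G where "G a1 a2 a3 b1 b2 b3 = cmult (cmult (\<psi>h' (a1 * b1)) (act (a2 * b2) f)) (cmult (\<psi>h a3) (\<psi>h b3)) c"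
    for a1 a2 a3 b1 b2 b3
  have inner: "cmult (cmult (cmult (\<psi>h' w) (\<psi>h a2)) (\<psi>h b2)) f c =
      sw a2 (\<lambda>u v. sw b2 (\<lambda>x y. cmult (cmult (\<psi>h' w) (act (u * x) f)) (cmult (\<psi>h v) (\<psi>h y)) c))"
    if ab: "a2 \<in> A" "b2 \<in> A" for w a2 b2
  proof -
    have "cmult (cmult (cmult (\<psi>h' w) (\<psi>h a2)) (\<psi>h b2)) f c = cmult (\<psi>h' w) (cmult (\<psi>h a2) (cmult (\<psi>h b2) f)) c"
      by (simp only: cmult_assoc closed f)
    also have "\<dots> = sw b2 (\<lambda>x y. cmult (\<psi>h' w) (cmult (cmult (\<psi>h a2) (act x f)) (\<psi>h y)) c)"
      by (simp only: push_left[OF ab(2) f] cmult_sw_right cmult_assoc closed f)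
    also have "\<dots> = sw b2 (\<lambda>x y. sw a2 (\<lambda>u v. cmult (\<psi>h' w) (cmult (cmult (act u (act x f)) (\<psi>h v)) (\<psi>h y)) c))"
      by (simp only: push_left[OF ab(1) act_carrier[OF f]] cmult_sw_right cmult_sw_left)
    also have "\<dots> = sw a2 (\<lambda>u v. sw b2 (\<lambda>x y. cmult (\<psi>h' w) (cmult (cmult (act u (act x f)) (\<psi>h v)) (\<psi>h y)) c))"
      by (rule sw_swap)
    also have "\<dots> = sw a2 (\<lambda>u v. sw b2 (\<lambda>x y. cmult (cmult (\<psi>h' w) (act (u * x) f)) (cmult (\<psi>h v) (\<psi>h y)) c))"
      by (rule sw_cong_sub[OF Ain(2)[OF ab(1)]])
        (simp_all add: \<psi>_simps f act_act closed, simp_all add: cmult_assoc closed f)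
    finally show ?thesis .
  qed
  have "cmult (Z a b) f c = sw a (\<lambda>a1 a2. sw b (\<lambda>b1 b2. cmult (cmult (cmult (\<psi>h' (a1 * b1)) (\<psi>h a2)) (\<psi>h b2)) f c))"
    by (simp only: Z_def cmult_sw_left)
  also have "\<dots> = sw a (\<lambda>a1 a2. sw b (\<lambda>b1 b2. sw a2 (\<lambda>u v. sw b2 (\<lambda>x y. G a1 u v b1 x y))))"
    unfolding G_def
  proof (rule sw_cong_sub[OF Ain(2)[OF a]])
    fix a1 a2 assume a12: "a1 \<in> A" "a2 \<in> A"
    show "sw b (\<lambda>b1 b2. cmult (cmult (cmult (\<psi>h' (a1 * b1)) (\<psi>h a2)) (\<psi>h b2)) f c)
      = sw b (\<lambda>b1 b2. sw a2 (\<lambda>u v. sw b2 (\<lambda>x y. cmult (cmult (\<psi>h' (a1 * b1)) (act (u * x) f)) (cmult (\<psi>h v) (\<psi>h y)) c)))"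
      by (rule sw_cong_sub[OF Ain(2)[OF b]]) (simp_all add: \<psi>_simps f inner a12)
  qed (simp_all add: \<psi>_simps f)
  also have "\<dots> = sw a (\<lambda>p a3. sw b (\<lambda>q b3. sw p (\<lambda>a1 a2. sw q (\<lambda>b1 b2. G a1 a2 a3 b1 b2 b3))))"
    by (rule sw_coassoc_pair) (simp_all add: G_def \<psi>_simps f)
  also have "\<dots> = sw a (\<lambda>p a3. sw b (\<lambda>q b3. cmult (cmult f (\<psi>h' (p * q))) (cmult (\<psi>h a3) (\<psi>h b3)) c))"
  proof -
    have pq: "sw p (\<lambda>a1 a2. sw q (\<lambda>b1 b2. G a1 a2 a3 b1 b2 b3)) = cmult (cmult f (\<psi>h' (p * q))) (cmult (\<psi>h a3) (\<psi>h b3)) c"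
      if "p \<in> A" "q \<in> A" for p q a3 b3
    proof -
      have "sw p (\<lambda>a1 a2. sw q (\<lambda>b1 b2. G a1 a2 a3 b1 b2 b3))
        = sw (p * q) (\<lambda>x y. cmult (cmult (\<psi>h' x) (act y f)) (cmult (\<psi>h a3) (\<psi>h b3)) c)"
        unfolding G_def by (rule sw_mult[symmetric]) (simp add: \<psi>_simps f)
      also have "\<dots> = cmult (cmult f (\<psi>h' (p * q))) (cmult (\<psi>h a3) (\<psi>h b3)) c"
        by (simp only: push_right[OF Ain(4)[OF that] f] cmult_sw_left)
      finally show ?thesis .
    qed
    show ?thesis
    proof (rule sw_cong_sub[OF Ain(2)[OF a]])
      fix p a3 assume p: "p \<in> A"
      show "sw b (\<lambda>q b3. sw p (\<lambda>a1 a2. sw q (\<lambda>b1 b2. G a1 a2 a3 b1 b2 b3)))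
        = sw b (\<lambda>q b3. cmult (cmult f (\<psi>h' (p * q))) (cmult (\<psi>h a3) (\<psi>h b3)) c)"
        by (rule sw_cong_sub[OF Ain(2)[OF b]]) (simp_all add: pq p, simp_all add: G_def \<psi>_simps f)
    qed (simp_all add: G_def \<psi>_simps f)
  qed
  also have "\<dots> = cmult f (Z a b) c"
    by (simp only: Z_def cmult_sw_right cmult_assoc closed f)
  finally show "cmult (Z a b) f c = cmult f (Z a b) c" .
qed

lemma one_nonzero: "\<exists>c\<in>C. \<one>\<^bsub>D\<^esub> c \<noteq> 0"
proof (rule ccontr)
  assume "\<not> ?thesis"
  then have 0: "\<epsilon> c = 0" if "c \<in> C" for c using that by (auto simp: one_D res_def)
  obtain v where v: "v \<in> V" "v \<noteq> 0" using V_nonzero subspace_0[OF V_subspace] by blast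
  have "hit \<epsilon> v = hit (\<lambda>x. 0) v" by (rule hit_cong_C[OF v(1) lin_counit]) (simp_all add: 0 lmap_iff)
  then show False using v(2) by (simp add: hit_counit) (simp add: hit_def lin_ext_def case_prod_unfold)
qed

text \<open>Schur's lemma: \<open>z\<close> has an eigenvector \<open>u\<close> in \<open>V\<close>
  and commutes with the action, and the action carries \<open>u\<close> to every vector of
  \<open>V\<close>.\<close>

lemma central_scalar:
  assumes z: "z \<in> carrier D" and comm: "\<And>f. f \<in> carrier D \<Longrightarrow> cmult z f = cmult f z"
  shows "\<exists>s. z = (\<lambda>c. s * \<one>\<^bsub>D\<^esub> c)"
proof -
  note lz = carrier_lin[OF z]
  obtain v where v: "v \<in> V" "v \<noteq> 0" using V_nonzero subspace_0[OF V_subspace] by blast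
  have sp: "V \<subseteq> span B0" using finite_dim by simp
  have "\<exists>l u. u \<in> V \<and> u \<noteq> 0 \<and> hit (\<lambda>x. z (P x)) u = scale l u"
    by (rule eigenvector_exists[OF vector_space_axioms V_subspace finite_dim(1) sp endo_hit[OF lz] hit_V[OF _ lz] v])
      (assumption, blast)
  then obtain l u where u: "u \<in> V" "u \<noteq> 0" "hit (\<lambda>x. z (P x)) u = scale l u" by blast
  have comm': "hit f (hit (\<lambda>x. z (P x)) w) = hit (\<lambda>x. z (P x)) (hit f w)" if f: "lin f" and w: "w \<in> V" for f w
  proof -
    have "hit f (hit (\<lambda>x. z (P x)) w) = hit (\<lambda>c. sw c (\<lambda>x y. z (P x) * f y)) w" by (rule hit_hit[OF lz f])
    also have "\<dots> = hit (\<lambda>c. sw c (\<lambda>x y. f x * z (P y))) w"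
    proof (rule hit_cong_C[OF w])
      show "lin (\<lambda>c. sw c (\<lambda>x y. z (P x) * f y))" "lin (\<lambda>c. sw c (\<lambda>x y. f x * z (P y)))"
        using f lz by (simp_all add: lin_simps)
      fix c assume c: "c \<in> C"
      have "res (\<lambda>x. z (P x)) = z" by (rule carrier_res[OF z])
      then have "res (\<lambda>c. sw c (\<lambda>x y. z (P x) * f y)) = res (\<lambda>c. sw c (\<lambda>x y. f x * z (P y)))"
        using comm[OF res_carrier[OF f]] cmult_res[OF lz f] cmult_res[OF f lz] by simp
      from fun_cong[OF this, of c] show "sw c (\<lambda>x y. z (P x) * f y) = sw c (\<lambda>x y. f x * z (P y))"
        using c by (simp add: res_def)
    qed
    also have "\<dots> = hit (\<lambda>x. z (P x)) (hit f w)" by (rule hit_hit[OF f lz, symmetric])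
    finally show ?thesis .
  qed
  have l: "lin (\<lambda>x. z (P x) + - l * \<epsilon> x)" using lz by (simp add: lmap_iff counit_add counit_scale algebra_simps)
  have "hit (\<lambda>x. z (P x) + - l * \<epsilon> x) w = 0" if w: "w \<in> V" for w
  proof -
    obtain f where f: "lin f" "hit f u = w" using hit_transitive[OF u(1,2) w] by blast
    have "hit (\<lambda>x. z (P x)) w = scale l w"
      using comm'[OF f(1) u(1)] u(3) f(2) lmap_scale[OF endo_hit[OF f(1)]] by simp
    moreover have "hit (\<lambda>x. z (P x) + - l * \<epsilon> x) w = hit (\<lambda>x. z (P x)) w + scale (- l) (hit \<epsilon> w)"
      by (simp only: hit_add hit_scale)
    ultimately show ?thesis by (simp add: hit_counit)
  qed
  from hit_faithful[OF l this] have "z c = l * \<epsilon> c" if "c \<in> C" for c using that by (force simp: P_id)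
  then show ?thesis using carrier_off[OF z] by (intro exI[of _ l]) (auto simp: one_D res_def)
qed

lemma cocycle_scalar:
  assumes a: "a \<in> A" and b: "b \<in> A"
  shows "Z a b = (\<lambda>c. cocycle scale \<Delta> \<epsilon> A C \<psi> \<psi>' a b * \<one>\<^bsub>D\<^esub> c)"
proof -
  have inner: "lin_ext fun_scale (\<lambda>(b1, b2). \<psi>' (a1 * b1) \<otimes>\<^bsub>D\<^esub> \<psi> a2 \<otimes>\<^bsub>D\<^esub> \<psi> b2) (tensor_restrict scale scale A A (\<Delta> b))
    = (\<lambda>c. sw b (\<lambda>b1 b2. cmult (cmult (\<psi>h' (a1 * b1)) (\<psi>h a2)) (\<psi>h b2) c))" if "a1 \<in> A" "a2 \<in> A" for a1 a2
    by (rule restrict_A[OF b])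
      (use that in \<open>simp_all add: \<psi>_simps mult_D \<psi>_carrier \<psi>'_carrier \<psi>h_eq \<psi>h'_eq cmult_closed Ain\<close>)
  have outer: "lin_ext fun_scale (\<lambda>(a1, a2). lin_ext fun_scale (\<lambda>(b1, b2). \<psi>' (a1 * b1) \<otimes>\<^bsub>D\<^esub> \<psi> a2 \<otimes>\<^bsub>D\<^esub> \<psi> b2)
      (tensor_restrict scale scale A A (\<Delta> b))) (tensor_restrict scale scale A A (\<Delta> a)) = Z a b"
    unfolding Z_def by (rule restrict_A[OF a]) (simp_all add: \<psi>_simps inner)
  obtain s where s: "Z a b = (\<lambda>c. s * \<one>\<^bsub>D\<^esub> c)"
    using central_scalar[OF Z_carrier Z_central[OF a b]] by blast
  obtain c where c: "\<one>\<^bsub>D\<^esub> c \<noteq> 0" using one_nonzero by blast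
  have "cocycle scale \<Delta> \<epsilon> A C \<psi> \<psi>' a b = s"
    unfolding cocycle_def Let_def outer
  proof (rule the_equality)
    show "fun_scale s \<one>\<^bsub>D\<^esub> = Z a b" by (simp add: s fun_scale_def)
    fix s' assume "fun_scale s' \<one>\<^bsub>D\<^esub> = Z a b"
    then have "s' * \<one>\<^bsub>D\<^esub> c = s * \<one>\<^bsub>D\<^esub> c" by (metis s fun_scale_def)
    then show "s' = s" using c by simp
  qed
  then show ?thesis using s by simp
qed

abbreviation \<alpha> where "\<alpha> \<equiv> cocycle scale \<Delta> \<epsilon> A C \<psi> \<psi>'"
abbreviation A\<alpha> where "A\<alpha> \<equiv> crossed_product scale \<Delta> A \<alpha>"

lemma crossed_closed:
  assumes "a \<in> A" "b \<in> A" shows "a \<otimes>\<^bsub>A\<alpha>\<^esub> b \<in> A"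
  unfolding crossed_product_def lin_ext_def
  using tensor_restrict(1)[OF Ain(2)[OF assms(1)]] tensor_restrict(1)[OF Ain(2)[OF assms(2)]]
  by (auto intro!: subspace_sum[OF Ain(1)] subspace_scale[OF Ain(1)] Ain(4))

text \<open>\<alpha>(a2, b2) \<psi>(a1 b1) unfolds to \<psi>(a1 b1) \<psi>'(a2 b2) \<psi>(a3)
  \<psi>(b3), where the first two factors cancel by convolution.\<close>

lemma \<psi>_mult:
  assumes a: "a \<in> A" and b: "b \<in> A"
  shows "\<psi> (a \<otimes>\<^bsub>A\<alpha>\<^esub> b) = cmult (\<psi> a) (\<psi> b)"
proof
  fix c
  have l: "lin (\<lambda>x. \<psi>h x c)" by (simp add: \<psi>_simps)
  have Z': "blin (\<lambda>a2 b2. cmult f (Z a2 b2) c)" for f by (simp add: Z_def \<psi>_simps)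
  define F where "F a1 a2 b1 b2 = cmult (\<psi>h (a1 * b1)) (Z a2 b2) c" for a1 a2 b1 b2
  have F: "\<alpha> a2 b2 * \<psi>h (a1 * b1) c = F a1 a2 b1 b2" if "a2 \<in> A" "b2 \<in> A" for a1 a2 b1 b2
    by (simp add: F_def cocycle_scalar[OF that] cmult_scale cmult_one closed)
  have "\<psi> (a \<otimes>\<^bsub>A\<alpha>\<^esub> b) c = \<psi>h (a \<otimes>\<^bsub>A\<alpha>\<^esub> b) c"
    by (simp add: \<psi>h_eq crossed_closed a b)
  also have "\<dots> = lin_ext (*) (\<lambda>(a1, a2). lin_ext (*) (\<lambda>(b1, b2). \<alpha> a2 b2 * \<psi>h (a1 * b1) c)
      (tensor_restrict scale scale A A (\<Delta> b))) (tensor_restrict scale scale A A (\<Delta> a))"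
    by (simp add: crossed_product_def lmap_of_lin_ext[OF l] case_prod_unfold lmap_scale[OF l])
  also have "\<dots> = lin_ext (*) (\<lambda>(a1, a2). sw b (\<lambda>b1 b2. F a1 a2 b1 b2)) (\<Delta> a)"
  proof (rule lin_ext_tensor_restrict[OF Ain(2)[OF a] vector_space_times])
    show "blin (\<lambda>a1 a2. sw b (F a1 a2))" by (simp add: F_def[abs_def] Z_def \<psi>_simps)
    fix a1 a2 assume "a1 \<in> A" "a2 \<in> A"
    then have "lin_ext (*) (\<lambda>(b1, b2). \<alpha> a2 b2 * \<psi>h (a1 * b1) c) (tensor_restrict scale scale A A (\<Delta> b))
      = lin_ext (*) (\<lambda>(b1, b2). F a1 a2 b1 b2) (\<Delta> b)"
      by (intro lin_ext_tensor_restrict[OF Ain(2)[OF b] vector_space_times])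
        (simp_all add: F, simp add: F_def[abs_def] Z_def \<psi>_simps)
    then show "(case (a1, a2) of (a1, a2) \<Rightarrow> lin_ext (*) (\<lambda>(b1, b2). \<alpha> a2 b2 * \<psi>h (a1 * b1) c)
        (tensor_restrict scale scale A A (\<Delta> b))) = sw b (F a1 a2)" by (simp add: sw_def)
  qed
  also have "\<dots> = sw a (\<lambda>a1 a2. sw b (\<lambda>b1 b2. sw a2 (\<lambda>u v. sw b2 (\<lambda>x y.
      cmult (\<psi>h (a1 * b1)) (cmult (\<psi>h' (u * x)) (cmult (\<psi>h v) (\<psi>h y))) c))))"
    unfolding sw_def[symmetric] F_def Z_def by (simp only: cmult_sw_right cmult_assoc closed)
  also have "\<dots> = sw a (\<lambda>p v. sw b (\<lambda>q y. sw p (\<lambda>a1 u. sw q (\<lambda>b1 x.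
      cmult (\<psi>h (a1 * b1)) (cmult (\<psi>h' (u * x)) (cmult (\<psi>h v) (\<psi>h y))) c))))"
    by (rule sw_coassoc_pair) (simp_all add: \<psi>_simps)
  also have "\<dots> = sw a (\<lambda>p v. sw b (\<lambda>q y. \<epsilon> p * (\<epsilon> q * cmult (\<psi>h v) (\<psi>h y) c)))"
  proof -
    have pq: "sw p (\<lambda>a1 u. sw q (\<lambda>b1 x. cmult (\<psi>h (a1 * b1)) (cmult (\<psi>h' (u * x)) g) c)) = \<epsilon> p * (\<epsilon> q * g c)"
      if "p \<in> A" "q \<in> A" "g \<in> carrier D" for p q g
    proof -
      have "sw p (\<lambda>a1 u. sw q (\<lambda>b1 x. cmult (\<psi>h (a1 * b1)) (cmult (\<psi>h' (u * x)) g) c))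
        = sw (p * q) (\<lambda>r t. cmult (\<psi>h r) (cmult (\<psi>h' t) g) c)"
        by (rule sw_mult[symmetric]) (simp add: \<psi>_simps)
      then show ?thesis using cancel(3)[OF Ain(4)[OF that(1,2)] that(3)] by (simp add: counit_mult)
    qed
    show ?thesis
    proof (rule sw_cong_sub[OF Ain(2)[OF a]])
      fix p v assume p: "p \<in> A"
      show "sw b (\<lambda>q y. sw p (\<lambda>a1 u. sw q (\<lambda>b1 x. cmult (\<psi>h (a1 * b1)) (cmult (\<psi>h' (u * x)) (cmult (\<psi>h v) (\<psi>h y))) c)))
        = sw b (\<lambda>q y. \<epsilon> p * (\<epsilon> q * cmult (\<psi>h v) (\<psi>h y) c))"
        by (rule sw_cong_sub[OF Ain(2)[OF b]]) (simp_all add: pq p closed, simp_all add: \<psi>_simps)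
    qed (simp_all add: \<psi>_simps)
  qed
  also have "\<dots> = sw a (\<lambda>p v. \<epsilon> p * cmult (\<psi>h v) (\<psi>h b) c)"
    by (simp only: sw_cmult) (subst sw_counit_left, simp_all add: \<psi>_simps)
  also have "\<dots> = cmult (\<psi>h a) (\<psi>h b) c"
    by (rule sw_counit_left) (simp add: \<psi>_simps)
  finally show "\<psi> (a \<otimes>\<^bsub>A\<alpha>\<^esub> b) c = cmult (\<psi> a) (\<psi> b) c" using a b by (simp add: \<psi>h_eq)
qed

lemma \<psi>_hom: "\<psi> \<in> algebra_hom A\<alpha> D"
  unfolding algebra_hom_def
proof (intro CollectI conjI allI ballI ring_hom_memI)
  show "\<psi> (a \<otimes>\<^bsub>A\<alpha>\<^esub> b) = \<psi> a \<otimes>\<^bsub>D\<^esub> \<psi> b" if "a \<in> carrier A\<alpha>" "b \<in> carrier A\<alpha>" for a b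
  proof -
    have ab: "a \<in> A" "b \<in> A" using that by (simp_all add: crossed_product_def)
    show ?thesis unfolding \<psi>_mult[OF ab] mult_D[OF \<psi>_carrier[OF ab(1)] \<psi>_carrier[OF ab(2)]] ..
  qed
qed (use \<psi>_linear in \<open>auto simp: crossed_product_def \<psi>_carrier \<psi>_one add_D smult_D linear_on_def\<close>)

end

lemma inverse_algebra_iso:
  assumes \<theta>: "\<theta> \<in> algebra_hom R N" and bij: "bij_betw \<theta> (carrier R) K"
    and R: "\<And>x y. x \<in> carrier R \<Longrightarrow> y \<in> carrier R \<Longrightarrow> x \<otimes>\<^bsub>R\<^esub> y \<in> carrier R"
      "\<And>x y. x \<in> carrier R \<Longrightarrow> y \<in> carrier R \<Longrightarrow> x \<oplus>\<^bsub>R\<^esub> y \<in> carrier R"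
      "\<And>c x. x \<in> carrier R \<Longrightarrow> c \<odot>\<^bsub>R\<^esub> x \<in> carrier R" "\<one>\<^bsub>R\<^esub> \<in> carrier R"
  shows "inv_into (carrier R) \<theta> \<in> algebra_iso (N\<lparr>carrier := K\<rparr>) R"
proof -
  let ?\<Phi> = "inv_into (carrier R) \<theta>"
  have hom: "\<theta> \<in> ring_hom R N" and sm: "\<And>c x. x \<in> carrier R \<Longrightarrow> \<theta> (c \<odot>\<^bsub>R\<^esub> x) = c \<odot>\<^bsub>N\<^esub> \<theta> x"
    using \<theta> by (auto simp: algebra_hom_def)
  have inv: "?\<Phi> (\<theta> x) = x" if "x \<in> carrier R" for x using bij that by (simp add: bij_betw_def)
  have K: "\<exists>x\<in>carrier R. y = \<theta> x" if "y \<in> K" for y using bij that by (auto simp: bij_betw_def)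
  have "bij_betw ?\<Phi> K (carrier R)" by (rule bij_betw_inv_into[OF bij])
  moreover have "?\<Phi> \<in> ring_hom (N\<lparr>carrier := K\<rparr>) R"
  proof (rule ring_hom_memI)
    show "?\<Phi> y \<in> carrier R" if "y \<in> carrier (N\<lparr>carrier := K\<rparr>)" for y
      using K[of y] that inv by auto
    fix y z assume "y \<in> carrier (N\<lparr>carrier := K\<rparr>)" "z \<in> carrier (N\<lparr>carrier := K\<rparr>)"
    then obtain a b where ab: "a \<in> carrier R" "b \<in> carrier R" "y = \<theta> a" "z = \<theta> b"
      using K[of y] K[of z] by auto
    show "?\<Phi> (y \<otimes>\<^bsub>N\<lparr>carrier := K\<rparr>\<^esub> z) = ?\<Phi> y \<otimes>\<^bsub>R\<^esub> ?\<Phi> z"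
      using ab R inv by (simp flip: ring_hom_mult[OF hom])
    show "?\<Phi> (y \<oplus>\<^bsub>N\<lparr>carrier := K\<rparr>\<^esub> z) = ?\<Phi> y \<oplus>\<^bsub>R\<^esub> ?\<Phi> z"
      using ab R inv by (simp flip: ring_hom_add[OF hom])
  next
    show "?\<Phi> \<one>\<^bsub>N\<lparr>carrier := K\<rparr>\<^esub> = \<one>\<^bsub>R\<^esub>"
      using R(4) inv by (simp flip: ring_hom_one[OF hom])
  qed
  moreover have "?\<Phi> (c \<odot>\<^bsub>N\<lparr>carrier := K\<rparr>\<^esub> y) = c \<odot>\<^bsub>R\<^esub> ?\<Phi> y" if y: "y \<in> K" for c y
  proof -
    obtain a where "a \<in> carrier R" "y = \<theta> a" using K[OF y] by auto
    then show ?thesis using R inv by (simp flip: sm)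
  qed
  ultimately show ?thesis by (simp add: algebra_iso_def algebra_hom_def)
qed

section \<open>Injectivity of \<psi> and the mutual centralizers\<close>

context implemented_action
begin

lemma \<psi>h_P: "\<psi>h x (P (u + v)) = \<psi>h x (P u) + \<psi>h x (P v)" "\<psi>h x (P (scale k u)) = k * \<psi>h x (P u)"
  and \<psi>h'_P: "\<psi>h' x (P (u + v)) = \<psi>h' x (P u) + \<psi>h' x (P v)" "\<psi>h' x (P (scale k u)) = k * \<psi>h' x (P u)"
  using carrier_lin[OF \<psi>h_carrier] carrier_lin[OF \<psi>h'_carrier] by (auto simp: lmap_iff)

lemma P_add: "P (u + v) = P u + P v" and P_scale: "P (scale k u) = scale k (P u)"
  using endo_P by (auto simp: lmap_iff)

lemmas P_simps = \<psi>_simps \<psi>h_P \<psi>h'_P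

lemma cmult_eval: "c \<in> C \<Longrightarrow> cmult f g c = sw c (\<lambda>x y. f (P x) * g (P y))"
  by (simp add: cmult_def)

lemma act_res: "act x (res g) (P z) = g (P (P z * x))"
  by (simp add: act_def res_def P_in)

text \<open>From \<psi>(a) = 0 and \<open>push_left\<close> follows g(c1 a1) \<psi>(a2)(c2) = 0 for
  all \<open>g\<close>. The antipode of a further leg of \<open>c\<close> removes c1, so a1
  \<otimes> \<psi>(a2) = 0, and convolution with \<psi>' returns a \<otimes> 1 = 0.\<close>

lemma \<psi>_faithful:
  assumes a: "a \<in> A" and 0: "\<And>c. \<psi> a c = 0"
  shows "a = 0"
proof -
  have E1: "sw a (\<lambda>x y. sw c (\<lambda>c1 c2. g (c1 * x) * \<psi>h y (P c2))) = 0" if g: "lin g" and c: "c \<in> C" for g c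
  proof -
    note g' = g[unfolded lmap_iff]
    have "0 = cmult (\<psi>h a) (res g) c" by (simp add: cmult_def \<psi>h_eq a 0 sw_zero)
    also have "\<dots> = sw a (\<lambda>x y. cmult (act x (res g)) (\<psi>h y) c)" by (simp only: push_left[OF a res_carrier[OF g]])
    also have "\<dots> = sw a (\<lambda>x y. sw c (\<lambda>c1 c2. g (c1 * x) * \<psi>h y (P c2)))"
    proof (rule sw_cong_sub[OF Ain(2)[OF a]])
      fix x y assume x: "x \<in> A"
      show "cmult (act x (res g)) (\<psi>h y) c = sw c (\<lambda>c1 c2. g (c1 * x) * \<psi>h y (P c2))"
        unfolding cmult_eval[OF c] act_res
      proof (rule sw_cong_sub[OF C_tensor[OF c]])
        have "lin (\<lambda>z. g (P (P z * x)))" using g' by (simp add: lin_simps P_add P_scale)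
        then show "blin (\<lambda>c1 c2. g (P (P c1 * x)) * \<psi>h y (P c2))" "blin (\<lambda>c1 c2. g (c1 * x) * \<psi>h y (P c2))"
          using g' by (simp_all add: P_simps)
      qed (simp add: P_id CA x)
    qed (use g' res_carrier[OF g] in \<open>simp_all add: P_simps\<close>)
    finally show ?thesis by simp
  qed
  have E2: "sw a (\<lambda>x y. f x * \<psi>h y c) = 0" if f: "lin f" and c: "c \<in> C" for f c
  proof -
    note f' = f[unfolded lmap_iff]
    have anti: "sw w (\<lambda>c0 c1. f (S c0 * (c1 * x)) * k) = \<epsilon> w * (f x * k)" for w x k
      using sw_antipode_left[of "\<lambda>z. f (z * x) * k" w] f' by (simp add: lin_simps)
    have "0 = sw c (\<lambda>c0 r. sw a (\<lambda>x y. sw r (\<lambda>c1 c2. f (S c0 * (c1 * x)) * \<psi>h y (P c2))))"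
    proof -
      have "sw c (\<lambda>c0 r. sw a (\<lambda>x y. sw r (\<lambda>c1 c2. f (S c0 * (c1 * x)) * \<psi>h y (P c2)))) = sw c (\<lambda>c0 r. 0)"
        by (rule sw_cong_sub[OF C_tensor[OF c]])
          (use f' E1[of "\<lambda>z. f (S x * z)" for x] in \<open>simp_all add: P_simps\<close>)
      then show ?thesis by (simp add: sw_zero)
    qed
    also have "\<dots> = sw a (\<lambda>x y. sw c (\<lambda>c0 r. sw r (\<lambda>c1 c2. f (S c0 * (c1 * x)) * \<psi>h y (P c2))))"
      by (rule sw_swap)
    also have "\<dots> = sw a (\<lambda>x y. sw c (\<lambda>w c2. sw w (\<lambda>c0 c1. f (S c0 * (c1 * x)) * \<psi>h y (P c2))))"
      by (intro sw_cong sw_coassoc[symmetric]) (use f' in \<open>simp_all add: P_simps\<close>)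
    also have "\<dots> = sw a (\<lambda>x y. sw c (\<lambda>w c2. \<epsilon> w * (f x * \<psi>h y (P c2))))"
      by (simp only: anti)
    also have "\<dots> = sw a (\<lambda>x y. f x * \<psi>h y (P c))"
      by (intro sw_cong sw_counit_left) (use f' in \<open>simp add: P_simps\<close>)
    finally show ?thesis by (simp add: P_id c)
  qed
  obtain c where c: "c \<in> C" "\<one>\<^bsub>D\<^esub> c \<noteq> 0" using one_nonzero by blast
  show ?thesis
  proof (rule zero_if_functionals)
    fix f assume f: "lin f"
    note f' = f[unfolded lmap_iff]
    have "f a * \<one>\<^bsub>D\<^esub> c = sw a (\<lambda>x q. f x * (\<epsilon> q * \<one>\<^bsub>D\<^esub> c))"
      using sw_counit_right[of "\<lambda>x. f x * \<one>\<^bsub>D\<^esub> c" a] f' by (simp add: lin_simps mult_ac)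
    also have "\<dots> = sw a (\<lambda>x q. sw q (\<lambda>y z. f x * cmult (\<psi>h' y) (\<psi>h z) c))"
      by (rule sw_cong_sub[OF Ain(2)[OF a]])
        (use f' in \<open>simp_all add: P_simps fun_cong[OF conv_left]\<close>)
    also have "\<dots> = sw a (\<lambda>p z. sw p (\<lambda>x y. f x * cmult (\<psi>h' y) (\<psi>h z) c))"
      by (rule sw_coassoc[symmetric]) (use f' in \<open>simp_all add: P_simps\<close>)
    also have "\<dots> = sw a (\<lambda>p z. sw p (\<lambda>x y. sw c (\<lambda>c1 c2. f x * \<psi>h' y (P c1) * \<psi>h z (P c2))))"
      by (simp add: cmult_eval c sw_cmult mult.assoc)
    also have "\<dots> = sw a (\<lambda>p z. sw c (\<lambda>c1 c2. sw p (\<lambda>x y. f x * \<psi>h' y (P c1) * \<psi>h z (P c2))))"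
      by (intro sw_cong sw_swap)
    also have "\<dots> = sw c (\<lambda>c1 c2. sw a (\<lambda>p z. sw p (\<lambda>x y. f x * \<psi>h' y (P c1)) * \<psi>h z (P c2)))"
      by (subst sw_swap) (simp only: sw_multc)
    also have "\<dots> = 0"
    proof -
      have "lin (\<lambda>p. sw p (\<lambda>x y. f x * \<psi>h' y (P c1)))" for c1 using f' by (simp add: P_simps)
      from E2[OF this P_in] show ?thesis by (simp add: sw_zero)
    qed
    finally show "f a = 0" using c by simp
  qed
qed

lemma \<psi>_inj: "inj_on \<psi> A"
proof (rule inj_onI)
  fix a b assume ab: "a \<in> A" "b \<in> A" "\<psi> a = \<psi> b"
  have d: "a + scale (- 1) b \<in> A" using ab Ain(1) by (intro subspace_add subspace_scale)
  have "\<psi> (a + scale (- 1) b) c = 0" for c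
    using ab by (simp add: \<psi>h_add \<psi>h_eq flip: \<psi>h_eq[OF d] del: scale_minus_left)
  from \<psi>_faithful[OF d this] show "a = b" by simp
qed

text \<open>Now \<open>push_right\<close> gives \<psi>'(a1)(c1) g(c2 a2) = 0, and the leg c3 that
  should cancel c2 comes after it. So the antipode is applied first: S(c2 a2) c3 collapses to S(a2).
  Injectivity of the antipode on \<open>A\<close>, a consequence of the integral, then removes
  it.\<close>

lemma \<psi>'_faithful:
  assumes a: "a \<in> A" and 0: "\<And>c. \<psi>' a c = 0"
  shows "a = 0"
proof -
  obtain e where e: "left_integral A e" "\<epsilon> e = 1" using normalised_integral_exists[OF ss A] by blast
  have e0: "e \<noteq> 0" using e(2) lmap_zero[OF lin_counit] by auto
  have E1: "sw a (\<lambda>x y. sw c (\<lambda>c1 c2. \<psi>h' x (P c1) * g (c2 * y))) = 0" if g: "lin g" and c: "c \<in> C" for g c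
  proof -
    note g' = g[unfolded lmap_iff]
    have "0 = cmult (res g) (\<psi>h' a) c" by (simp add: cmult_def \<psi>h'_eq a 0 sw_zero)
    also have "\<dots> = sw a (\<lambda>x y. cmult (\<psi>h' x) (act y (res g)) c)" by (simp only: push_right[OF a res_carrier[OF g]])
    also have "\<dots> = sw a (\<lambda>x y. sw c (\<lambda>c1 c2. \<psi>h' x (P c1) * g (c2 * y)))"
    proof (rule sw_cong_sub[OF Ain(2)[OF a]])
      fix x y assume y: "y \<in> A"
      show "cmult (\<psi>h' x) (act y (res g)) c = sw c (\<lambda>c1 c2. \<psi>h' x (P c1) * g (c2 * y))"
        unfolding cmult_eval[OF c] act_res
      proof (rule sw_cong_sub[OF C_tensor[OF c]])
        have "lin (\<lambda>z. g (P (P z * y)))" using g' by (simp add: lin_simps P_add P_scale)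
        then show "blin (\<lambda>c1 c2. \<psi>h' x (P c1) * g (P (P c2 * y)))" "blin (\<lambda>c1 c2. \<psi>h' x (P c1) * g (c2 * y))"
          using g' by (simp_all add: P_simps)
      qed (simp add: P_id CA y)
    qed (use g' res_carrier[OF g] in \<open>simp_all add: P_simps\<close>)
    finally show ?thesis by simp
  qed
  have l: "lin (\<lambda>x. \<psi>h' x c)" for c by (simp add: \<psi>_simps)
  have E2: "sw a (\<lambda>x y. \<psi>h' x c * f y) = 0" if f: "lin f" and c: "c \<in> C" for f c
  proof -
    have "S (hit (\<lambda>x. \<psi>h' x c) a) = 0"
    proof (rule zero_if_functionals)
      fix f assume f: "lin f"
      note f' = f[unfolded lmap_iff]
      have fS: "lin (\<lambda>y. f (S y))" using f' by (simp add: lin_simps)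
      have anti: "sw q (\<lambda>c2 w. k * f (S y * (S c2 * w))) = \<epsilon> q * (k * f (S y))" for q y k
        using sw_antipode_left[of "\<lambda>z. k * f (S y * z)" q] f' by (simp add: lin_simps)
      have "0 = sw c (\<lambda>r w. sw a (\<lambda>x y. sw r (\<lambda>c1 c2. \<psi>h' x (P c1) * f (S (c2 * y) * w))))"
      proof -
        have "sw c (\<lambda>r w. sw a (\<lambda>x y. sw r (\<lambda>c1 c2. \<psi>h' x (P c1) * f (S (c2 * y) * w)))) = sw c (\<lambda>r w. 0)"
        proof (rule sw_cong_sub[OF C_tensor[OF c]])
          fix r w assume "r \<in> C"
          have "lin (\<lambda>z. f (S z * w))" using f' by (simp add: lin_simps)
          from E1[OF this \<open>r \<in> C\<close>]
          show "sw a (\<lambda>x y. sw r (\<lambda>c1 c2. \<psi>h' x (P c1) * f (S (c2 * y) * w))) = 0" .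
        qed (use f' in \<open>simp_all add: P_simps\<close>)
        then show ?thesis by (simp add: sw_zero)
      qed
      also have "\<dots> = sw a (\<lambda>x y. sw c (\<lambda>r w. sw r (\<lambda>c1 c2. \<psi>h' x (P c1) * f (S (c2 * y) * w))))"
        by (rule sw_swap)
      also have "\<dots> = sw a (\<lambda>x y. sw c (\<lambda>c1 q. sw q (\<lambda>c2 w. \<psi>h' x (P c1) * f (S (c2 * y) * w))))"
        by (intro sw_cong sw_coassoc) (use f' in \<open>simp_all add: P_simps\<close>)
      also have "\<dots> = sw a (\<lambda>x y. sw c (\<lambda>c1 q. \<epsilon> q * (\<psi>h' x (P c1) * f (S y))))"
        by (simp only: antipode_mult mult.assoc anti)
      also have "\<dots> = sw a (\<lambda>x y. \<psi>h' x (P c) * f (S y))"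
        by (intro sw_cong sw_counit_right) (use f' in \<open>simp add: P_simps\<close>)
      also have "\<dots> = f (S (hit (\<lambda>x. \<psi>h' x c) a))"
        using lin_hit[OF fS] by (simp add: P_id c)
      finally show "f (S (hit (\<lambda>x. \<psi>h' x c) a)) = 0" by simp
    qed
    then have "hit (\<lambda>x. \<psi>h' x c) a = 0"
      using integral_antipode_inj[OF A e(1) e0 hit_mem[OF Ain(2)[OF a] Ain(1) l]] by blast
    then show ?thesis using lin_hit[OF f, of "\<lambda>x. \<psi>h' x c" a] lmap_zero[OF f] by simp
  qed
  obtain c where c: "c \<in> C" "\<one>\<^bsub>D\<^esub> c \<noteq> 0" using one_nonzero by blast
  show ?thesis
  proof (rule zero_if_functionals)
    fix f assume f: "lin f"
    note f' = f[unfolded lmap_iff]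
    have "\<one>\<^bsub>D\<^esub> c * f a = sw a (\<lambda>p z. \<epsilon> p * \<one>\<^bsub>D\<^esub> c * f z)"
      using sw_counit_left[of "\<lambda>x. \<one>\<^bsub>D\<^esub> c * f x" a] f' by (simp add: lin_simps)
    also have "\<dots> = sw a (\<lambda>p z. sw p (\<lambda>x y. cmult (\<psi>h' x) (\<psi>h y) c * f z))"
      by (rule sw_cong_sub[OF Ain(2)[OF a]])
        (use f' in \<open>simp_all add: P_simps fun_cong[OF conv_left]\<close>)
    also have "\<dots> = sw a (\<lambda>x q. sw q (\<lambda>y z. cmult (\<psi>h' x) (\<psi>h y) c * f z))"
      by (rule sw_coassoc) (use f' in \<open>simp_all add: P_simps\<close>)
    also have "\<dots> = sw a (\<lambda>x q. sw q (\<lambda>y z. sw c (\<lambda>c1 c2. \<psi>h' x (P c1) * (\<psi>h y (P c2) * f z))))"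
      by (simp add: cmult_eval c sw_multc[symmetric] mult.assoc)
    also have "\<dots> = sw a (\<lambda>x q. sw c (\<lambda>c1 c2. sw q (\<lambda>y z. \<psi>h' x (P c1) * (\<psi>h y (P c2) * f z))))"
      by (intro sw_cong sw_swap)
    also have "\<dots> = sw c (\<lambda>c1 c2. sw a (\<lambda>x q. \<psi>h' x (P c1) * sw q (\<lambda>y z. \<psi>h y (P c2) * f z)))"
      by (subst sw_swap) (simp only: sw_cmult)
    also have "\<dots> = 0"
    proof -
      have "lin (\<lambda>q. sw q (\<lambda>y z. \<psi>h y (P c2) * f z))" for c2 using f' by (simp add: P_simps)
      from E2[OF this P_in] show ?thesis by (simp add: sw_zero)
    qed
    finally show "f a = 0" using c by simp
  qed
qed

definition invariants where "invariants = {f \<in> carrier D. \<forall>a\<in>A. act a f = (\<lambda>c. \<epsilon> a * f c)}"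

text \<open>If \<open>f\<close> commutes with \<psi>(A), then a.f = f \<psi>(a1) \<psi>'(a2) =
  \<epsilon>(a) f. Conversely \<open>push_left\<close> with a1.f = \<epsilon>(a1) f gives
  commutation.\<close>

lemma centralizer_\<psi>: "centralizer D (\<psi> ` A) = invariants"
proof (intro equalityI subsetI)
  fix f assume "f \<in> centralizer D (\<psi> ` A)"
  then have f: "f \<in> carrier D" and comm: "\<And>a. a \<in> A \<Longrightarrow> cmult f (\<psi>h a) = cmult (\<psi>h a) f"
    by (auto simp: centralizer_def mult_D \<psi>_carrier \<psi>h_eq)
  have "act a f c = \<epsilon> a * f c" if a: "a \<in> A" for a c
  proof -
    have "act a f c = sw a (\<lambda>x y. cmult (cmult f (\<psi>h x)) (\<psi>h' y) c)"
      unfolding action[OF a f]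
      by (rule sw_cong_sub[OF Ain(2)[OF a]]) (simp_all add: comm, simp_all add: \<psi>_simps)
    then show ?thesis using cancel(2)[OF a f] by simp
  qed
  then show "f \<in> invariants" using f by (auto simp: invariants_def)
next
  fix f assume "f \<in> invariants"
  then have f: "f \<in> carrier D" and inv: "\<And>a. a \<in> A \<Longrightarrow> act a f = (\<lambda>c. \<epsilon> a * f c)"
    by (auto simp: invariants_def)
  have "cmult (\<psi>h a) f c = cmult f (\<psi>h a) c" if a: "a \<in> A" for a c
  proof -
    have "cmult (\<psi>h a) f c = sw a (\<lambda>x y. \<epsilon> x * cmult f (\<psi>h y) c)"
      unfolding push_left[OF a f]
      by (rule sw_cong_sub[OF Ain(2)[OF a]]) (simp_all add: \<psi>_simps f, simp add: inv cmult_scale)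
    also have "\<dots> = cmult f (\<psi>h a) c" by (rule sw_counit_left) (simp add: \<psi>_simps)
    finally show ?thesis .
  qed
  then have "cmult (\<psi>h a) f = cmult f (\<psi>h a)" if "a \<in> A" for a using that by blast
  then show "f \<in> centralizer D (\<psi> ` A)"
    using f by (auto simp: centralizer_def mult_D \<psi>_carrier \<psi>h_eq)
qed

abbreviation J where "J \<equiv> dual_to_end scale \<Delta> C V"

lemma J_V: "f \<in> carrier D \<Longrightarrow> v \<in> V \<Longrightarrow> J f v \<in> V"
  by (simp add: dual_to_end_eq hit_V carrier_lin)

lemma J_coefficient:
  assumes "f \<in> carrier D" "v \<in> V" "lin \<xi>" shows "\<xi> (J f v) = f (hitl \<xi> v)"
proof -
  have "hitl \<xi> v \<in> C" by (rule hitl_mem[OF V_tensor_C[OF assms(2)] C_subspace assms(3)])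
  then show ?thesis
    using lin_hitl[OF carrier_lin[OF assms(1)], of \<xi> v] lin_hit[OF assms(3), of "\<lambda>x. f (P x)" v]
    by (simp add: dual_to_end_eq assms P_id)
qed

lemma J_sw:
  assumes "\<And>x y. \<Psi> x y \<in> carrier D" "v \<in> V" "lin \<xi>"
  shows "\<xi> (J (\<lambda>c. sw e (\<lambda>x y. \<Psi> x y c)) v) = sw e (\<lambda>x y. \<xi> (J (\<Psi> x y) v))"
  using J_coefficient[OF sw_carrier[OF assms(1)] assms(2,3)] J_coefficient[OF assms(1) assms(2,3)] by simp

text \<open>\<open>C\<^sup>*\<close> is a matrix algebra, so a tensor \<open>\<Sum> x \<otimes> y\<close> is determined by the map \<open>f \<mapsto> \<Sum> x f y\<close>.\<close>

lemma separate_tensors: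
  assumes X: "\<And>x. X x \<in> carrier D" and Y: "\<And>y. Y y \<in> carrier D"
    and X': "\<And>x. X' x \<in> carrier D" and Y': "\<And>y. Y' y \<in> carrier D"
    and eq: "\<And>f. f \<in> carrier D \<Longrightarrow>
      (\<lambda>c. sw e (\<lambda>x y. cmult (cmult (X x) f) (Y y) c)) = (\<lambda>c. sw e (\<lambda>x y. cmult (cmult (X' x) f) (Y' y) c))"
    and c: "c \<in> C" and d: "d \<in> C"
  shows "sw e (\<lambda>x y. X x c * Y y d) = sw e (\<lambda>x y. X' x c * Y' y d)"
proof -
  have lin_span: "k c = 0" if c: "c \<in> C" and k: "linear_on scale (*) C k"
    and 0: "\<And>g v. v \<in> V \<Longrightarrow> lin g \<Longrightarrow> k (hitl g v) = 0" for k :: "'h \<Rightarrow> 'k" and c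
  proof -
    obtain k' where k': "lin k'" "\<And>x. x \<in> C \<Longrightarrow> k' x = k x"
      using linear_extension_from_subspace[OF C_subspace k vector_space_times] by blast
    have "c \<in> span {hitl g v | g v. v \<in> V \<and> lin g}" using c C_coefficients by simp
    then have "k' c = 0"
    proof (induction rule: span_induct_alt)
      case base
      show ?case by (rule lmap_zero[OF k'(1)])
    next
      case (step r x y)
      then obtain g v where x: "x = hitl g v" "v \<in> V" "lin g" by blast
      have "x \<in> C" unfolding x by (rule hitl_mem[OF V_tensor_C[OF x(2)] C_subspace x(3)])
      then have "k' x = 0" using 0[OF x(2,3)] k'(2) x(1) by simp
      then show ?case using step lmap_add[OF k'(1)] lmap_scale[OF k'(1)] by simp
    qed
    then show ?thesis using k'(2)[OF c] by simp
  qed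
  have core: "sw e (\<lambda>x y. X x (hitl \<xi> v) * Y y (hitl \<phi> u)) = sw e (\<lambda>x y. X' x (hitl \<xi> v) * Y' y (hitl \<phi> u))"
    if v: "v \<in> V" "u \<in> V" and \<xi>: "lin \<xi>" "lin \<phi>" for v u \<xi> \<phi>
  proof -
    \<comment> \<open>An \<open>f\<close> acting as an operator of rank at most one: the entry of x
      f y then splits into an entry of x times an entry of y.\<close>
    have "linear_on scale scale V (\<lambda>z. scale (\<xi> z) u)"
      using \<xi>(1) by (simp add: linear_on_def scale_left_distrib)
    moreover have "(\<lambda>z. scale (\<xi> z) u) ` V \<subseteq> V" using v(2) V_subspace by (auto intro: subspace_scale)
    ultimately obtain f0 where f0: "lin f0" "\<And>z. z \<in> V \<Longrightarrow> hit f0 z = scale (\<xi> z) u" using hit_surj by blast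
    define f where "f = res f0"
    have f: "f \<in> carrier D" by (simp add: f_def res_carrier f0)
    have Jf: "J f z = scale (\<xi> z) u" if "z \<in> V" for z using that by (simp add: f_def dual_to_end_res f0)
    have side: "\<phi> (J (\<lambda>c. sw e (\<lambda>x y. cmult (cmult (X x) f) (Y y) c)) v) = sw e (\<lambda>x y. X x (hitl \<xi> v) * Y y (hitl \<phi> u))"
      if X: "\<And>x. X x \<in> carrier D" and Y: "\<And>y. Y y \<in> carrier D" for X Y :: "'h \<Rightarrow> 'h \<Rightarrow> 'k"
    proof -
      have "\<phi> (J (\<lambda>c. sw e (\<lambda>x y. cmult (cmult (X x) f) (Y y) c)) v) = sw e (\<lambda>x y. \<phi> (J (Y y) (J f (J (X x) v))))"
        by (subst J_sw) (simp_all add: cmult_closed X Y f v \<xi> dual_to_end_mult)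
      also have "\<dots> = sw e (\<lambda>x y. X x (hitl \<xi> v) * Y y (hitl \<phi> u))"
      proof (rule sw_cong)
        fix x y
        have "J (Y y) (scale k u) = scale k (J (Y y) u)" for k
          using lmap_scale[OF endo_hit[OF carrier_lin[OF Y]]] v
          by (simp add: dual_to_end_eq Y subspace_scale[OF V_subspace])
        then show "\<phi> (J (Y y) (J f (J (X x) v))) = X x (hitl \<xi> v) * Y y (hitl \<phi> u)"
          by (simp add: Jf J_V X v lmap_scale[OF \<xi>(2)] J_coefficient Y \<xi>)
      qed
      finally show ?thesis .
    qed
    show ?thesis using side[of X Y, OF X Y] side[of X' Y', OF X' Y'] eq[OF f] by simp
  qed
  have Lin: "linear_on scale (*) C (\<lambda>c. sw e (\<lambda>x y. X x c * Y y d) - sw e (\<lambda>x y. X' x c * Y' y d))" for d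
    using X X' by (simp add: carrier_D linear_on_def distrib_right sw_plus mult.assoc sw_cmult right_diff_distrib)
  have Lin': "linear_on scale (*) C (\<lambda>d. sw e (\<lambda>x y. X x c * Y y d) - sw e (\<lambda>x y. X' x c * Y' y d))" for c
    using Y Y' by (simp add: carrier_D linear_on_def distrib_left sw_plus mult.left_commute[where 'a='k] sw_cmult right_diff_distrib)
  have "sw e (\<lambda>x y. X x c * Y y d) - sw e (\<lambda>x y. X' x c * Y' y d) = 0"
  proof (rule lin_span[OF c Lin])
    fix \<xi> v assume v: "v \<in> V" "lin \<xi>"
    show "sw e (\<lambda>x y. X x (hitl \<xi> v) * Y y d) - sw e (\<lambda>x y. X' x (hitl \<xi> v) * Y' y d) = 0"
      by (rule lin_span[OF d Lin']) (use core v in simp)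
  qed
  then show ?thesis by simp
qed

lemma centralizer_invariants: "centralizer D invariants = \<psi> ` A"
proof (intro equalityI subsetI)
  fix T assume "T \<in> \<psi> ` A"
  then obtain a where a: "a \<in> A" "T = \<psi> a" by blast
  have "f \<otimes>\<^bsub>D\<^esub> T = T \<otimes>\<^bsub>D\<^esub> f" if "f \<in> invariants" for f
    using that a unfolding centralizer_\<psi>[symmetric] by (simp add: centralizer_def)
  then show "T \<in> centralizer D invariants"
    using a by (auto simp: centralizer_def \<psi>_carrier)
next
  fix T assume "T \<in> centralizer D invariants"
  then have T: "T \<in> carrier D" and comm: "\<And>f. f \<in> invariants \<Longrightarrow> cmult T f = cmult f T"
    by (auto simp: centralizer_def mult_D invariants_def)
  obtain e where e: "left_integral A e" "\<epsilon> e = 1" using normalised_integral_exists[OF ss A] by blast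
  have ae: "a * e = scale (\<epsilon> a) e" if "a \<in> A" for a using e that by (auto simp: left_integral_def)
  have eA: "e \<in> A" using e by (simp add: left_integral_def)
  have e0: "e \<noteq> 0" using e(2) lmap_zero[OF lin_counit] by auto
  have avg: "act e f \<in> invariants" if f: "f \<in> carrier D" for f
    using act_carrier[OF f] by (auto simp: invariants_def act_act ae act_add f)
  have sep: "sw e (\<lambda>x y. cmult T (\<psi>h x) c * \<psi>h' y d) = sw e (\<lambda>x y. \<psi>h x c * cmult (\<psi>h' y) T d)"
    if "c \<in> C" "d \<in> C" for c d
  proof (rule separate_tensors[OF _ _ _ _ _ that])
    fix f assume f: "f \<in> carrier D"
    have "(\<lambda>c. sw e (\<lambda>x y. cmult (cmult (cmult T (\<psi>h x)) f) (\<psi>h' y) c)) = cmult T (act e f)"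
      by (simp only: action[OF eA f] cmult_sw_right cmult_assoc closed f T)
    also have "\<dots> = cmult (act e f) T" by (rule comm[OF avg[OF f]])
    also have "\<dots> = (\<lambda>c. sw e (\<lambda>x y. cmult (cmult (\<psi>h x) f) (cmult (\<psi>h' y) T) c))"
      by (simp only: action[OF eA f] cmult_sw_left cmult_assoc closed f T)
    finally show "(\<lambda>c. sw e (\<lambda>x y. cmult (cmult (cmult T (\<psi>h x)) f) (\<psi>h' y) c))
      = (\<lambda>c. sw e (\<lambda>x y. cmult (cmult (\<psi>h x) f) (cmult (\<psi>h' y) T) c))" .
  qed (simp_all add: closed T)
  have l': "lin (\<lambda>y. \<psi>h' y c)" for c by (simp add: \<psi>_simps)
  have lT: "lin (\<lambda>y. cmult (\<psi>h' y) T c)" for c by (simp add: \<psi>_simps)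
  have lT': "lin (\<lambda>y. cmult T (\<psi>h y) c)" for c by (simp add: \<psi>_simps)
  have l: "lin (\<lambda>y. \<psi>h y c)" for c by (simp add: \<psi>_simps)
  \<comment> \<open>What remains of \<open>e\<close> in its first leg when \<psi>' of the second is
    evaluated at \<open>c\<close>. For a \<open>d\<close> with \<open>\<kappa> d = 1\<close> the
    left side of \<open>sep\<close> becomes \<open>T c\<close>, since \<psi>(1) = 1.\<close>
  define \<kappa> where "\<kappa> c = hitl (\<lambda>y. \<psi>h' y c) e" for c
  have "1 \<in> \<kappa> ` C"
  proof (rule mem_if_functionals)
    have \<psi>C: "\<psi>h' y (c + d) = \<psi>h' y c + \<psi>h' y d" "\<psi>h' y (scale k c) = k * \<psi>h' y c"
      if "c \<in> C" "d \<in> C" for y c d k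
      using that \<psi>h'_carrier[of y] by (auto simp: carrier_D linear_on_def)
    have \<kappa>_add: "\<kappa> (c + d) = \<kappa> c + \<kappa> d" if cd: "c \<in> C" "d \<in> C" for c d
    proof (rule eq_if_functionals)
      fix f assume f: "lin f"
      show "f (\<kappa> (c + d)) = f (\<kappa> c + \<kappa> d)"
        by (simp add: \<kappa>_def lmap_add[OF f] lin_hitl[OF f] \<psi>C[OF cd] distrib_left sw_plus)
    qed
    have \<kappa>_scale: "\<kappa> (scale k c) = scale k (\<kappa> c)" if c: "c \<in> C" for c k
    proof (rule eq_if_functionals)
      fix f assume f: "lin f"
      show "f (\<kappa> (scale k c)) = f (scale k (\<kappa> c))"
        by (simp add: \<kappa>_def lmap_scale[OF f] lin_hitl[OF f] \<psi>C[OF c c] mult.left_commute[where 'a='k] sw_cmult)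
    qed
    show "subspace (\<kappa> ` C)"
    proof (unfold subspace_def, intro conjI ballI allI)
      have "\<kappa> 0 = 0" using \<kappa>_scale[OF subspace_0[OF C_subspace], of 0] by simp
      then show "0 \<in> \<kappa> ` C" using subspace_0[OF C_subspace] by force
    next
      fix x y assume "x \<in> \<kappa> ` C" "y \<in> \<kappa> ` C"
      then obtain c d where cd: "c \<in> C" "d \<in> C" "x = \<kappa> c" "y = \<kappa> d" by blast
      then have "x + y = \<kappa> (c + d)" by (simp only: \<kappa>_add)
      then show "x + y \<in> \<kappa> ` C" using subspace_add[OF C_subspace cd(1,2)] by blast
    next
      fix k x assume "x \<in> \<kappa> ` C"
      then obtain c where c: "c \<in> C" "x = \<kappa> c" by blast
      then have "scale k x = \<kappa> (scale k c)" by (simp only: \<kappa>_scale)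
      then show "scale k x \<in> \<kappa> ` C" using subspace_scale[OF C_subspace c(1)] by blast
    qed
    fix f assume f: "lin f" and 0: "\<And>y. y \<in> \<kappa> ` C \<Longrightarrow> f y = 0"
    have hA: "hit f e \<in> A" by (rule hit_mem[OF Ain(2)[OF eA] Ain(1) f])
    have "\<psi>' (hit f e) c = 0" for c
    proof (cases "c \<in> C")
      case True
      have "\<psi>h' (hit f e) c = f (\<kappa> c)" unfolding \<kappa>_def by (simp add: lin_hit[OF l'] lin_hitl[OF f])
      then show ?thesis using 0 True by (simp add: \<psi>h'_eq hA)
    next
      case False
      then show ?thesis using carrier_off[OF \<psi>'_carrier[OF hA]] by simp
    qed
    from \<psi>'_faithful[OF hA this] have h0: "hit f e = 0" .
    \<comment> \<open>A functional \<open>f\<close> that kills the image of \<kappa> has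
      \<open>hit f e = 0\<close>. Some contraction e1 k(S(e2)) is 1, so f(1) = k(S(hit f e)) is 0 as
      well, and 1 lies in the image.\<close>
    obtain k where k: "lin k" "hitl (\<lambda>y. k (S y)) e = 1" using integral_left_leg_one[OF A e(1) e0] by blast
    have kS: "lin (\<lambda>y. k (S y))" using k(1) by (simp add: lin_simps)
    have "f 1 = k (S (hit f e))" using lin_hitl[OF f, of "\<lambda>y. k (S y)" e] lin_hit[OF kS, of f e] k(2) by simp
    then show "f 1 = 0" using h0 lmap_zero[OF kS] by simp
  qed
  then obtain d where d: "d \<in> C" "\<kappa> d = 1" by auto
  define b where "b = hitl (\<lambda>y. cmult (\<psi>h' y) T d) e"
  have bA: "b \<in> A" unfolding b_def by (rule hitl_mem[OF Ain(2)[OF eA] Ain(1) lT])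
  have "T = \<psi> b"
  proof
    fix c
    show "T c = \<psi> b c"
    proof (cases "c \<in> C")
      case True
      have "T c = cmult T (\<psi>h (\<kappa> d)) c" using d(2) by (simp add: \<psi>h_eq Ain \<psi>_one cmult_one T)
      also have "\<dots> = sw e (\<lambda>x y. cmult T (\<psi>h x) c * \<psi>h' y d)" unfolding \<kappa>_def by (rule lin_hitl[OF lT'])
      also have "\<dots> = sw e (\<lambda>x y. \<psi>h x c * cmult (\<psi>h' y) T d)" by (rule sep[OF True d(1)])
      also have "\<dots> = \<psi>h b c" unfolding b_def by (rule lin_hitl[OF l, symmetric])
      finally show ?thesis by (simp add: \<psi>h_eq bA)
    next
      case False
      then show ?thesis using carrier_off[OF T] carrier_off[OF \<psi>_carrier[OF bA]] by simp
    qed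
  qed
  then show "T \<in> \<psi> ` A" using bA by blast
qed

end

section \<open>The quotient coalgebra and the commuting pair\<close>

locale quotient_setting = implemented_action scale \<Delta> \<epsilon> S C V B0 P A PA \<psi> \<psi>'
  for scale :: "'k::alg_closed_field \<Rightarrow> 'h::ring_1 \<Rightarrow> 'h"
    and \<Delta> :: "'h \<Rightarrow> ('h \<times> 'h \<Rightarrow>\<^sub>0 'k)" and \<epsilon> :: "'h \<Rightarrow> 'k" and S :: "'h \<Rightarrow> 'h"
    and C V B0 :: "'h set" and P :: "'h \<Rightarrow> 'h" and A :: "'h set" and PA :: "'h \<Rightarrow> 'h"
    and \<psi> \<psi>' :: "'h \<Rightarrow> 'h \<Rightarrow> 'k" +
  fixes scaleQ :: "'k \<Rightarrow> 'q::ab_group_add \<Rightarrow> 'q" and Q :: "'q set"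
    and \<Delta>Q :: "'q \<Rightarrow> ('q \<times> 'q \<Rightarrow>\<^sub>0 'k)" and \<epsilon>Q :: "'q \<Rightarrow> 'k" and p :: "'h \<Rightarrow> 'q"
  assumes quotient: "quotient_coalgebra scale \<Delta> \<epsilon> (left_ideal_plus scale \<epsilon> A) scaleQ Q \<Delta>Q \<epsilon>Q p"
begin

abbreviation Cbar where "Cbar \<equiv> p ` C"
abbreviation DQ where "DQ \<equiv> dual_algebra scaleQ \<Delta>Q \<epsilon>Q Cbar"
abbreviation linQ where "linQ \<equiv> lmap scaleQ (*)"

lemma vsQ: "vector_space scaleQ"
  using quotient by (simp add: quotient_coalgebra_def coalgebra_on_def)

interpretation vq: vector_space scaleQ by (rule vsQ)

lemma p_linear: "lmap scale scaleQ p"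
  using quotient by (simp add: quotient_coalgebra_def lmap_iff_linear[OF vector_space_axioms vsQ])

lemma p_kernel: "p h = 0 \<longleftrightarrow> h \<in> left_ideal_plus scale \<epsilon> A"
  and p_comult: "tensor_eq scaleQ scaleQ (\<Delta>Q (p h)) (tensor_map p p (\<Delta> h))"
  and p_counit: "\<epsilon>Q (p h) = \<epsilon> h"
  using quotient by (auto simp: quotient_coalgebra_def)

lemma lin_p: "linQ F \<Longrightarrow> lin (\<lambda>x. F (p x))"
  by (rule lmap_compose[OF p_linear])

lemma Cbar_subspace: "vq.subspace Cbar"
  by (rule subspace_image[OF vector_space_axioms vsQ p_linear C_subspace])

lemma carrier_DQ: "f \<in> carrier DQ \<longleftrightarrow> linear_on scaleQ (*) Cbar f \<and> (\<forall>x. x \<notin> Cbar \<longrightarrow> f x = 0)"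
  by (simp add: dual_algebra_def)

lemma extend_DQ:
  assumes "f \<in> carrier DQ"
  obtains F where "linQ F" "\<And>x. x \<in> Cbar \<Longrightarrow> F x = f x"
  using vq.linear_extension_from_subspace[OF Cbar_subspace _ vector_space_times] assms carrier_DQ by blast

abbreviation t where "t \<equiv> transpose_on C p"

lemma t_eq: "(\<And>x. x \<in> Cbar \<Longrightarrow> F x = f x) \<Longrightarrow> t f = res (\<lambda>x. F (p x))"
  by (auto simp: transpose_on_def res_def)

lemma t_image: "t ` carrier DQ = {res (\<lambda>x. F (p x)) | F. linQ F}"
proof (intro equalityI subsetI)
  fix x assume "x \<in> t ` carrier DQ"
  then obtain f where f: "f \<in> carrier DQ" "x = t f" by blast
  obtain F where "linQ F" "\<And>x. x \<in> Cbar \<Longrightarrow> F x = f x" using extend_DQ[OF f(1)] by blast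
  then show "x \<in> {res (\<lambda>x. F (p x)) | F. linQ F}" using t_eq[of F f] f(2) by blast
next
  fix x assume "x \<in> {res (\<lambda>x. F (p x)) | F. linQ F}"
  then obtain F where F: "linQ F" "x = res (\<lambda>x. F (p x))" by blast
  define f where "f = (\<lambda>x. if x \<in> Cbar then F x else 0)"
  have "f \<in> carrier DQ"
    using F(1) vq.subspace_add[OF Cbar_subspace] vq.subspace_scale[OF Cbar_subspace]
    unfolding carrier_DQ linear_on_def f_def by simp
  moreover have "x = t f" unfolding F(2) by (rule t_eq[symmetric]) (simp add: f_def)
  ultimately show "x \<in> t ` carrier DQ" by blast
qed

lemma t_carrier:
  assumes "f \<in> carrier DQ" shows "t f \<in> carrier D"
proof -
  obtain F where F: "linQ F" "\<And>x. x \<in> Cbar \<Longrightarrow> F x = f x" using extend_DQ[OF assms] by blast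
  have "t f = res (\<lambda>x. F (p x))" by (rule t_eq[OF F(2)])
  then show ?thesis using res_carrier[OF lin_p[OF F(1)]] by simp
qed

lemma lin_ext_p:
  assumes "linQ F" "linQ G"
  shows "lin_ext (*) (\<lambda>(x, y). F x * G y) (\<Delta>Q (p c)) = sw c (\<lambda>x y. F (p x) * G (p y))"
proof -
  have "bilin scaleQ scaleQ (*) (\<lambda>x y. F x * G y)"
    using assms by (simp add: bilin_def lmap_iff algebra_simps)
  then have "lin_ext (*) (\<lambda>(x, y). F x * G y) (\<Delta>Q (p c)) = lin_ext (*) (\<lambda>(x, y). F x * G y) (tensor_map p p (\<Delta> c))"
    by (intro lin_ext_tensor_eq[OF p_comult vector_space_times]) simp
  then show ?thesis by (simp add: lin_ext_tensor_map[OF vector_space_times] sw_def)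
qed

lemma Cbar_tensor:
  assumes c: "c \<in> C" shows "tensor_in scaleQ scaleQ Cbar Cbar (\<Delta>Q (p c))"
proof -
  obtain u where u: "Poly_Mapping.keys u \<subseteq> C \<times> C" "tensor_eq scale scale u (\<Delta> c)"
    using C_tensor[OF c] by (auto simp: tensor_in_def)
  have "tensor_eq scaleQ scaleQ (tensor_map p p u) (\<Delta>Q (p c))"
  proof (rule tensor_eq_if_functionals[OF vsQ vsQ])
    fix F G assume FG: "linQ F" "linQ G"
    have "blin (\<lambda>x y. F (p x) * G (p y))" using lin_p[OF FG(1)] lin_p[OF FG(2)] by (simp add: lin_simps)
    then have "lin_ext (*) (\<lambda>(x, y). F (p x) * G (p y)) u = sw c (\<lambda>x y. F (p x) * G (p y))"
      unfolding sw_def by (intro lin_ext_tensor_eq[OF u(2) vector_space_times]) simp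
    then show "lin_ext (*) (\<lambda>(x, y). F x * G y) (tensor_map p p u) = lin_ext (*) (\<lambda>(x, y). F x * G y) (\<Delta>Q (p c))"
      by (simp add: lin_ext_tensor_map[OF vector_space_times] lin_ext_p[OF FG])
  qed
  moreover have "Poly_Mapping.keys (tensor_map p p u) \<subseteq> Cbar \<times> Cbar"
    by (rule keys_tensor_map[OF u(1)]) auto
  ultimately show ?thesis by (auto simp: tensor_in_def)
qed

lemma t_mult:
  assumes f: "f \<in> carrier DQ" and g: "g \<in> carrier DQ"
  shows "t (f \<otimes>\<^bsub>DQ\<^esub> g) = cmult (t f) (t g)"
proof
  fix c
  obtain F where F: "linQ F" "\<And>x. x \<in> Cbar \<Longrightarrow> F x = f x" using extend_DQ[OF f] by blast
  obtain G where G: "linQ G" "\<And>x. x \<in> Cbar \<Longrightarrow> G x = g x" using extend_DQ[OF g] by blast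
  show "t (f \<otimes>\<^bsub>DQ\<^esub> g) c = cmult (t f) (t g) c"
  proof (cases "c \<in> C")
    case True
    have "(f \<otimes>\<^bsub>DQ\<^esub> g) (p c) = lin_ext (*) (\<lambda>(x, y). f x * g y) (tensor_restrict scaleQ scaleQ Cbar Cbar (\<Delta>Q (p c)))"
      using True by (simp add: dual_algebra_def)
    also have "\<dots> = lin_ext (*) (\<lambda>(x, y). F x * G y) (\<Delta>Q (p c))"
      by (rule lin_ext_tensor_restrict[OF Cbar_tensor[OF True] vector_space_times])
        (use F G in \<open>auto simp: bilin_def lmap_iff algebra_simps\<close>)
    also have "\<dots> = sw c (\<lambda>x y. F (p x) * G (p y))" by (rule lin_ext_p[OF F(1) G(1)])
    also have "\<dots> = cmult (t f) (t g) c"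
      using True cmult_res[OF lin_p[OF F(1)] lin_p[OF G(1)]] t_eq[of F f, OF F(2)] t_eq[of G g, OF G(2)]
      by (simp add: res_def)
    finally show ?thesis using True by (simp add: transpose_on_def)
  qed (simp add: transpose_on_def cmult_def)
qed

lemma t_hom: "t \<in> algebra_hom DQ D"
  unfolding algebra_hom_def
proof (intro CollectI conjI allI ballI ring_hom_memI)
  show "t (f \<otimes>\<^bsub>DQ\<^esub> g) = t f \<otimes>\<^bsub>D\<^esub> t g" if "f \<in> carrier DQ" "g \<in> carrier DQ" for f g
    using that by (simp add: t_mult mult_D t_carrier)
  show "t \<one>\<^bsub>DQ\<^esub> = \<one>\<^bsub>D\<^esub>"
    by (auto simp: transpose_on_def dual_algebra_def p_counit)
qed (auto simp: t_carrier, auto simp: transpose_on_def dual_algebra_def fun_scale_def)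

lemma t_inj: "inj_on t (carrier DQ)"
proof (rule inj_onI)
  fix f g assume fg: "f \<in> carrier DQ" "g \<in> carrier DQ" "t f = t g"
  show "f = g"
  proof
    fix x
    show "f x = g x"
    proof (cases "x \<in> Cbar")
      case True
      then obtain c where c: "c \<in> C" "x = p c" by blast
      then show ?thesis using fun_cong[OF fg(3), of c] by (simp add: transpose_on_def)
    next
      case False
      then show ?thesis using fg(1,2) by (simp add: carrier_DQ)
    qed
  qed
qed

text \<open>c a and \<epsilon>(a) c have the same image under \<open>p\<close>, so transposes are
  invariant. Conversely an invariant \<open>f\<close> equals e.f, and x e = 0 on the kernel of
  \<open>p\<close>; hence \<open>f\<close> vanishes on the kernel within \<open>C\<close> and
  descends.\<close>

lemma t_invariants: "t ` carrier DQ = invariants"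
proof (intro equalityI subsetI)
  fix f assume "f \<in> t ` carrier DQ"
  then obtain F where F: "linQ F" "f = res (\<lambda>x. F (p x))" using t_image by blast
  have "act a f c = \<epsilon> a * f c" if a: "a \<in> A" for a c
  proof (cases "c \<in> C")
    case True
    let ?a = "a + scale (- \<epsilon> a) 1"
    have "?a \<in> A" using a Ain(1,3) by (intro subspace_add subspace_scale)
    moreover have "\<epsilon> ?a = 0" by (simp add: counit_one counit_scale lmap_diff[OF lin_counit])
    ultimately have "c * ?a \<in> left_ideal_plus scale \<epsilon> A"
      unfolding left_ideal_plus_def by (intro span_base) blast
    then have "p (c * ?a) = 0" by (simp only: p_kernel)
    then have "p (c * a) = scaleQ (\<epsilon> a) (p c)"
      by (simp add: right_diff_distrib scale_mult_right lmap_diff[OF p_linear] lmap_scale[OF p_linear])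
    then show ?thesis
      using True a by (simp add: act_def F(2) res_def CA P_id lmap_scale[OF F(1)])
  next
    case False
    then show ?thesis by (simp add: act_def F(2) res_def)
  qed
  then show "f \<in> invariants"
    using res_carrier[OF lin_p[OF F(1)]] F(2) by (auto simp: invariants_def)
next
  fix f assume "f \<in> invariants"
  then have f: "f \<in> carrier D" and inv: "\<And>a. a \<in> A \<Longrightarrow> act a f = (\<lambda>c. \<epsilon> a * f c)"
    by (auto simp: invariants_def)
  obtain e where e: "left_integral A e" "\<epsilon> e = 1" using normalised_integral_exists[OF ss A] by blast
  have eA: "e \<in> A" using e by (simp add: left_integral_def)
  have fC: "f (x + y) = f x + f y" "f (scale k x) = k * f x" if "x \<in> C" "y \<in> C" for x y k
    using f that by (auto simp: carrier_D linear_on_def)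
  have vanish: "f x = 0" if x: "x \<in> C" "p x = 0" for x
  proof -
    have "x \<in> span {h * a | h a. a \<in> A \<and> \<epsilon> a = 0}"
      using x(2) by (simp add: p_kernel left_ideal_plus_def)
    then have "x * e = 0"
    proof (induction rule: span_induct_alt)
      case base
      show ?case by simp
    next
      case (step k y z)
      then obtain h a where "y = h * a" "a \<in> A" "\<epsilon> a = 0" by blast
      then have "y * e = 0" using e by (simp add: left_integral_def mult.assoc)
      then show ?case using step by (simp add: distrib_right scale_mult_left)
    qed
    then have "act e f x = 0" using x(1) f fC(2)[OF subspace_0[OF C_subspace] subspace_0[OF C_subspace], of 0]
      by (simp add: act_def P_zero)
    then show ?thesis using inv[OF eA] e(2) by simp
  qed
  \<comment> \<open>A preimage in \<open>C\<close> is chosen; \<open>vanish\<close> makes the value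
    independent of it.\<close>
  define g where "g q = (if q \<in> Cbar then f (inv_into C p q) else 0)" for q
  have g: "g (p c) = f c" if c: "c \<in> C" for c
  proof -
    let ?d = "inv_into C p (p c)"
    have d: "?d \<in> C" "p ?d = p c" using c by (auto intro: inv_into_into f_inv_into_f)
    have "c + scale (- 1) ?d \<in> C" using c d C_subspace by (intro subspace_add subspace_scale)
    moreover have "p (c + scale (- 1) ?d) = 0"
      using d by (simp add: lmap_diff[OF p_linear])
    ultimately have "f (c + scale (- 1) ?d) = 0" by (rule vanish)
    then have "f c + - 1 * f ?d = 0"
      using fC(1)[OF c subspace_scale[OF C_subspace d(1)], of "- 1"] fC(2)[OF d(1) d(1), of "- 1"] by simp
    then show ?thesis using c by (simp add: g_def)
  qed
  have "g \<in> carrier DQ"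
    unfolding carrier_DQ linear_on_def
  proof (intro conjI ballI allI impI)
    fix x y assume "x \<in> Cbar" "y \<in> Cbar"
    then obtain c d where cd: "c \<in> C" "d \<in> C" "x = p c" "y = p d" by blast
    have "g (p (c + d)) = g (p c) + g (p d)"
      using g[OF subspace_add[OF C_subspace cd(1,2)]] g[OF cd(1)] g[OF cd(2)] fC(1)[OF cd(1,2)] by simp
    then show "g (x + y) = g x + g y" using cd by (simp add: lmap_add[OF p_linear])
  next
    fix k x assume "x \<in> Cbar"
    then obtain c where c: "c \<in> C" "x = p c" by blast
    have "g (p (scale k c)) = k * g (p c)"
      using g[OF subspace_scale[OF C_subspace c(1)]] g[OF c(1)] fC(2)[OF c(1) c(1)] by simp
    then show "g (scaleQ k x) = k * g x" using c by (simp add: lmap_scale[OF p_linear])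
  qed (simp add: g_def)
  moreover have "f = t g"
    using g carrier_off[OF f] by (auto simp: transpose_on_def)
  ultimately show "f \<in> t ` carrier DQ" by blast
qed

section \<open>Endomorphisms of the comodule over the quotient\<close>

abbreviation M where "M \<equiv> comodule_end_op scaleQ scale V (\<lambda>v. tensor_map p id (coaction scale \<Delta> C V v))"

text \<open>Tested with F \<otimes> g, one side of the colinearity equation lets the functional F
  after \<open>p\<close> act behind \<open>J f\<close>, the other lets it act before. So colinearity
  means commutation with all transposes, carried back through the injective
  \<open>J\<close>.\<close>

lemma colinear_iff:
  assumes f: "f \<in> carrier D"
  shows "(\<forall>v\<in>V. tensor_eq scaleQ scale (tensor_map p id (coaction scale \<Delta> C V (J f v)))
      (tensor_map id (J f) (tensor_map p id (coaction scale \<Delta> C V v)))) \<longleftrightarrow>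
    (\<forall>F. linQ F \<longrightarrow> cmult (res (\<lambda>x. F (p x))) f = cmult f (res (\<lambda>x. F (p x))))"
proof -
  have left: "lin_ext (*) (\<lambda>(x, y). F x * g y) (tensor_map p id (coaction scale \<Delta> C V (J f v)))
      = g (J (res (\<lambda>x. F (p x))) (J f v))" (is "?L = _")
    if F: "linQ F" and g: "lin g" and v: "v \<in> V" for F g v
  proof -
    have w: "J f v \<in> V" by (rule J_V[OF f v])
    have "?L = lin_ext (*) (\<lambda>(x, y). F (p x) * g y) (tensor_restrict scale scale C V (\<Delta> (J f v)))"
      by (simp add: lin_ext_tensor_map[OF vector_space_times] coaction_def)
    also have "\<dots> = sw (J f v) (\<lambda>x y. F (p x) * g y)"
      unfolding sw_def by (rule lin_ext_tensor_restrict[OF V_tensor_C[OF w] vector_space_times])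
        (use lin_p[OF F] g in \<open>simp_all add: lin_simps\<close>)
    also have "\<dots> = g (J (res (\<lambda>x. F (p x))) (J f v))"
      by (simp add: dual_to_end_res[OF lin_p[OF F] w] lin_hit[OF g])
    finally show ?thesis .
  qed
  have right: "lin_ext (*) (\<lambda>(x, y). F x * g y) (tensor_map id (J f) (tensor_map p id (coaction scale \<Delta> C V v)))
      = g (J f (J (res (\<lambda>x. F (p x))) v))" (is "?L = _")
    if F: "linQ F" and g: "lin g" and v: "v \<in> V" for F g v
  proof -
    have l: "lin (\<lambda>y. g (hit (\<lambda>x. f (P x)) y))" by (rule lmap_compose[OF endo_hit[OF carrier_lin[OF f]] g])
    have "?L = lin_ext (*) (\<lambda>(x, y). F (p x) * g (J f y)) (tensor_restrict scale scale C V (\<Delta> v))"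
      by (simp add: lin_ext_tensor_map[OF vector_space_times] coaction_def case_prod_unfold)
    also have "\<dots> = sw v (\<lambda>x y. F (p x) * g (hit (\<lambda>x. f (P x)) y))"
      unfolding sw_def by (rule lin_ext_tensor_restrict[OF V_tensor_C[OF v] vector_space_times])
        (use lin_p[OF F] l in \<open>simp_all add: lin_simps dual_to_end_eq[OF f]\<close>)
    also have "\<dots> = g (hit (\<lambda>x. f (P x)) (hit (\<lambda>x. F (p x)) v))" by (rule lin_hit[OF l, symmetric])
    also have "\<dots> = g (J f (J (res (\<lambda>x. F (p x))) v))"
      by (simp add: dual_to_end_res[OF lin_p[OF F] v] dual_to_end_eq[OF f hit_V[OF v lin_p[OF F]]])
    finally show ?thesis .
  qed
  have comm: "cmult (res (\<lambda>x. F (p x))) f = cmult f (res (\<lambda>x. F (p x))) \<longleftrightarrow>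
      (\<forall>v\<in>V. J (res (\<lambda>x. F (p x))) (J f v) = J f (J (res (\<lambda>x. F (p x))) v))" if F: "linQ F" for F
  proof -
    let ?r = "res (\<lambda>x. F (p x))"
    have r: "?r \<in> carrier D" by (rule res_carrier[OF lin_p[OF F]])
    have "cmult ?r f = cmult f ?r \<longleftrightarrow> J (cmult ?r f) = J (cmult f ?r)"
      using inj_on_eq_iff[OF dual_to_end_inj] cmult_closed r f by metis
    also have "\<dots> \<longleftrightarrow> (\<forall>v\<in>V. J (cmult ?r f) v = J (cmult f ?r) v)"
      by (auto simp: fun_eq_iff dual_to_end_def)
    also have "\<dots> \<longleftrightarrow> (\<forall>v\<in>V. J ?r (J f v) = J f (J ?r v))"
      by (auto simp: dual_to_end_mult[OF r f] dual_to_end_mult[OF f r])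
    finally show ?thesis .
  qed
  have func: "(\<forall>g. lin g \<longrightarrow> g x = g y) \<longleftrightarrow> x = y" for x y using eq_if_functionals by blast
  have "(\<forall>v\<in>V. tensor_eq scaleQ scale (tensor_map p id (coaction scale \<Delta> C V (J f v)))
      (tensor_map id (J f) (tensor_map p id (coaction scale \<Delta> C V v)))) \<longleftrightarrow>
    (\<forall>v\<in>V. \<forall>F. linQ F \<longrightarrow> (\<forall>g. lin g \<longrightarrow> g (J (res (\<lambda>x. F (p x))) (J f v)) = g (J f (J (res (\<lambda>x. F (p x))) v))))"
    unfolding tensor_eq_iff_functionals[OF vsQ vector_space_axioms] using left right by auto
  also have "\<dots> \<longleftrightarrow> (\<forall>F. linQ F \<longrightarrow> (\<forall>v\<in>V. J (res (\<lambda>x. F (p x))) (J f v) = J f (J (res (\<lambda>x. F (p x))) v)))"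
    unfolding func by blast
  also have "\<dots> \<longleftrightarrow> (\<forall>F. linQ F \<longrightarrow> cmult (res (\<lambda>x. F (p x))) f = cmult f (res (\<lambda>x. F (p x))))"
    using comm by blast
  finally show ?thesis .
qed

lemma carrier_M: "carrier M = J ` \<psi> ` A"
proof -
  have J: "bij_betw J (carrier D) (carrier (end_op scale V))"
    using dual_to_end_iso by (simp add: algebra_iso_def)
  have C: "\<psi> ` A = {f \<in> carrier D. \<forall>F. linQ F \<longrightarrow> cmult (res (\<lambda>x. F (p x))) f = cmult f (res (\<lambda>x. F (p x)))}"
  proof -
    have "\<psi> ` A = centralizer D (t ` carrier DQ)" by (simp add: t_invariants centralizer_invariants)
    also have "\<dots> = {f \<in> carrier D. \<forall>F. linQ F \<longrightarrow> cmult (res (\<lambda>x. F (p x))) f = cmult f (res (\<lambda>x. F (p x)))}"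
      unfolding t_image centralizer_def using mult_D res_carrier[OF lin_p] by auto
    finally show ?thesis .
  qed
  have "carrier M = {T \<in> J ` carrier D. \<forall>v\<in>V. tensor_eq scaleQ scale (tensor_map p id (coaction scale \<Delta> C V (T v)))
      (tensor_map id T (tensor_map p id (coaction scale \<Delta> C V v)))}"
    using J by (simp add: comodule_end_op_def bij_betw_def)
  also have "\<dots> = J ` {f \<in> carrier D. \<forall>F. linQ F \<longrightarrow> cmult (res (\<lambda>x. F (p x))) f = cmult f (res (\<lambda>x. F (p x)))}"
    using colinear_iff by blast
  finally show ?thesis by (simp add: C)
qed

text \<open>\<open>J\<close> reverses composition, so \<open>J \<circ> \<psi>\<close> is
  multiplicative into the opposite algebra; its inverse on the image is the isomorphism.\<close>

lemma comodule_end_iso: "\<exists>\<Phi>. \<Phi> \<in> algebra_iso M A\<alpha>"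
proof -
  have Jh: "J \<in> algebra_hom D (end_op scale V)" using dual_to_end_iso by (simp add: algebra_iso_def)
  have cA: "carrier A\<alpha> = A" by (simp add: crossed_product_def)
  have "J \<circ> \<psi> \<in> algebra_hom A\<alpha> (end_op scale V)"
    using ring_hom_trans[of \<psi> A\<alpha> D J "end_op scale V"] Jh \<psi>_hom \<psi>_carrier
    by (auto simp: algebra_hom_def cA)
  moreover have "bij_betw (J \<circ> \<psi>) (carrier A\<alpha>) (carrier M)"
    unfolding bij_betw_def carrier_M cA
    using comp_inj_on[OF \<psi>_inj inj_on_subset[OF dual_to_end_inj]] \<psi>_carrier by (auto simp: image_comp)
  ultimately have "inv_into (carrier A\<alpha>) (J \<circ> \<psi>) \<in> algebra_iso ((end_op scale V)\<lparr>carrier := carrier M\<rparr>) A\<alpha>"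
  proof (rule inverse_algebra_iso)
    show "x \<otimes>\<^bsub>A\<alpha>\<^esub> y \<in> carrier A\<alpha>" if "x \<in> carrier A\<alpha>" "y \<in> carrier A\<alpha>" for x y
      using that crossed_closed unfolding cA by blast
    show "x \<oplus>\<^bsub>A\<alpha>\<^esub> y \<in> carrier A\<alpha>" if "x \<in> carrier A\<alpha>" "y \<in> carrier A\<alpha>" for x y
      using that subspace_add[OF Ain(1)] by (simp add: crossed_product_def)
    show "c \<odot>\<^bsub>A\<alpha>\<^esub> x \<in> carrier A\<alpha>" if "x \<in> carrier A\<alpha>" for c x
      using that subspace_scale[OF Ain(1)] by (simp add: crossed_product_def)
    show "\<one>\<^bsub>A\<alpha>\<^esub> \<in> carrier A\<alpha>" by (simp add: crossed_product_def Ain(3))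
  qed
  moreover have "(end_op scale V)\<lparr>carrier := carrier M\<rparr> = M" by (simp add: comodule_end_op_def)
  ultimately show ?thesis by auto
qed

end

theorem proposition3p2p3:
  fixes scale :: "'k::{alg_closed_field, field_char_0} \<Rightarrow> 'h::ring_1 \<Rightarrow> 'h"
    and \<Delta> :: "'h \<Rightarrow> ('h \<times> 'h \<Rightarrow>\<^sub>0 'k)" and \<epsilon> :: "'h \<Rightarrow> 'k" and S :: "'h \<Rightarrow> 'h"
    and A C V :: "'h set"
    and scaleQ :: "'k \<Rightarrow> 'q::ab_group_add \<Rightarrow> 'q"
    and Q :: "'q set" and \<Delta>Q :: "'q \<Rightarrow> ('q \<times> 'q \<Rightarrow>\<^sub>0 'k)" and \<epsilon>Q :: "'q \<Rightarrow> 'k"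
    and p :: "'h \<Rightarrow> 'q"
    and \<psi> \<psi>' :: "'h \<Rightarrow> 'h \<Rightarrow> 'k"
  defines "Cbar \<equiv> p ` C"
    and "\<alpha> \<equiv> cocycle scale \<Delta> \<epsilon> A C \<psi> \<psi>'"
    and "\<rho> \<equiv> coaction scale \<Delta> C V"
  assumes "hopf_algebra scale \<Delta> \<epsilon> S" and "semisimple_ring TYPE('h)"
    and "hopf_subalgebra scale \<Delta> S A"
    and "simple_subcoalgebra scale \<Delta> C" and "\<forall>c\<in>C. \<forall>a\<in>A. c * a \<in> C"
    and "irreducible_left_coideal scale \<Delta> V" and "V \<subseteq> C"
    and "quotient_coalgebra scale \<Delta> \<epsilon> (left_ideal_plus scale \<epsilon> A) scaleQ Q \<Delta>Q \<epsilon>Q p"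
    and "implements_action scale \<Delta> \<epsilon> A C \<psi> \<psi>'"
  shows
    "(\<exists>\<Phi>. \<Phi> \<in> algebra_iso (comodule_end_op scaleQ scale V (\<lambda>v. tensor_map p id (\<rho> v)))
                         (crossed_product scale \<Delta> A \<alpha>)) \<and>
     dual_to_end scale \<Delta> C V \<in> algebra_iso (dual_algebra scale \<Delta> \<epsilon> C) (end_op scale V) \<and>
     \<psi> \<in> algebra_hom (crossed_product scale \<Delta> A \<alpha>) (dual_algebra scale \<Delta> \<epsilon> C) \<and>
     inj_on \<psi> A \<and>
     transpose_on C p \<in> algebra_hom (dual_algebra scaleQ \<Delta>Q \<epsilon>Q Cbar) (dual_algebra scale \<Delta> \<epsilon> C) \<and>
     inj_on (transpose_on C p) (carrier (dual_algebra scaleQ \<Delta>Q \<epsilon>Q Cbar)) \<and>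
     centralizer (dual_algebra scale \<Delta> \<epsilon> C) (\<psi> ` A) =
       transpose_on C p ` carrier (dual_algebra scaleQ \<Delta>Q \<epsilon>Q Cbar) \<and>
     centralizer (dual_algebra scale \<Delta> \<epsilon> C)
       (transpose_on C p ` carrier (dual_algebra scaleQ \<Delta>Q \<epsilon>Q Cbar)) = \<psi> ` A"
proof -
  interpret H: hopf_algebra scale \<Delta> \<epsilon> S by fact
  obtain \<Lambda> where \<Lambda>: "H.left_integral UNIV \<Lambda>" "\<epsilon> \<Lambda> = 1" using H.semisimple_integral assms(5) by blast
  have "\<Lambda> \<noteq> 0" using \<Lambda>(2) lmap_zero[OF H.lin_counit] by auto
  then obtain B0 where B0: "finite B0" "UNIV \<subseteq> H.span B0"
    using H.integral_finite_dim[OF H.hopf_subalgebra_UNIV \<Lambda>(1)] by blast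
  have "H.subspace C" "H.subspace A"
    using assms(6,7) by (auto simp: simple_subcoalgebra_def subcoalgebra_def hopf_subalgebra_def)
  then obtain P PA where P: "lmap scale scale P" "\<And>x. P x \<in> C" "\<And>x. x \<in> C \<Longrightarrow> P x = x"
    and PA: "lmap scale scale PA" "\<And>x. PA x \<in> A" "\<And>x. x \<in> A \<Longrightarrow> PA x = x"
    using H.subspace_projection by metis
  interpret quotient_setting scale \<Delta> \<epsilon> S C V B0 P A PA \<psi> \<psi>' scaleQ Q \<Delta>Q \<epsilon>Q p
    by unfold_locales (use assms B0 P PA in auto)
  show ?thesis
    unfolding Cbar_def \<alpha>_def \<rho>_def
    using comodule_end_iso dual_to_end_iso \<psi>_hom \<psi>_inj t_hom t_inj
    by (simp add: t_invariants centralizer_\<psi> centralizer_invariants)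
qed

end
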